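(* Consider the partially labeled two-dimensional rearrangement problem (PTR) on a $k\times k$ lattice with $k$ types, $k$ items of each type, where $k$ is a perfect square, the initial configuration is a uniformly random arrangement of these $k^2$ items, and the goal configuration follows pattern $A$ or pattern $B$. Then PlanPTR computes valid plans with the minimum number of pick-n-swaps that are distance-optimal in the asymptotic sense in expectation: the expected end-effector travel of the PlanPTR plan divided by the expected minimum end-effector travel over all valid plans using the minimum number of pick-n-swaps tends to $1$ as $k\to\infty$.
   Context: Setting (PTR). A $k\times k$ lattice, the cell in row $r$, column $c$ located at $(r,c)\in\mathbb R^2$, each cell initially holding one item of a type in $\{1,\dots,k\}$; items of the same type are interchangeable. A goal configuration assigns a type to each cell (each type to $k$ cells); the goal is that finally every cell holds an item of its goal type. Pattern $A$: the lattice is partitioned into $k$ disjoint $\sqrt k\times\sqrt k$ square blocks and each block is the goal region of one type. Pattern $B$: each type's goal region is one full column. A robot end-effector holds at most one item and starts at the top-left cell $p_0$ holding nothing. A pick-n-swap at a cell $p$: if holding nothing, pick up the item in $p$; if holding an item and $p$ contains an item, exchange them; if holding an item and $p$ is empty, put it into $p$. A plan is a sequence of cells $P=(p_0,\dots,p_N)$ visited in order with a pick-n-swap at each of $p_1,\dots,p_N$, then a return to $p_{N+1}:=p_0$; it is valid if at the end every cell holds an item of its goal type and nothing is held. $N$ is its number of pick-n-swaps and $\sum_{i=0}^N\|p_i-p_{i+1}\|_2$ its end-effector travel. PlanPTR has three phases. (1) For each type $t$, build the complete bipartite graph between the cells initially holding a misplaced item of type $t$ and the goal cells of type $t$ not holding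 a type-$t$ item, with edge weights equal to the Euclidean distance, and compute a minimum-weight perfect matching; the resulting assignment of misplaced items to goal cells is a permutation of the misplaced cells whose cycles form the initial cycle set $C$. (2) Two cycles are mergeable if they contain items of the same type; merging is done by swapping the assigned goals of two same-type items in the two cycles. Build the graph on $C$ with an edge between each pair of mergeable cycles weighted by the additional travel distance incurred by the cheapest such goal swap, compute a minimum spanning forest, and merge the cycles of each tree into one cycle, yielding a cycle set $C'$ (this minimizes the number of pick-n-swaps). (3) Build a directed graph on $C'\cup\{p_0\}$ where the distance between two cycles $c_1,c_2$ is $\min_{v_1\in c_1,v_2\in c_2}\|v_1-v_2\|_2$ (and similarly for $p_0$), compute a directed minimum spanning tree rooted at $p_0$, and traverse it by a double covering starting and ending at $p_0$, cycle-following each cycle (pick up an item at an entry cell of the cycle, repeatedly carry the held item to its assigned goal cell and swap, and finally place the last item at the entry cell) when it is reached. *)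

theory Defs
  imports Complex_Main "HOL-Combinatorics.Permutations"
begin

type_synonym cell = "nat \<times> nat"   (* (row, column), 0-based *)

definition lattice :: "nat \<Rightarrow> cell set" where
  "lattice k = {0..<k} \<times> {0..<k}"

definition cdist :: "cell \<Rightarrow> cell \<Rightarrow> real" where
  "cdist p q = sqrt ((real (fst p) - real (fst q))^2 + (real (snd p) - real (snd q))^2)"

text \<open>Top-left cell, start of the end-effector.\<close>
definition p0 :: cell where "p0 = (0, 0)"

text \<open>Initial configurations: types 1..k, each type on exactly k cells; canonical value 0
  outside the lattice.  The uniformly random arrangement of the k^2 items induces the uniform
  distribution on this finite set.\<close>
definition configs :: "nat \<Rightarrow> (cell \<Rightarrow> nat) set" where
  "configs k = {f. (\<forall>c. c \<notin> lattice k \<longrightarrow> f c = 0) \<and> f ` lattice k \<subseteq> {1..k} \<and>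
                    (\<forall>t\<in>{1..k}. card {c \<in> lattice k. f c = t} = k)}"

definition patternA :: "nat \<Rightarrow> (cell \<Rightarrow> nat) \<Rightarrow> bool" where
  "patternA m g \<longleftrightarrow> (\<exists>\<beta>. bij_betw \<beta> ({0..<m} \<times> {0..<m}) {1..m^2} \<and>
      (\<forall>r c. r < m^2 \<and> c < m^2 \<longrightarrow> g (r, c) = \<beta> (r div m, c div m)))"

definition patternB :: "nat \<Rightarrow> (cell \<Rightarrow> nat) \<Rightarrow> bool" where
  "patternB k g \<longleftrightarrow> (\<exists>\<gamma>. bij_betw \<gamma> {0..<k} {1..k} \<and>
      (\<forall>r c. r < k \<and> c < k \<longrightarrow> g (r, c) = \<gamma> c))"

text \<open>A pick-n-swap at p exchanges the (possibly empty) content of p with the (possibly empty)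
  content of the end-effector; this covers the three cases pick / swap / put.\<close>
definition pns :: "(cell \<Rightarrow> nat option) \<times> nat option \<Rightarrow> cell \<Rightarrow> (cell \<Rightarrow> nat option) \<times> nat option" where
  "pns st p = ((fst st)(p := snd st), fst st p)"

definition exec :: "nat \<Rightarrow> (cell \<Rightarrow> nat) \<Rightarrow> cell list \<Rightarrow> (cell \<Rightarrow> nat option) \<times> nat option" where
  "exec k init ps = foldl pns ((\<lambda>c. if c \<in> lattice k then Some (init c) else None), None) ps"

text \<open>A plan is given by the list [p_1,...,p_N] of pick-n-swap cells (p_0 is the fixed start).\<close>
definition valid_plan :: "nat \<Rightarrow> (cell \<Rightarrow> nat) \<Rightarrow> (cell \<Rightarrow> nat) \<Rightarrow> cell list \<Rightarrow> bool" where
  "valid_plan k init goal ps \<longleftrightarrow> set ps \<subseteq> lattice k \<and> snd (exec k init ps) = None \<and>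
      (\<forall>c\<in>lattice k. fst (exec k init ps) c = Some (goal c))"

definition path_len :: "cell list \<Rightarrow> real" where
  "path_len xs = sum_list (map (\<lambda>(a, b). cdist a b) (zip xs (tl xs)))"

definition travel :: "cell list \<Rightarrow> real" where
  "travel ps = path_len (p0 # ps @ [p0])"

definition min_pns :: "nat \<Rightarrow> (cell \<Rightarrow> nat) \<Rightarrow> (cell \<Rightarrow> nat) \<Rightarrow> nat" where
  "min_pns k init goal = (LEAST n. \<exists>ps. valid_plan k init goal ps \<and> length ps = n)"

definition opt_travel :: "nat \<Rightarrow> (cell \<Rightarrow> nat) \<Rightarrow> (cell \<Rightarrow> nat) \<Rightarrow> real" where
  "opt_travel k init goal = Min {travel ps | ps. valid_plan k init goal ps \<and> length ps = min_pns k init goal}"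

definition misplaced :: "nat \<Rightarrow> (cell \<Rightarrow> nat) \<Rightarrow> (cell \<Rightarrow> nat) \<Rightarrow> cell set" where
  "misplaced k init goal = {c \<in> lattice k. init c \<noteq> goal c}"

definition orbit :: "(cell \<Rightarrow> cell) \<Rightarrow> cell \<Rightarrow> cell set" where
  "orbit s c = {(s ^^ n) c | n. True}"

text \<open>Phase 1: sigma maps each misplaced cell to the goal cell assigned to its item; for each
  type t its restriction to the misplaced type-t items is a minimum-weight perfect matching.\<close>
definition phase1 :: "nat \<Rightarrow> (cell \<Rightarrow> nat) \<Rightarrow> (cell \<Rightarrow> nat) \<Rightarrow> (cell \<Rightarrow> cell) \<Rightarrow> bool" where
  "phase1 k init goal \<sigma> \<longleftrightarrow> (let D = misplaced k init goal in
     \<sigma> permutes D \<and> (\<forall>c\<in>D. goal (\<sigma> c) = init c) \<and>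
     (\<forall>t. \<forall>f. bij_betw f {c \<in> D. init c = t} {c \<in> D. goal c = t} \<longrightarrow>
        (\<Sum>c\<in>{c \<in> D. init c = t}. cdist c (\<sigma> c)) \<le> (\<Sum>c\<in>{c \<in> D. init c = t}. cdist c (f c))))"

text \<open>Additional travel distance of swapping the assigned goals of u and v.\<close>
definition mcost :: "(cell \<Rightarrow> cell) \<Rightarrow> cell \<Rightarrow> cell \<Rightarrow> real" where
  "mcost s u v = cdist u (s v) + cdist v (s u) - cdist u (s u) - cdist v (s v)"

definition merge_pairs :: "cell set \<Rightarrow> (cell \<Rightarrow> nat) \<Rightarrow> (cell \<Rightarrow> cell) \<Rightarrow> (cell \<times> cell) set" where
  "merge_pairs D init s = {(u, v). u \<in> D \<and> v \<in> D \<and> init u = init v \<and> orbit s u \<noteq> orbit s v}"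

definition merge_edges :: "cell set \<Rightarrow> (cell \<Rightarrow> nat) \<Rightarrow> (cell \<Rightarrow> cell) \<Rightarrow> cell set set set" where
  "merge_edges D init s = {{orbit s u, orbit s v} | u v. (u, v) \<in> merge_pairs D init s}"

definition edge_weight :: "cell set \<Rightarrow> (cell \<Rightarrow> nat) \<Rightarrow> (cell \<Rightarrow> cell) \<Rightarrow> cell set set \<Rightarrow> real" where
  "edge_weight D init s e = Min {mcost s u v | u v. (u, v) \<in> merge_pairs D init s \<and> {orbit s u, orbit s v} = e}"

definition conn :: "'v set set \<Rightarrow> 'v \<Rightarrow> 'v \<Rightarrow> bool" where
  "conn F a b \<longleftrightarrow> (a, b) \<in> {(x, y). {x, y} \<in> F}\<^sup>*"

definition spanning_forest :: "'v set set \<Rightarrow> 'v set set \<Rightarrow> bool" where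
  "spanning_forest E F \<longleftrightarrow> F \<subseteq> E \<and> conn F = conn E \<and> (\<forall>e\<in>F. conn (F - {e}) \<noteq> conn F)"

definition min_spanning_forest :: "'v set set \<Rightarrow> ('v set \<Rightarrow> real) \<Rightarrow> 'v set set \<Rightarrow> bool" where
  "min_spanning_forest E w F \<longleftrightarrow> spanning_forest E F \<and>
     (\<forall>F'. spanning_forest E F' \<longrightarrow> sum w F \<le> sum w F')"

text \<open>Phase 2: merge the cycles of each tree of a minimum spanning forest by swapping the goals
  of the cheapest same-type pair for every forest edge.\<close>
definition phase2 :: "cell set \<Rightarrow> (cell \<Rightarrow> nat) \<Rightarrow> (cell \<Rightarrow> cell) \<Rightarrow> (cell \<Rightarrow> cell) \<Rightarrow> bool" where
  "phase2 D init \<sigma> \<sigma>' \<longleftrightarrow> (\<exists>F ts.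
     min_spanning_forest (merge_edges D init \<sigma>) (edge_weight D init \<sigma>) F \<and>
     distinct (map (\<lambda>(u, v). {orbit \<sigma> u, orbit \<sigma> v}) ts) \<and>
     set (map (\<lambda>(u, v). {orbit \<sigma> u, orbit \<sigma> v}) ts) = F \<and>
     (\<forall>(u, v)\<in>set ts. (u, v) \<in> merge_pairs D init \<sigma> \<and>
        mcost \<sigma> u v = edge_weight D init \<sigma> {orbit \<sigma> u, orbit \<sigma> v}) \<and>
     \<sigma>' = foldl (\<lambda>s (u, v). s(u := s v, v := s u)) \<sigma> ts)"

text \<open>Phase 3.  Nodes: the merged cycles (cell sets) and the root {p0} (cycles have length
  at least 2, so the root is distinct from every cycle).\<close>
definition ndist :: "cell set \<Rightarrow> cell set \<Rightarrow> real" where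
  "ndist a b = Min {cdist u v | u v. u \<in> a \<and> v \<in> b}"

definition arborescence :: "cell set set \<Rightarrow> (cell set \<Rightarrow> cell set) \<Rightarrow> bool" where
  "arborescence N par \<longleftrightarrow> (\<forall>x\<in>N. par x \<in> insert {p0} N \<and> (\<exists>n. (par ^^ n) x = {p0}))"

definition min_arborescence :: "cell set set \<Rightarrow> (cell set \<Rightarrow> cell set) \<Rightarrow> bool" where
  "min_arborescence N par \<longleftrightarrow> arborescence N par \<and>
     (\<forall>par'. arborescence N par' \<longrightarrow> (\<Sum>x\<in>N. ndist (par x) x) \<le> (\<Sum>x\<in>N. ndist (par' x) x))"

inductive dfs :: "cell set set \<Rightarrow> (cell set \<Rightarrow> cell set) \<Rightarrow> cell set \<Rightarrow> cell set list \<Rightarrow> bool"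
  for N par where
  "distinct cs \<Longrightarrow> set cs = {y \<in> N. par y = x} \<Longrightarrow> list_all2 (dfs N par) cs yss \<Longrightarrow>
   dfs N par x (x # concat yss)"

definition follow :: "(cell \<Rightarrow> cell) \<Rightarrow> cell set \<Rightarrow> cell \<Rightarrow> cell list" where
  "follow s x e = map (\<lambda>i. (s ^^ i) e) [0..<card x] @ [e]"

definition phase3 :: "cell set \<Rightarrow> (cell \<Rightarrow> cell) \<Rightarrow> cell list \<Rightarrow> bool" where
  "phase3 D \<sigma>' ps \<longleftrightarrow> (let N = {orbit \<sigma>' c | c. c \<in> D} in
     \<exists>par ent L. min_arborescence N par \<and>
       (\<forall>x\<in>N. ent x \<in> x \<and> (\<exists>u\<in>par x. cdist u (ent x) = ndist (par x) x)) \<and>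
       dfs N par {p0} ({p0} # L) \<and>
       ps = concat (map (\<lambda>x. follow \<sigma>' x (ent x)) L))"

text \<open>ps is a possible output of PlanPTR (for some tie-breaking in each phase).\<close>
definition PlanPTR :: "nat \<Rightarrow> (cell \<Rightarrow> nat) \<Rightarrow> (cell \<Rightarrow> nat) \<Rightarrow> cell list \<Rightarrow> bool" where
  "PlanPTR k init goal ps \<longleftrightarrow> (let D = misplaced k init goal in
     \<exists>\<sigma> \<sigma>'. phase1 k init goal \<sigma> \<and> phase2 D init \<sigma> \<sigma>' \<and> phase3 D \<sigma>' ps)"

definition expect :: "nat \<Rightarrow> ((cell \<Rightarrow> nat) \<Rightarrow> real) \<Rightarrow> real" where
  "expect k X = (\<Sum>f\<in>configs k. X f) / real (card (configs k))"

end

theory Submission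
  imports Defs "HOL-Combinatorics.Cycles" "HOL-Real_Asymp.Real_Asymp"
begin

text \<open>
  A plan that moves every item from its cell to its final cell travels at least the cost of a
  type-preserving matching, hence at least the phase 1 cost \<open>M\<close>. PlanPTR travels \<open>M\<close>, plus
  \<open>O(k\<^sup>2)\<close> for the at most \<open>k\<close> merged cycles, plus the cost of the goal swaps of phase 2. The
  expected optimum is of order \<open>k\<^sup>3\<close>, so it remains to see that the swaps cost \<open>o(k\<^sup>3)\<close>.

  For blocks this is immediate: a swap keeps every goal inside a block of diameter \<open>O(\<surd>k)\<close>.
  For columns, consecutive goals of a column give a spanning forest of weight at most \<open>2k\<^sup>2\<close>, but
  a swap that is cheap on its own may be expensive after other swaps at the same cell. Therefore
  swaps are charged by the row difference of the two cells, which does not depend on the order of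
  the swaps: replacing Euclidean by horizontal distance shows that the total cost exceeds \<open>M\<close> by at
  most the row displacement of the phase 1 matching plus twice these row differences. A swap
  between far rows costs at least (row difference)\<open>\<^sup>2\<close>\<open>/(3k)\<close> unless one of its cells has a large row
  displacement, and rotating the goals of one column shows that for most types no cell of the type
  has a large row displacement. The required average bounds come from the variance of the number
  of items of a given type in the first rows.
\<close>

section \<open>Orbits and spanning forests\<close>

text \<open>The number of pick-n-swaps is decided by types alone. After phase 2 every type occurs on
  only one cycle, so the cycles carry disjoint sets of types, each closed under passing from the
  initial to the goal type of a cell. Every plan visits the goal region of such a class at least
  once per misplaced cell of its cycle and once more; cycle-following attains this.

  The column estimate rests on an asymmetry: the horizontal part of any matching cost is fixed by
  the configuration, while a row displacement y adds at least y^2/(3k). Cheap reference matchings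
  therefore bound squares of displacements. Rotating a column moves every other goal by one row,
  which is cheap only for cells far from their goal column, so cells closer than a threshold are
  counted separately.

  No square root survives: each is replaced by a linear bound with a free parameter. The final
  overhead is then affine in its two random quantities, and expectations can be inserted directly.
  The optimum has order k^3 because reflecting the columns preserves the distribution, while a cell
  and its mirror image are on average at distance of order k.\<close>

lemma goal_swap_permutes:
  assumes "s permutes D" "u \<in> D" "v \<in> D"
  shows "s(u := s v, v := s u) permutes D"
proof -
  have "s(u := s v, v := s u) = s \<circ> transpose u v"
    by (auto simp: fun_eq_iff transpose_def)
  then show ?thesis
    using assms by (simp add: permutes_compose permutes_swap_id)
qed

lemma orbit_self: "c \<in> orbit s c"
  unfolding orbit_def by (auto intro: exI[of _ 0])

lemma orbit_step: "d \<in> orbit s c \<Longrightarrow> s d \<in> orbit s c"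
  unfolding orbit_def by (auto intro: exI[of _ "Suc n" for n])

lemma orbit_subset_closed:
  assumes "c \<in> A" "\<And>x. x \<in> A \<Longrightarrow> s x \<in> A"
  shows "orbit s c \<subseteq> A"
proof -
  have "(s ^^ n) c \<in> A" for n
    by (induction n) (use assms in auto)
  then show ?thesis by (auto simp: orbit_def)
qed

lemma orbit_subset_orbit: "d \<in> orbit s c \<Longrightarrow> orbit s d \<subseteq> orbit s c"
  by (rule orbit_subset_closed) (auto intro: orbit_step)

lemma orbit_subset: "s permutes D \<Longrightarrow> c \<in> D \<Longrightarrow> orbit s c \<subseteq> D"
  by (rule orbit_subset_closed) (auto simp: permutes_in_image)

lemma permutes_period:
  assumes "s permutes D" "finite D"
  obtains n where "n > 0" "s ^^ n = id"
proof -
  have "permutation s" using assms permutation_permutes by blast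
  then show ?thesis using that permutation_is_nilpotent by blast
qed

text \<open>With \<open>s ^^ n = id\<close>, walking (n - 1) * i further steps from
  \<open>(s ^^ i) c\<close> returns to \<open>c\<close>. Orbits are defined by forward iteration
  only; this makes them equivalence classes.\<close>

lemma orbit_sym:
  assumes "s permutes D" "finite D" "d \<in> orbit s c"
  shows "c \<in> orbit s d"
proof -
  obtain n where n: "n > 0" "s ^^ n = id" using permutes_period assms by metis
  obtain i where i: "d = (s ^^ i) c" using assms(3) by (auto simp: orbit_def)
  have "(s ^^ (n * i - i)) d = (s ^^ (n * i)) c"
    using n(1) by (simp add: i funpow_add[THEN fun_cong, unfolded o_apply, symmetric])
  also have "\<dots> = ((s ^^ n) ^^ i) c" by (simp add: funpow_mult)
  also have "\<dots> = c" using n(2) by simp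
  finally show ?thesis unfolding orbit_def by force
qed

lemma orbit_eq:
  assumes "s permutes D" "finite D" "d \<in> orbit s c"
  shows "orbit s d = orbit s c"
  using assms orbit_sym orbit_subset_orbit by (metis subset_antisym)

text \<open>Exchanging the images of two points on different cycles splices the cycles: from
  \<open>u\<close> the new map enters the old cycle of \<open>v\<close> at \<open>s v\<close>,
  follows it up to \<open>v\<close>, and then continues at \<open>s u\<close> along the old cycle of
  \<open>u\<close>. Other cycles never meet \<open>u\<close> or \<open>v\<close>.\<close>

lemma goal_swap_merges_orbits:
  assumes s: "s permutes D" "finite D" and uv: "u \<in> D" "v \<in> D" "v \<notin> orbit s u"
    and c: "c \<in> D"
  defines "s' \<equiv> s(u := s v, v := s u)"
  shows "orbit s' c = (if c \<in> orbit s u \<union> orbit s v then orbit s u \<union> orbit s v else orbit s c)"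
proof -
  have s': "s' permutes D"
    unfolding s'_def using s uv by (intro goal_swap_permutes)
  have u_notin: "u \<notin> orbit s v" using orbit_sym[OF s] uv by blast
  have s'_other: "s' x = s x" if "x \<noteq> u" "x \<noteq> v" for x using that by (simp add: s'_def)
  have s'_uv: "s' u = s v" "s' v = s u" using uv orbit_self by (auto simp: s'_def)
  note s's = s' s(2)
  have v_in: "v \<in> orbit s' u"
  proof -
    have sv: "(s ^^ n) (s v) \<in> orbit s v" for n
      by (simp add: funpow_swap1[symmetric] orbit_def) (metis funpow.simps(2) o_apply)
    \<comment> \<open>Along the old cycle of \<open>v\<close> both maps agree until \<open>v\<close>
      itself is met, because \<open>u\<close> is not on that cycle.\<close>
    have walk: "v \<in> orbit s' u \<or> (s ^^ n) (s v) \<in> orbit s' u" for n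
    proof (induction n)
      case 0
      then show ?case using orbit_step[OF orbit_self, of s' u] s'_uv by simp
    next
      case (Suc n)
      let ?x = "(s ^^ n) (s v)"
      show ?case
      proof (cases "?x = v")
        case True then show ?thesis using Suc by auto
      next
        case False
        moreover have "?x \<noteq> u" using sv u_notin by metis
        ultimately have "s' ?x = s ?x" by (rule s'_other[rotated])
        then show ?thesis using Suc orbit_step[of ?x s' u] by auto
      qed
    qed
    obtain n where "n > 0" "s ^^ n = id" using permutes_period s by metis
    then have "(s ^^ (n - 1)) (s v) = v"
      by (metis Suc_diff_1 funpow_Suc_right id_apply o_apply)
    then show ?thesis using walk by metis
  qed
  have suv: "s u \<in> orbit s' u" "s v \<in> orbit s' u"
    using orbit_step[OF v_in] orbit_step[OF orbit_self, of s' u] s'_uv by auto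
  have sub: "orbit s x \<subseteq> orbit s' u" if "x \<in> {u, v}" for x
  proof (rule orbit_subset_closed)
    show "x \<in> orbit s' u" using that v_in orbit_self[of u s'] by auto
    show "s y \<in> orbit s' u" if "y \<in> orbit s' u" for y
      using that suv s'_other[of y] orbit_step[of y s' u] by (cases "y = u \<or> y = v") auto
  qed
  have eq: "orbit s' u = orbit s u \<union> orbit s v"
  proof
    show "orbit s' u \<subseteq> orbit s u \<union> orbit s v"
    proof (rule orbit_subset_closed)
      show "u \<in> orbit s u \<union> orbit s v" by (simp add: orbit_self)
      fix x assume "x \<in> orbit s u \<union> orbit s v"
      then show "s' x \<in> orbit s u \<union> orbit s v"
        by (cases "x = u \<or> x = v")
          (auto simp: s'_uv s'_other orbit_step[OF orbit_self] intro: orbit_step)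
    qed
  qed (use sub in auto)
  show ?thesis
  proof (cases "c \<in> orbit s u \<union> orbit s v")
    case True
    then show ?thesis using eq orbit_eq[OF s's, of c u] by simp
  next
    case False
    have pow: "(s' ^^ n) c = (s ^^ n) c" for n
    proof (induction n)
      case (Suc n)
      have "(s ^^ n) c \<in> orbit s c" by (auto simp: orbit_def)
      then have "(s ^^ n) c \<noteq> u" "(s ^^ n) c \<noteq> v"
        using False orbit_sym[OF s, of "(s ^^ n) c" c] by (metis UnCI)+
      then show ?case by (simp add: Suc s'_other)
    qed simp
    show ?thesis using False by (simp add: orbit_def pow)
  qed
qed

section \<open>Connectivity, forests and their component count\<close>

lemma conn_refl [simp]: "conn F x x"
  by (simp add: conn_def)

lemma conn_trans: "conn F x y \<Longrightarrow> conn F y z \<Longrightarrow> conn F x z"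
  by (auto simp: conn_def)

lemma conn_sym: "conn F x y \<Longrightarrow> conn F y x"
proof -
  have "sym {(x, y). {x, y} \<in> F}" by (auto simp: sym_def insert_commute)
  then show "conn F x y \<Longrightarrow> conn F y x"
    unfolding conn_def by (meson symD sym_rtrancl)
qed

lemma conn_edge: "{x, y} \<in> F \<Longrightarrow> conn F x y"
  by (auto simp: conn_def)

lemma conn_mono: "F \<subseteq> F' \<Longrightarrow> conn F x y \<Longrightarrow> conn F' x y"
  using rtrancl_mono[of "{(x, y). {x, y} \<in> F}" "{(x, y). {x, y} \<in> F'}"] by (auto simp: conn_def)

lemma conn_le:
  assumes "\<And>x y. {x, y} \<in> F \<Longrightarrow> R x y" "\<And>x. R x x" "\<And>x y z. R x y \<Longrightarrow> R y z \<Longrightarrow> R x z"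
    and "conn F x y"
  shows "R x y"
proof -
  have "(x, y) \<in> {(x, y). {x, y} \<in> F}\<^sup>*" using assms(4) by (simp add: conn_def)
  then show ?thesis by (induction rule: rtrancl_induct) (use assms in blast)+
qed

text \<open>A path can be shortened so that it uses the new edge at most once. Formally, the
  right-hand side is a reflexive and transitive relation that contains all edges, and
  \<open>conn\<close> is the least such relation.\<close>

lemma conn_insert:
  "conn (insert {a, b} F) x y \<longleftrightarrow>
     conn F x y \<or> conn F x a \<and> conn F b y \<or> conn F x b \<and> conn F a y" (is "_ = ?R x y")
proof
  assume "conn (insert {a, b} F) x y"
  then show "?R x y"
  proof (rule conn_le[rotated -1])
    show "?R x y" if "{x, y} \<in> insert {a, b} F" for x y
      using that conn_edge[of x y F] by (auto simp: doubleton_eq_iff)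
    show "?R x z" if "?R x y" "?R y z" for x y z
      using that by (meson conn_trans conn_sym)
  qed simp
next
  have 1: "conn F x y \<Longrightarrow> conn (insert {a, b} F) x y" for x y by (meson conn_mono subset_insertI)
  have "conn (insert {a, b} F) a b" by (simp add: conn_edge)
  then show "?R x y \<Longrightarrow> conn (insert {a, b} F) x y"
    using 1 by (meson conn_trans conn_sym)
qed

text \<open>Stated for the endpoints of an edge, not by comparing whole connectivity relations, so
  that subsets inherit it. The case \<open>a = b\<close> excludes loops.\<close>

definition acyclic_edges :: "'v set set \<Rightarrow> bool" where
  "acyclic_edges F \<longleftrightarrow> (\<forall>a b. {a, b} \<in> F \<longrightarrow> \<not> conn (F - {{a, b}}) a b)"

lemma acyclic_edges_subset: "acyclic_edges F \<Longrightarrow> F' \<subseteq> F \<Longrightarrow> acyclic_edges F'"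
  unfolding acyclic_edges_def by (meson conn_mono Diff_mono order_refl subsetD)

lemma acyclic_edges_insertD: "acyclic_edges (insert {a, b} F) \<Longrightarrow> {a, b} \<notin> F \<Longrightarrow> \<not> conn F a b"
  unfolding acyclic_edges_def by auto

lemma spanning_forest_acyclic:
  assumes "spanning_forest E F"
  shows "acyclic_edges F"
  unfolding acyclic_edges_def
proof (intro allI impI notI)
  fix a b assume ab: "{a, b} \<in> F" and c: "conn (F - {{a, b}}) a b"
  have "F = insert {a, b} (F - {{a, b}})" using ab by auto
  then have "conn F x y \<longleftrightarrow> conn (F - {{a, b}}) x y" for x y
    using conn_insert[of a b "F - {{a, b}}" x y] c conn_sym[OF c] conn_trans[of "F - {{a, b}}"]
    by metis
  then have "conn (F - {{a, b}}) = conn F" by (auto simp: fun_eq_iff)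
  then show False using assms ab by (auto simp: spanning_forest_def)
qed

text \<open>Components plus edges equal vertices, since each further edge of a forest joins two
  different components. The map \<open>h\<close> sends a vertex to a name of its component; on
  inserting an edge the name of one endpoint's component is overwritten by that of the other, so
  exactly one name disappears.\<close>

lemma acyclic_edges_representatives:
  fixes F :: "'v set set"
  assumes "finite F" "acyclic_edges F" "finite W" "\<And>e. e \<in> F \<Longrightarrow> \<exists>a\<in>W. \<exists>b\<in>W. e = {a, b}"
  shows "\<exists>h :: 'v \<Rightarrow> 'v. (\<forall>x\<in>W. \<forall>y\<in>W. h x = h y \<longleftrightarrow> conn F x y) \<and> card (h ` W) + card F = card W"
  using assms
proof (induction F rule: finite_induct)
  case empty
  have "conn {} x y \<longleftrightarrow> x = y" for x y :: 'v by (simp add: conn_def)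
  then show ?case by (intro exI[of _ id]) auto
next
  case (insert e F)
  obtain a b where ab: "a \<in> W" "b \<in> W" "e = {a, b}" using insert.prems(3)[of e] by auto
  have "acyclic_edges F" using insert.prems(1) acyclic_edges_subset by blast
  then obtain h :: "'v \<Rightarrow> 'v" where h: "\<And>x y. x \<in> W \<Longrightarrow> y \<in> W \<Longrightarrow> h x = h y \<longleftrightarrow> conn F x y"
      "card (h ` W) + card F = card W"
    using insert by auto
  have nab: "\<not> conn F a b"
    using acyclic_edges_insertD insert.hyps(2) insert.prems(1) ab by metis
  define h' where "h' x = (if h x = h b then h a else h x)" for x
  have "h' ` W = h ` W - {h b}"
    using ab nab h(1)[of a b] by (auto simp: h'_def)
  then have "card (h' ` W) + card (insert e F) = card W"
  proof -
    have "h b \<in> h ` W" "finite (h ` W)" using ab insert.prems(2) by auto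
    then have "card (h ` W - {h b}) + 1 = card (h ` W)"
      by (metis Suc_eq_plus1 card_Suc_Diff1)
    then show ?thesis using h(2) insert.hyps \<open>h' ` W = _\<close> by simp
  qed
  moreover have "h' x = h' y \<longleftrightarrow> conn (insert e F) x y" if "x \<in> W" "y \<in> W" for x y
    unfolding h'_def ab(3) conn_insert h(1)[OF that, symmetric] h(1)[OF that(1) ab(1), symmetric]
      h(1)[OF that(1) ab(2), symmetric] h(1)[OF ab(2) that(2), symmetric] h(1)[OF ab(1) that(2), symmetric]
    by (cases "h x = h b"; cases "h y = h b") simp_all
  ultimately show ?case by auto
qed

lemma acyclic_edges_card:
  assumes "finite F" "acyclic_edges F" "finite W" "\<And>e. e \<in> F \<Longrightarrow> \<exists>a\<in>W. \<exists>b\<in>W. e = {a, b}"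
  shows "card F \<le> card W"
  using acyclic_edges_representatives[OF assms] by auto

text \<open>A subset of least cardinality with unchanged connectivity cannot lose an edge. The extra
  set \<open>E'\<close> allows a minimum spanning forest to be compared with an explicitly
  constructed connecting set.\<close>

lemma spanning_forest_exists:
  assumes "finite E" "E' \<subseteq> E" "conn E' = conn E"
  obtains F where "F \<subseteq> E'" "spanning_forest E F"
proof -
  let ?P = "\<lambda>F. F \<subseteq> E' \<and> conn F = conn E"
  define F where "F = (ARG_MIN card F. ?P F)"
  have P: "?P F" and min: "\<And>F'. ?P F' \<Longrightarrow> card F \<le> card F'"
    using arg_min_nat_lemma[of ?P E' card] assms(3) unfolding F_def by auto
  have "finite F" using P assms finite_subset by metis
  have "conn (F - {e}) \<noteq> conn F" if "e \<in> F" for e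
  proof
    assume "conn (F - {e}) = conn F"
    then have "card F \<le> card (F - {e})" using P by (intro min) auto
    then show False using that \<open>finite F\<close> by (meson card_Diff1_less not_le)
  qed
  then show ?thesis using that[of F] P assms(2) by (auto simp: spanning_forest_def)
qed

lemma min_spanning_forest_exists:
  assumes "finite E"
  obtains F where "min_spanning_forest E w F"
proof -
  have "finite {F. spanning_forest E F}"
    using assms by (auto simp: spanning_forest_def intro: finite_subset[of _ "Pow E"])
  moreover have "{F. spanning_forest E F} \<noteq> {}"
    using spanning_forest_exists[OF assms] by blast
  ultimately show ?thesis
    using arg_min_if_finite(1)[of "{F. spanning_forest E F}" "sum w"]
      arg_min_least[of "{F. spanning_forest E F}" _ "sum w"] that
    by (auto simp: min_spanning_forest_def)
qed

section \<open>Phase 2: merging cycles by goal swaps\<close>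

lemma finite_lattice [simp]: "finite (lattice k)"
  by (simp add: lattice_def)

lemma finite_misplaced [simp]: "finite (misplaced k init goal)"
  by (simp add: misplaced_def)

lemma finite_merge_pairs: "finite D \<Longrightarrow> finite (merge_pairs D init s)"
  by (rule finite_subset[of _ "D \<times> D"]) (auto simp: merge_pairs_def)

lemma merge_edges_image: "merge_edges D init s = (\<lambda>(u, v). {orbit s u, orbit s v}) ` merge_pairs D init s"
  by (auto simp: merge_edges_def)

lemma finite_merge_edges: "finite D \<Longrightarrow> finite (merge_edges D init s)"
  by (simp add: merge_edges_image finite_merge_pairs)

text \<open>Each swap exchanges the current goals left by the preceding swaps, whereas forest edges
  and their weights refer to the original \<sigma>. Relating the two is the main difficulty with
  phase 2.\<close>

definition merge_goals :: "(cell \<Rightarrow> cell) \<Rightarrow> (cell \<times> cell) list \<Rightarrow> cell \<Rightarrow> cell" where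
  "merge_goals \<sigma> ts = foldl (\<lambda>s (u, v). s(u := s v, v := s u)) \<sigma> ts"

lemma merge_goals_Nil [simp]: "merge_goals \<sigma> [] = \<sigma>"
  by (simp add: merge_goals_def)

lemma merge_goals_snoc [simp]:
  "merge_goals \<sigma> (ts @ [(u, v)]) =
     (merge_goals \<sigma> ts)(u := merge_goals \<sigma> ts v, v := merge_goals \<sigma> ts u)"
  by (simp add: merge_goals_def)

lemma merge_goals_permutes:
  assumes "\<sigma> permutes D" "\<forall>(u, v)\<in>set ts. u \<in> D \<and> v \<in> D"
  shows "merge_goals \<sigma> ts permutes D"
  using assms(2)
proof (induction ts rule: rev_induct)
  case (snoc a xs)
  then show ?case
    by (cases a) (auto simp del: fun_upd_apply intro!: goal_swap_permutes)
qed (use assms in simp)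

lemma merge_goals_types:
  assumes "\<forall>c\<in>D. goal (\<sigma> c) = init c" "\<forall>(u, v)\<in>set ts. u \<in> D \<and> v \<in> D \<and> init u = init v"
  shows "\<forall>c\<in>D. goal (merge_goals \<sigma> ts c) = init c"
  using assms(2)
proof (induction ts rule: rev_induct)
  case (snoc a xs)
  then show ?case by (cases a) auto
qed (use assms in simp)

abbreviation orbit_edge :: "(cell \<Rightarrow> cell) \<Rightarrow> cell \<times> cell \<Rightarrow> cell set set" where
  "orbit_edge s \<equiv> \<lambda>(u, v). {orbit s u, orbit s v}"

text \<open>Current orbits are the components of the edges processed so far. Since the edges form a
  forest, the next one joins two different components, so its cells lie on different current cycles
  even after earlier swaps, and these two cycles get spliced.\<close>

lemma merge_goals_orbits:
  assumes \<sigma>: "\<sigma> permutes D" "finite D"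
    and "\<forall>(u, v)\<in>set ts. u \<in> D \<and> v \<in> D"
    and "distinct (map (orbit_edge \<sigma>) ts)"
    and "acyclic_edges (set (map (orbit_edge \<sigma>) ts))"
    and "c \<in> D"
  shows "orbit (merge_goals \<sigma> ts) c =
     {d \<in> D. conn (set (map (orbit_edge \<sigma>) ts)) (orbit \<sigma> c) (orbit \<sigma> d)}"
  using assms(3-)
proof (induction ts arbitrary: c rule: rev_induct)
  case Nil
  have "conn {} x y \<longleftrightarrow> x = y" for x y :: "cell set" by (simp add: conn_def)
  moreover have "orbit \<sigma> c = {d \<in> D. orbit \<sigma> c = orbit \<sigma> d}"
    using orbit_subset[OF \<sigma>(1) Nil(4)] orbit_eq[OF \<sigma>] orbit_self by blast
  ultimately show ?case by simp
next
  case (snoc a xs)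
  obtain u v where a: "a = (u, v)" by (cases a)
  define F where "F = set (map (orbit_edge \<sigma>) xs)"
  define s where "s = merge_goals \<sigma> xs"
  have edges: "map (orbit_edge \<sigma>) (xs @ [a]) =
      map (orbit_edge \<sigma>) xs @ [{orbit \<sigma> u, orbit \<sigma> v}]"
    by (simp add: a)
  have F': "set (map (orbit_edge \<sigma>) (xs @ [a])) = insert {orbit \<sigma> u, orbit \<sigma> v} F"
    unfolding edges F_def by (simp only: set_append list.set Un_insert_right Un_empty_right)
  have uv: "u \<in> D" "v \<in> D" using snoc.prems(1) by (simp_all add: a)
  have uv': "{orbit \<sigma> u, orbit \<sigma> v} \<notin> F" "acyclic_edges (insert {orbit \<sigma> u, orbit \<sigma> v} F)"
    using snoc.prems(2,3) unfolding F' unfolding edges F_def by (simp_all only: distinct_append list.set) blast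
  have nconn: "\<not> conn F (orbit \<sigma> u) (orbit \<sigma> v)"
    by (rule acyclic_edges_insertD[OF uv'(2,1)])
  have xs: "\<forall>(u, v)\<in>set xs. u \<in> D \<and> v \<in> D" "distinct (map (orbit_edge \<sigma>) xs)"
    using snoc.prems(1,2) unfolding edges by (simp, simp only: distinct_append)
  have "acyclic_edges F" by (rule acyclic_edges_subset[OF uv'(2) subset_insertI])
  then have IH: "orbit s c = {d \<in> D. conn F (orbit \<sigma> c) (orbit \<sigma> d)}" if "c \<in> D" for c
    using snoc.IH[OF xs _ that] unfolding s_def F_def by simp
  have s: "s permutes D" unfolding s_def by (intro merge_goals_permutes \<sigma> xs)
  have "v \<notin> orbit s u" using IH[OF uv(1)] nconn by simp
  note m = goal_swap_merges_orbits[OF s \<sigma>(2) uv(1,2) this snoc.prems(4)]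
  have *: "merge_goals \<sigma> (xs @ [a]) = s(u := s v, v := s u)"
    by (simp add: a s_def)
  have sym: "conn F x y \<longleftrightarrow> conn F y x" for x y using conn_sym by metis
  let ?c = "orbit \<sigma> c" and ?u = "orbit \<sigma> u" and ?v = "orbit \<sigma> v"
  show ?case
  proof (cases "conn F ?u ?c \<or> conn F ?v ?c")
    case True
    then have "conn F ?c y \<or> conn F ?c ?u \<and> conn F ?v y \<or> conn F ?c ?v \<and> conn F ?u y \<longleftrightarrow>
        conn F ?u y \<or> conn F ?v y" for y
      using sym[of ?c] conn_trans[of F] by metis
    then show ?thesis
      unfolding * F' m conn_insert IH[OF uv(1)] IH[OF uv(2)] using True snoc.prems(4) by auto
  next
    case False
    then show ?thesis
      unfolding * F' m conn_insert IH[OF uv(1)] IH[OF uv(2)] IH[OF snoc.prems(4)]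
      using sym[of ?c] by simp
  qed
qed

lemma phase1D:
  assumes "phase1 k init goal \<sigma>"
  shows "\<sigma> permutes misplaced k init goal" "\<forall>c\<in>misplaced k init goal. goal (\<sigma> c) = init c"
  using assms by (auto simp: phase1_def Let_def)

lemma phase2E:
  assumes "phase2 D init \<sigma> \<sigma>'"
  obtains F ts where "min_spanning_forest (merge_edges D init \<sigma>) (edge_weight D init \<sigma>) F"
    "distinct (map (orbit_edge \<sigma>) ts)"
    "set (map (orbit_edge \<sigma>) ts) = F"
    "\<And>u v. (u, v) \<in> set ts \<Longrightarrow> (u, v) \<in> merge_pairs D init \<sigma> \<and>
        mcost \<sigma> u v = edge_weight D init \<sigma> {orbit \<sigma> u, orbit \<sigma> v}"
    "\<sigma>' = merge_goals \<sigma> ts"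
  using assms unfolding phase2_def merge_goals_def[symmetric] by blast

text \<open>Two cells of one type on different cycles give a merge edge, and the forest preserves
  connectivity; hence after merging all misplaced items of a type lie on one cycle. This third
  property drives the count of pick-n-swaps.\<close>

lemma phase2_properties:
  assumes \<sigma>: "\<sigma> permutes D" "finite D" "\<forall>c\<in>D. goal (\<sigma> c) = init c"
    and p2: "phase2 D init \<sigma> \<sigma>'"
  shows "\<sigma>' permutes D" "\<forall>c\<in>D. goal (\<sigma>' c) = init c"
    "\<And>u v. u \<in> D \<Longrightarrow> v \<in> D \<Longrightarrow> init u = init v \<Longrightarrow> orbit \<sigma>' u = orbit \<sigma>' v"
proof -
  obtain F ts where F: "spanning_forest (merge_edges D init \<sigma>) F"
    and ts: "distinct (map (orbit_edge \<sigma>) ts)"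
      "set (map (orbit_edge \<sigma>) ts) = F"
      "\<forall>(u, v)\<in>set ts. (u, v) \<in> merge_pairs D init \<sigma>"
    and \<sigma>': "\<sigma>' = merge_goals \<sigma> ts"
    using phase2E[OF p2] unfolding min_spanning_forest_def by (metis (no_types, lifting) case_prodI2)
  have tsD: "\<forall>(u, v)\<in>set ts. u \<in> D \<and> v \<in> D \<and> init u = init v"
    using ts(3) by (auto simp: merge_pairs_def)
  show s': "\<sigma>' permutes D"
    unfolding \<sigma>' using tsD \<sigma>(1) by (intro merge_goals_permutes) auto
  show "\<forall>c\<in>D. goal (\<sigma>' c) = init c"
    unfolding \<sigma>' using tsD \<sigma>(3) by (intro merge_goals_types) auto
  fix u v assume uv: "u \<in> D" "v \<in> D" "init u = init v"
  have "conn (merge_edges D init \<sigma>) (orbit \<sigma> u) (orbit \<sigma> v)"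
  proof (cases "orbit \<sigma> u = orbit \<sigma> v")
    case False
    then have "(u, v) \<in> merge_pairs D init \<sigma>" using uv by (simp add: merge_pairs_def)
    then show ?thesis by (intro conn_edge) (auto simp only: merge_edges_image intro!: rev_image_eqI split: prod.split)
  qed simp
  then have "conn F (orbit \<sigma> u) (orbit \<sigma> v)" using F by (simp add: spanning_forest_def)
  moreover have "orbit \<sigma>' u = {d \<in> D. conn F (orbit \<sigma> u) (orbit \<sigma> d)}"
    unfolding \<sigma>' ts(2)[symmetric]
    using tsD ts spanning_forest_acyclic[OF F] uv by (intro merge_goals_orbits \<sigma>) auto
  ultimately have "v \<in> orbit \<sigma>' u" using uv by simp
  then show "orbit \<sigma>' u = orbit \<sigma>' v" using orbit_eq[OF s' \<sigma>(2)] by simp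
qed

lemma edge_weight_attained:
  assumes "finite D" "e \<in> merge_edges D init s"
  shows "\<exists>u v. (u, v) \<in> merge_pairs D init s \<and> {orbit s u, orbit s v} = e \<and> mcost s u v = edge_weight D init s e"
proof -
  let ?S = "{mcost s u v | u v. (u, v) \<in> merge_pairs D init s \<and> {orbit s u, orbit s v} = e}"
  have "finite ?S"
    by (rule finite_subset[of _ "(\<lambda>(u, v). mcost s u v) ` merge_pairs D init s"])
      (auto simp: finite_merge_pairs assms(1))
  moreover have "?S \<noteq> {}" using assms(2) by (auto simp: merge_edges_def)
  ultimately have "Min ?S \<in> ?S" by (rule Min_in)
  then show ?thesis unfolding edge_weight_def by fastforce
qed

lemma edge_weight_le:
  assumes "finite D" "(u, v) \<in> merge_pairs D init s"
  shows "edge_weight D init s {orbit s u, orbit s v} \<le> mcost s u v"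
  unfolding edge_weight_def
proof (rule Min_le)
  show "finite {mcost s u' v' |u' v'. (u', v') \<in> merge_pairs D init s \<and> {orbit s u', orbit s v'} = {orbit s u, orbit s v}}"
    by (rule finite_subset[of _ "(\<lambda>(u, v). mcost s u v) ` merge_pairs D init s"])
      (auto simp: finite_merge_pairs assms(1))
qed (use assms in blast)

lemma phase2_exists:
  assumes "finite D"
  shows "\<exists>\<sigma>'. phase2 D init \<sigma> \<sigma>'"
proof -
  obtain F where F: "min_spanning_forest (merge_edges D init \<sigma>) (edge_weight D init \<sigma>) F"
    using min_spanning_forest_exists finite_merge_edges[OF assms] by metis
  then have sub: "F \<subseteq> merge_edges D init \<sigma>" by (auto simp: min_spanning_forest_def spanning_forest_def)
  then obtain es where es: "set es = F" "distinct es"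
    using finite_distinct_list finite_subset finite_merge_edges[OF assms] by metis
  define pick where "pick e = (SOME p. p \<in> merge_pairs D init \<sigma> \<and> (case p of (u, v) \<Rightarrow>
     {orbit \<sigma> u, orbit \<sigma> v} = e \<and> mcost \<sigma> u v = edge_weight D init \<sigma> e))" for e
  have pick: "pick e \<in> merge_pairs D init \<sigma> \<and> (case pick e of (u, v) \<Rightarrow>
     {orbit \<sigma> u, orbit \<sigma> v} = e \<and> mcost \<sigma> u v = edge_weight D init \<sigma> e)" if "e \<in> F" for e
    unfolding pick_def by (rule someI_ex) (use edge_weight_attained[OF assms, of e] sub that in fastforce)
  have "(case pick e of (u, v) \<Rightarrow> {orbit \<sigma> u, orbit \<sigma> v}) = e" if "e \<in> F" for e
    using pick[OF that] by (cases "pick e") simp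
  then have m: "map (orbit_edge \<sigma>) (map pick es) = es"
    unfolding map_map using es(1) by (intro map_idI) simp
  show ?thesis
    unfolding phase2_def
  proof (intro exI conjI)
    show "distinct (map (orbit_edge \<sigma>) (map pick es))" unfolding m by (rule es)
    show "set (map (orbit_edge \<sigma>) (map pick es)) = F" unfolding m by (rule es)
    show "\<forall>(u, v)\<in>set (map pick es). (u, v) \<in> merge_pairs D init \<sigma> \<and>
        mcost \<sigma> u v = edge_weight D init \<sigma> {orbit \<sigma> u, orbit \<sigma> v}"
      using pick es(1) by fastforce
  qed (rule F refl)+
qed

section \<open>Effect of cycle-following on the contents of the cells\<close>

lemma orbit_enumeration:
  fixes e :: cell
  assumes "s permutes D" "finite D"
  defines "n \<equiv> card (orbit s e)"
  shows "n > 0" "(s ^^ n) e = e" "inj_on (\<lambda>i. (s ^^ i) e) {0..<n}" "(\<lambda>i. (s ^^ i) e) ` {0..<n} = orbit s e"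
proof -
  \<comment> \<open>The period of \<open>e\<close>. It turns out to be the size of the orbit, so the
    \<open>card x\<close> steps of \<open>follow\<close> visit every cell of the cycle once and the
    next cell would be \<open>e\<close> again.\<close>
  define p where "p = (LEAST m. m > 0 \<and> (s ^^ m) e = e)"
  have ex: "\<exists>m. m > 0 \<and> (s ^^ m) e = e" using permutes_period[OF assms(1,2)] by (metis id_apply)
  have p: "p > 0" "(s ^^ p) e = e" using LeastI_ex[OF ex] by (auto simp: p_def)
  have least: "p \<le> m" if "m > 0" "(s ^^ m) e = e" for m using that unfolding p_def by (auto intro: Least_le)
  have inj_s: "inj (s ^^ m)" for m using assms(1) permutes_funpow permutes_inj by blast
  have "i = j" if "i \<le> j" "j < p" "(s ^^ i) e = (s ^^ j) e" for i j
  proof (rule ccontr)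
    assume "i \<noteq> j"
    have "(s ^^ i) ((s ^^ (j - i)) e) = (s ^^ i) e"
      using that by (simp add: funpow_add[THEN fun_cong, unfolded o_apply, symmetric])
    then have "(s ^^ (j - i)) e = e" using inj_s by (simp add: inj_eq)
    then show False using least[of "j - i"] that \<open>i \<noteq> j\<close> by simp
  qed
  then have inj: "inj_on (\<lambda>i. (s ^^ i) e) {0..<p}"
    by (intro inj_onI) (metis atLeastLessThan_iff nle_le)
  have img: "(\<lambda>i. (s ^^ i) e) ` {0..<p} = orbit s e"
  proof
    show "orbit s e \<subseteq> (\<lambda>i. (s ^^ i) e) ` {0..<p}"
    proof (rule orbit_subset_closed)
      show "e \<in> (\<lambda>i. (s ^^ i) e) ` {0..<p}" using p by (auto intro!: image_eqI[of _ _ 0])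
      fix x assume "x \<in> (\<lambda>i. (s ^^ i) e) ` {0..<p}"
      then obtain i where i: "i < p" "s x = (s ^^ Suc i) e" by auto
      show "s x \<in> (\<lambda>i. (s ^^ i) e) ` {0..<p}"
      proof (cases "Suc i = p")
        case True then show ?thesis using p i by (intro image_eqI[of _ _ 0]) auto
      next
        case False then show ?thesis using i by (intro image_eqI[of _ _ "Suc i"]) auto
      qed
    qed
  qed (auto simp: orbit_def)
  have "n = p" unfolding n_def img[symmetric] card_image[OF inj] by simp
  then show "n > 0" "(s ^^ n) e = e" "inj_on (\<lambda>i. (s ^^ i) e) {0..<n}" "(\<lambda>i. (s ^^ i) e) ` {0..<n} = orbit s e"
    using p inj img by auto
qed

lemma pns_follow:
  assumes s: "s permutes D" "finite D"
  shows "foldl pns (L, None) (follow s (orbit s e) e) =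
    (\<lambda>p. if p \<in> orbit s e then L (inv s p) else L p, None)"
proof -
  define n where "n = card (orbit s e)"
  note en = orbit_enumeration[OF s, of e, folded n_def]
  have inv: "inv s ((s ^^ Suc i) e) = (s ^^ i) e" for i
    using permutes_inverses[OF s(1)] by simp
  \<comment> \<open>Invariant before the cycle closes: the entry cell is empty, every other visited
    cell already holds the item of its predecessor, and the item of the cell visited last is in the
    hand.\<close>
  have part: "foldl pns (L, None) (map (\<lambda>i. (s ^^ i) e) [0..<Suc j]) =
     (\<lambda>p. if p = e then None else if p \<in> (\<lambda>i. (s ^^ i) e) ` {1..j} then L (inv s p) else L p, L ((s ^^ j) e))"
    if "j < n" for j
    using that
  proof (induction j)
    case 0 then show ?case by (auto simp: pns_def)
  next
    case (Suc j)
    let ?p = "(s ^^ Suc j) e"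
    have ne: "?p \<noteq> (s ^^ i) e" if "i \<le> j" for i
      using inj_onD[OF en(3), of "Suc j" i] that Suc.prems by auto
    then have "?p \<noteq> e" "?p \<notin> (\<lambda>i. (s ^^ i) e) ` {1..j}"
      using ne[of 0] by (simp, metis (no_types, lifting) atLeastAtMost_iff image_iff ne)
    moreover have img: "(\<lambda>i. (s ^^ i) e) ` {1..Suc j} = insert ?p ((\<lambda>i. (s ^^ i) e) ` {1..j})"
      by (simp add: atLeastAtMostSuc_conv)
    moreover have step: "foldl pns (L, None) (map (\<lambda>i. (s ^^ i) e) [0..<Suc (Suc j)]) =
        pns (foldl pns (L, None) (map (\<lambda>i. (s ^^ i) e) [0..<Suc j])) ?p"
      by simp
    ultimately show ?case
      unfolding step Suc.IH[OF Suc_lessD[OF Suc.prems]] unfolding pns_def fst_conv snd_conv img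
      by (simp add: fun_eq_iff inv[of j] del: funpow.simps)
  qed
  obtain j where j: "n = Suc j" using en(1) by (cases n) auto
  have last: "inv s e = (s ^^ j) e" using inv[of j] en(2) by (simp add: j)
  have orb: "orbit s e = insert e ((\<lambda>i. (s ^^ i) e) ` {1..j})"
  proof -
    have "{0..<n} = insert 0 {1..j}" using j by auto
    then show ?thesis using en(4) by simp
  qed
  have "foldl pns (L, None) (follow s (orbit s e) e) =
      pns (foldl pns (L, None) (map (\<lambda>i. (s ^^ i) e) [0..<Suc j])) e"
    unfolding follow_def n_def[symmetric] j by simp
  also have "\<dots> = (\<lambda>p. if p \<in> orbit s e then L (inv s p) else L p, None)"
    unfolding part[of j, unfolded j, OF lessI] orb unfolding pns_def
    using last by (simp add: fun_eq_iff)
  finally show ?thesis .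
qed

lemma pns_follow_concat:
  assumes s: "s permutes D" "finite D"
    and "distinct xs" "\<And>x. x \<in> set xs \<Longrightarrow> ent x \<in> D \<and> x = orbit s (ent x)"
  shows "foldl pns (L, None) (concat (map (\<lambda>x. follow s x (ent x)) xs)) =
    (\<lambda>p. if p \<in> \<Union>(set xs) then L (inv s p) else L p, None)"
  using assms(3,4)
proof (induction xs arbitrary: L)
  case (Cons x xs)
  have x: "x = orbit s (ent x)" using Cons.prems by simp
  have inv_mem: "inv s p \<in> y" if "y \<in> set (x # xs)" "p \<in> y" for p y
  proof -
    have y: "y = orbit s (ent y)" using Cons.prems that(1) by blast
    have "s (inv s p) = p" using permutes_inverses[OF s(1)] by simp
    then have "p \<in> orbit s (inv s p)" using orbit_step orbit_self by metis
    then have "inv s p \<in> orbit s p" using orbit_sym[OF s] by blast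
    also have "\<dots> = y" using y that(2) orbit_eq[OF s] by metis
    finally show ?thesis .
  qed
  have disj: "p \<notin> x" if "y \<in> set xs" "p \<in> y" for p y
  proof
    assume "p \<in> x"
    then have "orbit s p = x" using x orbit_eq[OF s] by metis
    moreover have "orbit s p = y" using Cons.prems(2)[of y] that orbit_eq[OF s] by (metis list.set_intros(2))
    ultimately show False using that Cons.prems(1) by auto
  qed
  have "foldl pns (L, None) (follow s x (ent x)) = (\<lambda>p. if p \<in> x then L (inv s p) else L p, None)"
    using pns_follow[OF s, of L "ent x"] x by simp
  moreover have "inv s p \<notin> x" if "y \<in> set xs" "p \<in> y" for p y
    using disj[OF that(1)] inv_mem[of y p] that by simp
  ultimately show ?case
    using Cons.IH Cons.prems disj by (auto simp: fun_eq_iff)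
qed simp

section \<open>Depth-first traversal of an arborescence\<close>

lemma in_set_concat_nth: "y \<in> set (concat xss) \<longleftrightarrow> (\<exists>i<length xss. y \<in> set (xss ! i))"
  by (metis in_set_conv_nth set_concat UN_iff)

lemma distinct_concat_nth:
  assumes "\<And>i. i < length xss \<Longrightarrow> distinct (xss ! i)"
    and "\<And>i j. i < j \<Longrightarrow> j < length xss \<Longrightarrow> set (xss ! i) \<inter> set (xss ! j) = {}"
  shows "distinct (concat xss)"
  using assms
proof (induction xss)
  case (Cons xs xss)
  have "set xs \<inter> set (concat xss) = {}"
    using Cons.prems(2)[of 0 "Suc j" for j] by (simp add: disjoint_iff in_set_concat_nth del: set_concat)
  moreover have "distinct (concat xss)"
  proof (rule Cons.IH)
    show "distinct (xss ! i)" if "i < length xss" for i using Cons.prems(1)[of "Suc i"] that by simp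
    show "set (xss ! i) \<inter> set (xss ! j) = {}" if "i < j" "j < length xss" for i j
      using Cons.prems(2)[of "Suc i" "Suc j"] that by simp
  qed
  ultimately show ?case using Cons.prems(1)[of 0] by simp
qed simp

text \<open>Serves as termination measure when a traversal is built, and tells the subtrees of
  siblings apart.\<close>

definition depth :: "(cell set \<Rightarrow> cell set) \<Rightarrow> cell set \<Rightarrow> nat" where
  "depth par x = (LEAST n. (par ^^ n) x = {p0})"

lemma depth_parent:
  assumes "arborescence N par" "{p0} \<notin> N" "x \<in> N"
  shows "depth par x = Suc (depth par (par x))"
proof -
  obtain n where "(par ^^ n) x = {p0}" using assms by (auto simp: arborescence_def)
  moreover have "(par ^^ 0) x \<noteq> {p0}" using assms by auto
  ultimately have "(LEAST n. (par ^^ n) x = {p0}) = Suc (LEAST n. (par ^^ Suc n) x = {p0})"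
    by (rule Least_Suc)
  then show ?thesis by (simp add: depth_def funpow_swap1)
qed

lemma dfs_root_in: "dfs N par x ys \<Longrightarrow> x \<in> set ys"
  by (induction rule: dfs.induct) simp

lemma dfs_subset:
  "dfs N par x ys \<Longrightarrow> x \<in> insert {p0} N \<Longrightarrow> set ys \<subseteq> insert {p0} N"
proof (induction rule: dfs.induct)
  case (1 cs x yss)
  have "set (yss ! i) \<subseteq> insert {p0} N" if "i < length yss" for i
  proof -
    have "cs ! i \<in> set cs" using 1(3) that by (simp add: list_all2_conv_all_nth)
    then show ?thesis using 1(2,3) that by (simp add: list_all2_conv_all_nth)
  qed
  then have "set (concat yss) \<subseteq> insert {p0} N" 
    unfolding subset_iff in_set_concat_nth by blast
  then show ?case using 1(4) by simp
qed

lemma dfs_closed: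
  "dfs N par x ys \<Longrightarrow> z \<in> N \<Longrightarrow> par z \<in> set ys \<Longrightarrow> z \<in> set ys"
proof (induction arbitrary: z rule: dfs.induct)
  case (1 cs x yss)
  note l = 1(3)[unfolded list_all2_conv_all_nth]
  show ?case
  proof (cases "par z = x")
    case True
    then have "z \<in> set cs" using 1(2,4) by simp
    then obtain i where i: "i < length cs" "cs ! i = z" by (meson in_set_conv_nth)
    then have "z \<in> set (yss ! i)" using l dfs_root_in by blast
    then have "z \<in> set (concat yss)" using i(1) l unfolding in_set_concat_nth by auto
    then show ?thesis by simp
  next
    case False
    then obtain i where i: "i < length yss" "par z \<in> set (yss ! i)"
      using 1(5) in_set_concat_nth[of "par z" yss] by (auto simp del: set_concat)
    have "i < length cs" using i(1) conjunct1[OF l] by (simp only:)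
    from l[THEN conjunct2, THEN spec, THEN mp, OF this, THEN conjunct2, THEN spec, THEN mp, THEN mp, OF 1(4) i(2)]
    have "z \<in> set (yss ! i)" .
    then have "z \<in> set (concat yss)" unfolding in_set_concat_nth using i by blast
    then show ?thesis by simp
  qed
qed

text \<open>Every node reaches the root by finitely many parent steps, and a traversal is closed
  under taking children; the induction is on the number of steps.\<close>

lemma dfs_complete:
  assumes "arborescence N par" "dfs N par {p0} ys"
  shows "set ys = insert {p0} N"
proof
  have "x \<in> set ys" if "x \<in> insert {p0} N" "(par ^^ n) x = {p0}" for x n
    using that
  proof (induction n arbitrary: x)
    case 0
    then show ?case using dfs_root_in[OF assms(2)] by simp
  next
    case (Suc n)
    show ?case
    proof (cases "x = {p0}")
      case True
      then show ?thesis using dfs_root_in[OF assms(2)] by simp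
    next
      case False
      then have "x \<in> N" using Suc by simp
      moreover have "par x \<in> insert {p0} N" using assms(1) \<open>x \<in> N\<close> by (auto simp: arborescence_def)
      ultimately show ?thesis
        using Suc.IH[of "par x"] Suc.prems dfs_closed[OF assms(2)] by (simp add: funpow_swap1)
    qed
  qed
  then show "insert {p0} N \<subseteq> set ys"
    using assms(1) dfs_root_in[OF assms(2)] by (auto simp: arborescence_def)
  show "set ys \<subseteq> insert {p0} N" using dfs_subset[OF assms(2)] by simp
qed

text \<open>Whatever is listed below \<open>x\<close> descends from \<open>x\<close>. Expressing the
  number of parent steps through depths makes the ancestor at a given depth a function of the
  node.\<close>

lemma dfs_ancestor:
  assumes "arborescence N par" "{p0} \<notin> N" "dfs N par x ys" "y \<in> set ys"
  shows "depth par x \<le> depth par y \<and> (par ^^ (depth par y - depth par x)) y = x"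
  using assms(3,4)
proof (induction arbitrary: y rule: dfs.induct)
  case (1 cs x yss)
  show ?case
  proof (cases "y = x")
    case False
    then obtain i where i: "i < length yss" "y \<in> set (yss ! i)"
      using 1(4) in_set_concat_nth[of y yss] by (auto simp del: set_concat)
    define c where "c = cs ! i"
    have c: "c \<in> N" "par c = x" using i 1(2,3) nth_mem[of i cs] by (auto simp: c_def list_all2_conv_all_nth)
    have IH: "depth par c \<le> depth par y" "(par ^^ (depth par y - depth par c)) y = c"
      using 1(3) i by (auto simp: list_all2_conv_all_nth c_def)
    have d: "depth par c = Suc (depth par x)" using depth_parent[OF assms(1,2) c(1)] c(2) by simp
    then have "depth par y - depth par x = Suc (depth par y - depth par c)" using IH(1) by simp
    then show ?thesis using IH c d by simp
  qed simp
qed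

text \<open>A node occurring in the subtrees of two siblings would have two different ancestors at
  the same depth.\<close>

lemma dfs_distinct:
  assumes "arborescence N par" "{p0} \<notin> N" "dfs N par x ys"
  shows "distinct ys"
  using assms(3)
proof (induction rule: dfs.induct)
  case (1 cs x yss)
  note l = 1(3)[unfolded list_all2_conv_all_nth]
  have anc: "depth par y \<ge> Suc (depth par x)"
    "(par ^^ (depth par y - Suc (depth par x))) y = cs ! i" if "i < length yss" "y \<in> set (yss ! i)" for i y
  proof -
    have c: "cs ! i \<in> N" "par (cs ! i) = x" using 1(2) l that(1) nth_mem[of i cs] by auto
    have d: "depth par (cs ! i) = Suc (depth par x)" using depth_parent[OF assms(1,2) c(1)] c(2) by simp
    show "depth par y \<ge> Suc (depth par x)" "(par ^^ (depth par y - Suc (depth par x))) y = cs ! i"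
      using dfs_ancestor[OF assms(1,2), of "cs ! i" "yss ! i" y] l that d by auto
  qed
  have x: "x \<notin> set (concat yss)"
    unfolding in_set_concat_nth using anc(1) Suc_n_not_le_n by blast
  have disj: "set (yss ! i) \<inter> set (yss ! j) = {}" if "i < length yss" "j < length yss" "i \<noteq> j" for i j
  proof (rule ccontr)
    assume "set (yss ! i) \<inter> set (yss ! j) \<noteq> {}"
    then obtain y where "y \<in> set (yss ! i)" "y \<in> set (yss ! j)" by blast
    then have "cs ! i = cs ! j" using anc(2) that by metis
    then show False using 1(1) that l by (simp add: nth_eq_iff_index_eq)
  qed
  have "distinct (concat yss)"
    using l disj by (intro distinct_concat_nth) auto
  then show ?case using x by simp
qed

section \<open>Minimum-weight matchings\<close>

lemma cdist_nonneg [simp]: "cdist p q \<ge> 0"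
  by (simp add: cdist_def)

lemma cdist_self [simp]: "cdist p p = 0"
  by (simp add: cdist_def)

lemma cdist_commute: "cdist p q = cdist q p"
  by (simp add: cdist_def power2_commute)

lemma cdist_triangle: "cdist p r \<le> cdist p q + cdist q r"
proof -
  define z where "z p = Complex (real (fst p)) (real (snd p))" for p :: cell
  have "cdist p q = cmod (z p - z q)" for p q
    by (simp add: cdist_def z_def cmod_def)
  moreover have "cmod (z p - z r) \<le> cmod (z p - z q) + cmod (z q - z r)"
    using norm_triangle_ineq[of "z p - z q" "z q - z r"] by simp
  ultimately show ?thesis by simp
qed

lemma sum_update2:
  fixes h :: "'a \<Rightarrow> 'b \<Rightarrow> real"
  assumes "finite S" "u \<in> S" "v \<in> S" "u \<noteq> v"
  shows "(\<Sum>x\<in>S. h x ((s(u := p, v := q)) x)) =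
    (\<Sum>x\<in>S. h x (s x)) - h u (s u) - h v (s v) + h u p + h v q"
proof -
  have S: "S = insert u (insert v (S - {u, v}))" using assms by auto
  have "(\<Sum>x\<in>S. g x) = g u + g v + (\<Sum>x\<in>S - {u, v}. g x)" for g :: "'a \<Rightarrow> real"
    by (subst S) (use assms in simp)
  note split = this
  have "(\<Sum>x\<in>S - {u, v}. h x ((s(u := p, v := q)) x)) = (\<Sum>x\<in>S - {u, v}. h x (s x))"
    by (rule sum.cong) auto
  then show ?thesis
    using split[of "\<lambda>x. h x ((s(u := p, v := q)) x)"] split[of "\<lambda>x. h x (s x)"] assms(4) by simp
qed

lemma type_permutation_exists:
  assumes "finite S" "\<And>t. card {c \<in> S. f c = t} = card {c \<in> S. g c = t}"
  shows "\<exists>p. p permutes S \<and> (\<forall>c\<in>S. g (p c) = f c)"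
proof -
  have "count (image_mset h (mset_set S)) t = card {c \<in> S. h c = t}" for h :: "'a \<Rightarrow> 'b" and t
    using assms(1) by (simp add: count_image_mset vimage_def Int_def conj_commute)
  then have "image_mset f (mset_set S) = image_mset g (mset_set S)"
    using assms(2) by (intro multiset_eqI) simp
  from image_mset_eq_implies_permutes[OF assms(1) this] show ?thesis by metis
qed

text \<open>Minimizing the total cost over all type-preserving permutations is enough: if some type
  had a cheaper matching, it could be grafted onto the minimizer without touching the other
  types.\<close>

lemma phase1_exists:
  assumes bal: "\<And>t. card {c \<in> lattice k. init c = t} = card {c \<in> lattice k. goal c = t}"
  shows "\<exists>\<sigma>. phase1 k init goal \<sigma>"
proof -
  define D where "D = misplaced k init goal"
  have D: "finite D" by (simp add: D_def)
  define P where "P = {\<sigma>. \<sigma> permutes D \<and> (\<forall>c\<in>D. goal (\<sigma> c) = init c)}"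
  define C where "C \<sigma> = (\<Sum>c\<in>D. cdist c (\<sigma> c))" for \<sigma> :: "cell \<Rightarrow> cell"
  \<comment> \<open>Well-placed cells of type \<open>t\<close> are counted on both sides and
    cancel.\<close>
  have "card {c \<in> D. init c = t} = card {c \<in> D. goal c = t}" for t
  proof -
    let ?W = "{c \<in> lattice k. init c = t \<and> goal c = t}"
    have "{c \<in> lattice k. init c = t} = {c \<in> D. init c = t} \<union> ?W"
      "{c \<in> lattice k. goal c = t} = {c \<in> D. goal c = t} \<union> ?W"
      by (auto simp: D_def misplaced_def)
    moreover have "card ({c \<in> D. init c = t} \<union> ?W) = card {c \<in> D. init c = t} + card ?W"
      "card ({c \<in> D. goal c = t} \<union> ?W) = card {c \<in> D. goal c = t} + card ?W"
      by (rule card_Un_disjoint; auto simp: D_def misplaced_def)+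
    ultimately show ?thesis using bal[of t] by simp
  qed
  then have "P \<noteq> {}" using type_permutation_exists[OF D, of init goal] by (auto simp: P_def)
  moreover have "finite P" using finite_permutations[OF D] by (auto simp: P_def)
  ultimately obtain \<sigma> where \<sigma>: "\<sigma> \<in> P" and min: "\<And>\<tau>. \<tau> \<in> P \<Longrightarrow> C \<sigma> \<le> C \<tau>"
    using arg_min_if_finite(1) arg_min_least by metis
  have "(\<Sum>c\<in>{c \<in> D. init c = t}. cdist c (\<sigma> c)) \<le> (\<Sum>c\<in>{c \<in> D. init c = t}. cdist c (f c))"
    if f: "bij_betw f {c \<in> D. init c = t} {c \<in> D. goal c = t}" for t f
  proof -
    define A where "A = {c \<in> D. init c = t}"
    define B where "B = {c \<in> D. goal c = t}"
    have AB: "A \<subseteq> D" "B \<subseteq> D" by (auto simp: A_def B_def)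
    define \<tau> where "\<tau> c = (if c \<in> A then f c else \<sigma> c)" for c
    have \<sigma>D: "\<sigma> c \<in> D \<longleftrightarrow> c \<in> D" for c using \<sigma> by (simp add: P_def permutes_in_image)
    have "\<sigma> ` (D - A) = D - B"
    proof
      show "\<sigma> ` (D - A) \<subseteq> D - B" using \<sigma> \<sigma>D by (auto simp: A_def B_def P_def)
      show "D - B \<subseteq> \<sigma> ` (D - A)"
      proof
        fix d assume d: "d \<in> D - B"
        then obtain c where c: "c \<in> D" "d = \<sigma> c"
          using \<sigma> permutes_image[of \<sigma> D] unfolding P_def by blast
        then have "c \<in> D - A" using d \<sigma> by (auto simp: A_def B_def P_def)
        then show "d \<in> \<sigma> ` (D - A)" using c by blast
      qed
    qed
    moreover have "inj_on \<sigma> (D - A)" using \<sigma> permutes_inj_on by (auto simp: P_def)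
    ultimately have "bij_betw \<sigma> (D - A) (D - B)" by (simp add: bij_betw_def)
    then have "bij_betw \<tau> (A \<union> (D - A)) (B \<union> (D - B))"
      unfolding \<tau>_def using f by (intro bij_betw_disjoint_Un) (auto simp: A_def B_def)
    then have "bij_betw \<tau> D D" using AB by (simp add: Un_absorb1)
    moreover have "\<tau> c = c" if "c \<notin> D" for c
      using that \<sigma> AB permutes_not_in[of \<sigma> D c] by (auto simp: \<tau>_def P_def)
    ultimately have "\<tau> permutes D" by (simp add: bij_imp_permutes)
    moreover have "goal (\<tau> c) = init c" if "c \<in> D" for c
      using that \<sigma> bij_betwE[OF f, rule_format, of c] by (auto simp: \<tau>_def A_def P_def)
    ultimately have "\<tau> \<in> P" by (simp add: P_def)
    then have "C \<sigma> \<le> C \<tau>" by (rule min)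
    moreover have "C \<rho> = (\<Sum>c\<in>D - A. cdist c (\<rho> c)) + (\<Sum>c\<in>A. cdist c (\<rho> c))" for \<rho>
      unfolding C_def by (rule sum.subset_diff[OF AB(1) D])
    moreover have "(\<Sum>c\<in>D - A. cdist c (\<tau> c)) = (\<Sum>c\<in>D - A. cdist c (\<sigma> c))"
      "(\<Sum>c\<in>A. cdist c (\<tau> c)) = (\<Sum>c\<in>A. cdist c (f c))"
      by (auto simp: \<tau>_def intro!: sum.cong)
    ultimately show ?thesis unfolding A_def by simp
  qed
  then have "phase1 k init goal \<sigma>"
    using \<sigma> by (simp add: phase1_def Let_def P_def D_def[symmetric])
  then show ?thesis by blast
qed

lemma phase1_optimal:
  assumes \<sigma>: "phase1 k init goal \<sigma>" and D: "D = misplaced k init goal"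
    and \<tau>: "\<tau> permutes D" "\<forall>c\<in>D. goal (\<tau> c) = init c"
  shows "(\<Sum>c\<in>D. cdist c (\<sigma> c)) \<le> (\<Sum>c\<in>D. cdist c (\<tau> c))"
proof -
  have fin: "finite D" by (simp add: D)
  have "(\<Sum>c\<in>{c \<in> D. init c = t}. cdist c (\<sigma> c)) \<le> (\<Sum>c\<in>{c \<in> D. init c = t}. cdist c (\<tau> c))" for t
  proof -
    have "\<tau> ` {c \<in> D. init c = t} = {c \<in> D. goal c = t}"
    proof
      show "\<tau> ` {c \<in> D. init c = t} \<subseteq> {c \<in> D. goal c = t}"
        using \<tau> by (auto simp: permutes_in_image)
      show "{c \<in> D. goal c = t} \<subseteq> \<tau> ` {c \<in> D. init c = t}"
      proof
        fix d assume d: "d \<in> {c \<in> D. goal c = t}"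
        then obtain c where "c \<in> D" "d = \<tau> c" using permutes_image[OF \<tau>(1)] by blast
        then show "d \<in> \<tau> ` {c \<in> D. init c = t}" using d \<tau>(2) by auto
      qed
    qed
    then have "bij_betw \<tau> {c \<in> D. init c = t} {c \<in> D. goal c = t}"
      using permutes_inj_on[OF \<tau>(1)] by (simp add: bij_betw_def)
    then show ?thesis using \<sigma> by (simp add: phase1_def Let_def D)
  qed
  then show ?thesis
    using sum.image_gen[OF fin, of "\<lambda>c. cdist c (\<sigma> c)" init] sum.image_gen[OF fin, of "\<lambda>c. cdist c (\<tau> c)" init]
    by (simp add: sum_mono)
qed

text \<open>Well-placed cells are short-cut one at a time out of a type-preserving permutation.\<close>

lemma phase1_optimal_lattice:
  assumes \<sigma>: "phase1 k init goal \<sigma>" and D: "D = misplaced k init goal"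
    and "\<tau> permutes lattice k" "\<forall>c\<in>lattice k. goal (\<tau> c) = init c"
  shows "(\<Sum>c\<in>D. cdist c (\<sigma> c)) \<le> (\<Sum>c\<in>lattice k. cdist c (\<tau> c))"
  using assms(3,4)
proof (induction "card {c \<in> lattice k - D. \<tau> c \<noteq> c}" arbitrary: \<tau> rule: less_induct)
  case less
  let ?B = "\<lambda>\<tau>. {c \<in> lattice k - D. \<tau> c \<noteq> c}"
  have sub: "D \<subseteq> lattice k" by (auto simp: D misplaced_def)
  show ?case
  proof (cases "?B \<tau> = {}")
    case True
    then have "\<tau> permutes D" using permutes_superset[OF less(2), of D] by auto
    then have "(\<Sum>c\<in>D. cdist c (\<sigma> c)) \<le> (\<Sum>c\<in>D. cdist c (\<tau> c))"
      using less(3) sub by (intro phase1_optimal[OF \<sigma> D]) auto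
    also have "\<dots> \<le> (\<Sum>c\<in>lattice k. cdist c (\<tau> c))"
      using sub by (intro sum_mono2) auto
    finally show ?thesis .
  next
    case False
    then obtain c where c: "c \<in> lattice k" "c \<notin> D" "\<tau> c \<noteq> c" by auto
    define b where "b = inv \<tau> c"
    have b: "\<tau> b = c" using permutes_inverses[OF less(2)] by (simp add: b_def)
    have bl: "b \<in> lattice k" using c(1) b permutes_in_image[OF less(2), of b] by simp
    have bc: "b \<noteq> c" using b c by auto
    \<comment> \<open>The item of \<open>b\<close>, which was sent to the well-placed cell
      \<open>c\<close>, goes directly to \<open>\<tau> c\<close>, and the item of \<open>c\<close>
      stays where it is. Types agree because \<open>c\<close> has the same initial and goal
      type.\<close>
    define \<tau>' where "\<tau>' = \<tau>(b := \<tau> c, c := \<tau> b)"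
    have per: "\<tau>' permutes lattice k"
      unfolding \<tau>'_def using less(2) bl c(1) by (rule goal_swap_permutes)
    have "init c = goal c" using c by (auto simp: D misplaced_def)
    then have g: "\<forall>c\<in>lattice k. goal (\<tau>' c) = init c"
      using less(3) b bl c(1) by (auto simp: \<tau>'_def)
    have "?B \<tau>' \<subseteq> ?B \<tau> - {c}" using b bc by (auto simp: \<tau>'_def split: if_splits)
    moreover have "c \<in> ?B \<tau>" using c by simp
    ultimately have "card (?B \<tau>') < card (?B \<tau>)"
      by (intro psubset_card_mono) auto
    then have "(\<Sum>c\<in>D. cdist c (\<sigma> c)) \<le> (\<Sum>c\<in>lattice k. cdist c (\<tau>' c))"
      using per g by (rule less(1))
    also have "\<dots> = (\<Sum>c\<in>lattice k. cdist c (\<tau> c)) - cdist b c - cdist c (\<tau> c) + cdist b (\<tau> c) + cdist c c"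
      unfolding \<tau>'_def using sum_update2[OF finite_lattice bl c(1) bc, of cdist \<tau> "\<tau> c" "\<tau> b"] b by simp
    also have "\<dots> \<le> (\<Sum>c\<in>lattice k. cdist c (\<tau> c))"
      using cdist_triangle[of b "\<tau> c" c] by simp
    finally show ?thesis .
  qed
qed

section \<open>Minimum number of pick-n-swaps\<close>

lemma finite_dist_set: "finite a \<Longrightarrow> finite b \<Longrightarrow> finite {cdist u v | u v. u \<in> a \<and> v \<in> b}"
  by (rule finite_subset[of _ "(\<lambda>(u, v). cdist u v) ` (a \<times> b)"]) auto

lemma ndist_attained:
  assumes "finite a" "finite b" "a \<noteq> {}" "b \<noteq> {}"
  shows "\<exists>u\<in>a. \<exists>v\<in>b. cdist u v = ndist a b"
proof -
  have "{cdist u v | u v. u \<in> a \<and> v \<in> b} \<noteq> {}" using assms by auto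
  from Min_in[OF finite_dist_set[OF assms(1,2)] this]
  obtain u v where "ndist a b = cdist u v" "u \<in> a" "v \<in> b"
    unfolding ndist_def[symmetric] by blast
  then show ?thesis by metis
qed

text \<open>There are infinitely many parent functions, but the cost only sees their values on
  \<open>N\<close>, so finitely many costs occur. The star with all cycles attached to the root
  shows that there is at least one arborescence.\<close>

lemma min_arborescence_exists:
  assumes "finite N"
  shows "\<exists>par. min_arborescence N par"
proof -
  define C where "C par = (\<Sum>x\<in>N. ndist (par x) x)" for par :: "cell set \<Rightarrow> cell set"
  have "C ` Collect (arborescence N) \<subseteq> C ` (N \<rightarrow>\<^sub>E insert {p0} N)"
  proof
    fix y assume "y \<in> C ` Collect (arborescence N)"
    then obtain par where par: "arborescence N par" "y = C par" by auto
    have "C par = C (restrict par N)" by (simp add: C_def)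
    moreover have "restrict par N \<in> N \<rightarrow>\<^sub>E insert {p0} N" using par by (auto simp: arborescence_def)
    ultimately show "y \<in> C ` (N \<rightarrow>\<^sub>E insert {p0} N)" using par(2) by blast
  qed
  moreover have "finite (N \<rightarrow>\<^sub>E insert {p0} N)" using assms by (simp add: finite_PiE)
  ultimately have fin: "finite (C ` Collect (arborescence N))" by (meson finite_imageI finite_subset)
  have "arborescence N (\<lambda>_. {p0})"
    unfolding arborescence_def by (auto intro: exI[of _ "Suc 0"])
  then have "C ` Collect (arborescence N) \<noteq> {}" by blast
  then have "Min (C ` Collect (arborescence N)) \<in> C ` Collect (arborescence N)" using fin by (intro Min_in)
  then obtain par where "arborescence N par" "C par = Min (C ` Collect (arborescence N))" by auto
  then have "min_arborescence N par"
    using Min_le[OF fin] by (auto simp: min_arborescence_def C_def)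
  then show ?thesis by blast
qed

lemma dfs_exists:
  assumes "finite N" "arborescence N par" "{p0} \<notin> N"
  shows "\<exists>ys. dfs N par x ys"
proof (induction "Max (depth par ` N) - depth par x" arbitrary: x rule: less_induct)
  case less
  define cs where "cs = (SOME cs. distinct cs \<and> set cs = {y \<in> N. par y = x})"
  have cs: "distinct cs \<and> set cs = {y \<in> N. par y = x}"
    unfolding cs_def by (rule someI_ex) (use assms(1) finite_distinct_list[of "{y \<in> N. par y = x}"] in auto)
  have "\<exists>ys. dfs N par y ys" if y: "y \<in> set cs" for y
  proof (rule less)
    have "y \<in> N" "par y = x" using y cs by simp_all
    then have "depth par y = Suc (depth par x)" using depth_parent[OF assms(2,3)] by simp
    moreover have "depth par y \<le> Max (depth par ` N)" using \<open>y \<in> N\<close> assms(1) by simp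
    ultimately show "Max (depth par ` N) - depth par y < Max (depth par ` N) - depth par x" by simp
  qed
  then have "list_all2 (dfs N par) cs (map (\<lambda>y. SOME ys. dfs N par y ys) cs)"
    by (simp add: list_all2_conv_all_nth someI_ex)
  then show ?case using dfs.intros[of cs N par x] cs by blast
qed

lemma pns_unvisited: "p \<notin> set ps \<Longrightarrow> fst (foldl pns st ps) p = fst st p"
proof (induction ps rule: rev_induct)
  case (snoc a ps)
  then show ?case by (simp add: pns_def)
qed simp

text \<open>With all items of types \<open>K\<close> lying inside \<open>R\<close>, none of them can
  get into the hand, nor to a cell outside \<open>R\<close>, before \<open>R\<close> is
  visited.\<close>

lemma pns_outside_invariant:
  assumes "\<And>p t. p \<notin> R \<Longrightarrow> t \<in> K \<Longrightarrow> fst st p \<noteq> Some t" "\<And>t. t \<in> K \<Longrightarrow> snd st \<noteq> Some t"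
    and "set ps \<inter> R = {}" "t \<in> K"
  shows "snd (foldl pns st ps) \<noteq> Some t"
proof -
  have "(\<forall>p. p \<notin> R \<longrightarrow> (\<forall>t\<in>K. fst (foldl pns st ps) p \<noteq> Some t)) \<and> (\<forall>t\<in>K. snd (foldl pns st ps) \<noteq> Some t)"
    using assms(3)
  proof (induction ps rule: rev_induct)
    case Nil then show ?case using assms(1,2) by simp
  next
    case (snoc a ps)
    then have "a \<notin> R" and IH: "\<forall>p. p \<notin> R \<longrightarrow> (\<forall>t\<in>K. fst (foldl pns st ps) p \<noteq> Some t)"
      "\<forall>t\<in>K. snd (foldl pns st ps) \<noteq> Some t" by auto
    define st' where "st' = foldl pns st ps"
    have step: "foldl pns st (ps @ [a]) = ((fst st')(a := snd st'), fst st' a)"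
      by (simp add: st'_def pns_def)
    show ?case
      unfolding step fst_conv snd_conv using IH[folded st'_def] \<open>a \<notin> R\<close> by (metis fun_upd_apply)
  qed
  then show ?thesis using assms(4) by blast
qed

text \<open>The first visit to the region of a closed set of types brings an item of a foreign type
  (or nothing), so that the visited cell has to be visited again.\<close>

lemma visits_lower_bound:
  assumes vp: "valid_plan k init goal ps"
    and cl: "\<And>c. c \<in> lattice k \<Longrightarrow> init c \<in> K \<Longrightarrow> goal c \<in> K"
    and x: "x \<subseteq> misplaced k init goal" "goal ` x \<subseteq> K" "x \<noteq> {}"
  shows "card x + 1 \<le> length (filter (\<lambda>p. p \<in> lattice k \<and> goal p \<in> K) ps)"
proof -
  define R where "R = {c \<in> lattice k. goal c \<in> K}"
  define st0 :: "(cell \<Rightarrow> nat option) \<times> nat option"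
    where "st0 = (\<lambda>c. if c \<in> lattice k then Some (init c) else None, None)"
  have exec: "exec k init qs = foldl pns st0 qs" for qs by (simp add: exec_def st0_def)
  define qs where "qs = filter (\<lambda>p. p \<in> R) ps"
  have fin: "fst (foldl pns st0 ps) c = Some (goal c)" if "c \<in> lattice k" for c
    using vp that by (simp add: valid_plan_def exec)
  have xR: "x \<subseteq> R" using x by (auto simp: R_def misplaced_def)
  have "p \<in> set ps" if "p \<in> x" for p
  proof (rule ccontr)
    assume "p \<notin> set ps"
    then have "fst (foldl pns st0 ps) p = Some (init p)"
      using pns_unvisited[of p ps st0] that xR by (auto simp: st0_def R_def)
    moreover have "p \<in> lattice k" "init p \<noteq> goal p" using that x by (auto simp: misplaced_def)
    ultimately show False using fin by simp
  qed
  then have xq: "x \<subseteq> set qs" using xR by (auto simp: qs_def)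
  have "\<not> distinct qs"
  proof
    assume d: "distinct qs"
    obtain p where "p \<in> x" using x(3) by blast
    then have "\<exists>p\<in>set ps. p \<in> R" using xq by (auto simp: qs_def)
    then obtain pre c post where ps: "ps = pre @ c # post" "c \<in> R" "\<forall>p\<in>set pre. p \<notin> R"
      using split_list_first_prop[of ps "\<lambda>p. p \<in> R"] by blast
    have "c \<notin> set post" using d ps by (auto simp: qs_def)
    define st where "st = foldl pns st0 pre"
    have "fst (foldl pns st0 ps) c = fst (pns st c) c"
      unfolding ps(1) st_def using pns_unvisited[OF \<open>c \<notin> set post\<close>] by simp
    also have "\<dots> = snd st" by (simp add: pns_def)
    finally have "snd st = Some (goal c)" using fin ps(2) by (simp add: R_def)
    moreover have "snd st \<noteq> Some (goal c)"
      unfolding st_def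
    proof (rule pns_outside_invariant[of R K])
      show "fst st0 p \<noteq> Some t" if "p \<notin> R" "t \<in> K" for p t
        using that cl[of p] by (auto simp: st0_def R_def)
    qed (use ps in \<open>auto simp: st0_def R_def\<close>)
    ultimately show False by simp
  qed
  then have "card (set qs) < length qs"
    using card_length[of qs] card_distinct[of qs] by (cases "card (set qs) = length qs") auto
  moreover have "card x \<le> card (set qs)" using xq by (intro card_mono) auto
  ultimately show ?thesis by (simp add: qs_def R_def)
qed

lemma sum_visits_le:
  assumes "finite N" "\<And>p x y. x \<in> N \<Longrightarrow> y \<in> N \<Longrightarrow> P x p \<Longrightarrow> P y p \<Longrightarrow> x = y"
  shows "(\<Sum>x\<in>N. length (filter (P x) ps)) \<le> length ps"
proof (induction ps)
  case (Cons p ps)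
  have "(\<Sum>x\<in>N. if P x p then 1 else 0 :: nat) = card {x \<in> N. P x p}"
    using assms(1) by (simp add: sum.If_cases Int_def)
  also have "\<dots> \<le> 1"
  proof (cases "\<exists>x\<in>N. P x p")
    case True
    then obtain x where "x \<in> N" "P x p" by blast
    then have "{x \<in> N. P x p} \<subseteq> {x}" using assms(2) by blast
    then show ?thesis using card_mono[of "{x}"] by simp
  next
    case False
    then have "{x \<in> N. P x p} = {}" by blast
    then show ?thesis by (simp only: card.empty)
  qed
  finally have "(\<Sum>x\<in>N. if P x p then 1 else 0 :: nat) \<le> 1" .
  moreover have "(\<Sum>x\<in>N. length (filter (P x) (p # ps))) =
      (\<Sum>x\<in>N. if P x p then 1 else 0) + (\<Sum>x\<in>N. length (filter (P x) ps))"
    by (subst sum.distrib[symmetric]) (rule sum.cong; simp)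
  ultimately show ?case using Cons by simp
qed simp

text \<open>The interface between phases 2 and 3: a type-preserving permutation of the misplaced
  cells with a single cycle per type. The set \<open>N\<close> consists of its cycles.\<close>

locale type_cycles =
  fixes k :: nat and init goal :: "cell \<Rightarrow> nat" and s :: "cell \<Rightarrow> cell"
    and D :: "cell set" and N :: "cell set set"
  defines "D \<equiv> misplaced k init goal"
    and "N \<equiv> {orbit s c | c. c \<in> misplaced k init goal}"
  assumes s: "s permutes misplaced k init goal"
    and goal_s: "\<And>c. c \<in> misplaced k init goal \<Longrightarrow> goal (s c) = init c"
    and same_orbit: "\<And>u v. u \<in> misplaced k init goal \<Longrightarrow> v \<in> misplaced k init goal \<Longrightarrow>
      init u = init v \<Longrightarrow> orbit s u = orbit s v"
begin

lemma finite_D [simp]: "finite D"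
  by (simp add: D_def)

lemma s_D: "s permutes D"
  using s by (simp add: D_def)

lemma N_image: "N = orbit s ` D"
  by (auto simp: N_def D_def)

lemma finite_N [simp]: "finite N"
  by (simp add: N_image)

lemma mem_N: "x \<in> N \<Longrightarrow> c \<in> x \<Longrightarrow> c \<in> D \<and> x = orbit s c"
  unfolding N_image using orbit_subset[OF s_D] orbit_eq[OF s_D finite_D] by blast

lemma N_nonempty: "x \<in> N \<Longrightarrow> x \<noteq> {}"
  unfolding N_image using orbit_self by blast

lemma finite_cycle: "x \<in> N \<Longrightarrow> finite x"
  using mem_N finite_subset[OF _ finite_D] by blast

lemma Union_N: "\<Union> N = D"
  unfolding N_image using orbit_subset[OF s_D] orbit_self by blast

lemma sum_cycles: "(\<Sum>x\<in>N. \<Sum>c\<in>x. f c) = (\<Sum>c\<in>D. f c)"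
proof -
  have "(\<Sum>c\<in>\<Union>N. f c) = (\<Sum>x\<in>N. \<Sum>c\<in>x. f c)"
    by (rule sum.Union_disjoint[unfolded o_def]) (use finite_cycle mem_N in blast)+
  then show ?thesis by (simp add: Union_N)
qed

text \<open>A cycle with one cell would be a fixed point, whose item would already have the right
  type.\<close>

lemma root_notin_N: "{p0} \<notin> N"
proof
  assume "{p0} \<in> N"
  then have "p0 \<in> D" "{p0} = orbit s p0" using mem_N by blast+
  then have "s p0 = p0" using orbit_step[OF orbit_self, of s p0] by (metis singletonD)
  then show False using goal_s[of p0] \<open>p0 \<in> D\<close> by (simp add: D_def misplaced_def)
qed

lemma same_type_cycle:
  assumes "x \<in> N" "y \<in> N" "u \<in> x" "v \<in> y" "init u = init v"
  shows "x = y"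
  using mem_N[OF assms(1,3)] mem_N[OF assms(2,4)] same_orbit[of u v] assms(5) by (simp add: D_def)

text \<open>A type determines the cycle on which it occurs. With \<open>k\<close> types this gives
  at most \<open>k\<close> merged cycles, hence a lower-order cost for moving between them.\<close>

lemma card_N_le: "card N \<le> card (init ` D)"
proof -
  define f where "f t = orbit s (SOME c. c \<in> D \<and> init c = t)" for t
  have "f (init c) = orbit s c" if "c \<in> D" for c
  proof -
    define d where "d = (SOME d. d \<in> D \<and> init d = init c)"
    have "d \<in> D \<and> init d = init c" unfolding d_def by (rule someI[of _ c]) (use that in simp)
    then have "orbit s d = orbit s c" using that unfolding D_def by (intro same_orbit) auto
    then show ?thesis by (simp add: f_def d_def)
  qed
  then have "N \<subseteq> f ` init ` D" unfolding N_image by force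
  then show ?thesis using card_mono[of "f ` init ` D" N] card_image_le[of "init ` D" f] by simp
qed

lemma goal_in_cycle_types:
  assumes "x \<in> N" "c \<in> x"
  shows "goal c \<in> init ` x"
proof -
  have c: "c \<in> D" "x = orbit s c" using mem_N assms by blast+
  define b where "b = inv s c"
  have "s b = c" using permutes_inverses[OF s_D] by (simp add: b_def)
  then have b: "b \<in> D" "c \<in> orbit s b"
    using permutes_in_image[OF s_D, of b] c orbit_step[OF orbit_self, of s b] by auto
  then have "b \<in> x" using orbit_sym[OF s_D finite_D] c by blast
  moreover have "goal c = init b" using goal_s[of b] b \<open>s b = c\<close> by (simp add: D_def)
  ultimately show ?thesis by blast
qed

text \<open>The types on a cycle form a closed class, because the goal type of a cell is the type of
  its predecessor on the cycle. Classes of different cycles are disjoint, so no visit is counted for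
  two cycles and the single bounds add up.\<close>

lemma pns_lower_bound:
  assumes "valid_plan k init goal ps"
  shows "card D + card N \<le> length ps"
proof -
  have dj: "x = y" if xy: "x \<in> N" "y \<in> N" "t \<in> init ` x" "t \<in> init ` y" for x y t
    using xy same_type_cycle by blast
  have "card x + 1 \<le> length (filter (\<lambda>p. p \<in> lattice k \<and> goal p \<in> init ` x) ps)" if x: "x \<in> N" for x
  proof (rule visits_lower_bound[OF assms])
    show "goal c \<in> init ` x" if c: "c \<in> lattice k" "init c \<in> init ` x" for c
    proof (cases "c \<in> D")
      case True
      then have "orbit s c \<in> N" by (simp add: N_image)
      moreover have "init c \<in> init ` orbit s c" using orbit_self by blast
      ultimately have "orbit s c = x" using dj x c by blast
      then show ?thesis using goal_in_cycle_types[OF x, of c] orbit_self by blast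
    next
      case False
      then have "init c = goal c" using c by (simp add: D_def misplaced_def)
      then show ?thesis using c by simp
    qed
    show "x \<subseteq> misplaced k init goal" using mem_N[OF x] unfolding D_def by blast
    show "goal ` x \<subseteq> init ` x" using goal_in_cycle_types[OF x] by blast
  qed (rule N_nonempty[OF x])
  then have "(\<Sum>x\<in>N. card x + 1) \<le> (\<Sum>x\<in>N. length (filter (\<lambda>p. p \<in> lattice k \<and> goal p \<in> init ` x) ps))"
    by (rule sum_mono)
  also have "\<dots> \<le> length ps"
    by (rule sum_visits_le) (use dj in auto)
  finally have "(\<Sum>x\<in>N. card x) + card N \<le> length ps" by (simp only: sum.distrib) simp
  moreover have "(\<Sum>x\<in>N. card x) = card D" using sum_cycles[of "\<lambda>_. 1 :: nat"] by simp
  ultimately show ?thesis by simp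
qed

lemma phase3E:
  assumes "phase3 D s ps"
  obtains ent L where "distinct L" "set L = N" "\<And>x. x \<in> N \<Longrightarrow> ent x \<in> x"
    "ps = concat (map (\<lambda>x. follow s x (ent x)) L)"
proof -
  have N: "{orbit s c | c. c \<in> D} = N" by (auto simp: N_image)
  obtain par ent L where *: "min_arborescence N par" "\<forall>x\<in>N. ent x \<in> x"
      "dfs N par {p0} ({p0} # L)" "ps = concat (map (\<lambda>x. follow s x (ent x)) L)"
    using assms unfolding phase3_def Let_def N by blast
  have arb: "arborescence N par" using *(1) by (simp add: min_arborescence_def)
  have "distinct ({p0} # L)" by (rule dfs_distinct[OF arb root_notin_N *(3)])
  moreover have "set ({p0} # L) = insert {p0} N" by (rule dfs_complete[OF arb *(3)])
  ultimately have "distinct L" "set L = N"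
    using root_notin_N by (simp_all add: insert_ident)
  then show ?thesis using that * by blast
qed

lemma phase3_exists: "\<exists>ps. phase3 D s ps"
proof -
  have N: "{orbit s c | c. c \<in> D} = N" by (auto simp: N_image)
  obtain par where par: "min_arborescence N par" using min_arborescence_exists finite_N by blast
  then have arb: "arborescence N par" by (simp add: min_arborescence_def)
  obtain ys where ys: "dfs N par {p0} ys" using dfs_exists[OF finite_N arb root_notin_N] by blast
  then obtain L where L: "ys = {p0} # L" by (cases rule: dfs.cases) auto
  have "\<exists>v. v \<in> x \<and> (\<exists>u\<in>par x. cdist u v = ndist (par x) x)" if "x \<in> N" for x
  proof -
    have "par x \<in> insert {p0} N" using arb that by (auto simp: arborescence_def)
    then have "finite (par x)" "par x \<noteq> {}" using finite_cycle N_nonempty by auto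
    then show ?thesis using ndist_attained finite_cycle N_nonempty that by meson
  qed
  then obtain ent where "\<forall>x\<in>N. ent x \<in> x \<and> (\<exists>u\<in>par x. cdist u (ent x) = ndist (par x) x)" by metis
  then show ?thesis unfolding phase3_def Let_def N using par ys L by blast
qed

lemma phase3_valid:
  assumes "phase3 D s ps"
  shows "valid_plan k init goal ps" "length ps = card D + card N"
proof -
  obtain ent L where L: "distinct L" "set L = N" "\<And>x. x \<in> N \<Longrightarrow> ent x \<in> x"
    and ps: "ps = concat (map (\<lambda>x. follow s x (ent x)) L)"
    using phase3E[OF assms] by blast
  have ent: "ent x \<in> D \<and> x = orbit s (ent x)" if "x \<in> set L" for x
    using mem_N[of x "ent x"] L that by blast
  have "set (follow s x (ent x)) \<subseteq> x" if "x \<in> N" for x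
  proof -
    have "x = orbit s (ent x)" using ent that L by simp
    then have "(s ^^ i) (ent x) \<in> x" for i unfolding orbit_def by blast
    then show ?thesis using L(3)[OF that] by (auto simp: follow_def)
  qed
  then have "set ps \<subseteq> D" using L(2) Union_N by (fastforce simp: ps)
  then have sub: "set ps \<subseteq> lattice k" by (auto simp: D_def misplaced_def)
  have ex: "exec k init ps = (\<lambda>p. if p \<in> D then (if inv s p \<in> lattice k then Some (init (inv s p)) else None)
      else if p \<in> lattice k then Some (init p) else None, None)"
    unfolding exec_def ps using pns_follow_concat[OF s_D finite_D L(1) ent] by (simp add: L(2) Union_N)
  have "fst (exec k init ps) c = Some (goal c)" if c: "c \<in> lattice k" for c
  proof (cases "c \<in> D")
    case True
    have i: "s (inv s c) = c" using permutes_inverses[OF s_D] by simp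
    then have d: "inv s c \<in> D" using permutes_in_image[OF s_D, of "inv s c"] True by simp
    then have "init (inv s c) = goal c" using goal_s[of "inv s c"] i by (simp add: D_def)
    moreover have "inv s c \<in> lattice k" using d by (simp add: D_def misplaced_def)
    ultimately show ?thesis unfolding ex using True by simp
  next
    case False
    then show ?thesis unfolding ex using c by (simp add: D_def misplaced_def)
  qed
  then show "valid_plan k init goal ps" unfolding valid_plan_def using sub by (simp add: ex)
  have "length ps = (\<Sum>x\<leftarrow>L. card x + 1)"
    unfolding ps by (simp add: length_concat follow_def o_def)
  also have "\<dots> = (\<Sum>x\<in>N. card x + 1)" using L by (simp add: sum_list_distinct_conv_sum_set)
  also have "\<dots> = card D + card N"
    using sum_cycles[of "\<lambda>_. 1 :: nat"] by (simp only: sum.distrib) simp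
  finally show "length ps = card D + card N" .
qed

lemma phase3_min_pns:
  assumes "phase3 D s ps"
  shows "length ps = min_pns k init goal"
  unfolding min_pns_def phase3_valid(2)[OF assms]
  by (rule Least_equality[symmetric]) (use phase3_valid[OF assms] pns_lower_bound in auto)

end

lemma PlanPTR_cycles:
  assumes "phase1 k init goal \<sigma>" "phase2 (misplaced k init goal) init \<sigma> \<sigma>'"
  shows "type_cycles k init goal \<sigma>'"
proof
  note p = phase2_properties[OF phase1D(1)[OF assms(1)] finite_misplaced phase1D(2)[OF assms(1)] assms(2)]
  show "\<sigma>' permutes misplaced k init goal" by (rule p(1))
  show "goal (\<sigma>' c) = init c" if "c \<in> misplaced k init goal" for c using p(2) that by blast
  show "orbit \<sigma>' u = orbit \<sigma>' v" if "u \<in> misplaced k init goal" "v \<in> misplaced k init goal"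
    "init u = init v" for u v by (rule p(3)[OF that])
qed

lemma PlanPTR_valid:
  assumes "PlanPTR k init goal ps"
  shows "valid_plan k init goal ps" "length ps = min_pns k init goal"
proof -
  obtain \<sigma> \<sigma>' where *: "phase1 k init goal \<sigma>" "phase2 (misplaced k init goal) init \<sigma> \<sigma>'"
    "phase3 (misplaced k init goal) \<sigma>' ps"
    using assms by (auto simp: PlanPTR_def Let_def)
  interpret type_cycles k init goal \<sigma>' "misplaced k init goal" "{orbit \<sigma>' c | c. c \<in> misplaced k init goal}"
    using PlanPTR_cycles[OF *(1,2)] by simp_all
  show "valid_plan k init goal ps" "length ps = min_pns k init goal"
    using phase3_valid(1)[OF *(3)] phase3_min_pns[OF *(3)] by auto
qed

lemma PlanPTR_exists:
  assumes "\<And>t. card {c \<in> lattice k. init c = t} = card {c \<in> lattice k. goal c = t}"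
  shows "\<exists>ps. PlanPTR k init goal ps"
proof -
  obtain \<sigma> where \<sigma>: "phase1 k init goal \<sigma>" using phase1_exists[OF assms] by blast
  obtain \<sigma>' where \<sigma>': "phase2 (misplaced k init goal) init \<sigma> \<sigma>'"
    using phase2_exists[OF finite_misplaced] by blast
  interpret type_cycles k init goal \<sigma>' "misplaced k init goal" "{orbit \<sigma>' c | c. c \<in> misplaced k init goal}"
    using PlanPTR_cycles[OF \<sigma> \<sigma>'] by simp_all
  show ?thesis using phase3_exists \<sigma> \<sigma>' by (auto simp: PlanPTR_def Let_def)
qed

section \<open>Travel\<close>

lemma path_len_simps [simp]:
  "path_len [] = 0" "path_len [a] = 0" "path_len (a # b # xs) = cdist a b + path_len (b # xs)"
  by (simp_all add: path_len_def)

lemma path_len_append: "path_len (xs @ e # ys) = path_len (xs @ [e]) + path_len (e # ys)"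
proof (induction xs)
  case (Cons a xs)
  then show ?case by (cases xs) auto
qed simp

lemma path_len_snoc: "xs \<noteq> [] \<Longrightarrow> path_len (xs @ [p]) = path_len xs + cdist (last xs) p"
  using path_len_append[of "butlast xs" "last xs" "[p]"] append_butlast_last_id[of xs]
  by (metis add.right_neutral append_Cons append_Nil append_assoc path_len_simps(2,3))

lemma path_len_map_upt: "path_len (map f [0..<Suc n]) = (\<Sum>i<n. cdist (f i) (f (Suc i)))"
proof (induction n)
  case (Suc n)
  have "path_len (map f [0..<Suc n] @ [f (Suc n)]) = path_len (map f [0..<Suc n]) + cdist (f n) (f (Suc n))"
    by (subst path_len_snoc) auto
  then show ?case using Suc by simp
qed simp

lemma path_len_follow:
  assumes "s permutes D" "finite D"
  shows "path_len (follow s (orbit s e) e) = (\<Sum>c\<in>orbit s e. cdist c (s c))"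
proof -
  let ?n = "card (orbit s e)"
  note en = orbit_enumeration[OF assms, of e]
  have "follow s (orbit s e) e = map (\<lambda>i. (s ^^ i) e) [0..<Suc ?n]"
    using en(2) by (simp add: follow_def)
  then have "path_len (follow s (orbit s e) e) = (\<Sum>i<?n. cdist ((s ^^ i) e) ((s ^^ Suc i) e))"
    by (simp only: path_len_map_upt)
  also have "\<dots> = (\<Sum>i\<in>{0..<?n}. cdist ((s ^^ i) e) (s ((s ^^ i) e)))"
    by (simp add: atLeast0LessThan)
  also have "\<dots> = (\<Sum>c\<in>(\<lambda>i. (s ^^ i) e) ` {0..<?n}. cdist c (s c))"
    using sum.reindex[OF en(3), of "\<lambda>c. cdist c (s c)"] by simp
  finally show ?thesis by (simp only: en(4))
qed

lemma follow_Cons: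
  assumes "s permutes D" "finite D"
  shows "\<exists>zs. follow s (orbit s e) e = e # zs"
  using orbit_enumeration(1)[OF assms, of e] by (simp add: follow_def upt_conv_Cons)

lemma cdist_le_abs: "cdist p q \<le> \<bar>real (fst p) - real (fst q)\<bar> + \<bar>real (snd p) - real (snd q)\<bar>"
  unfolding cdist_def by (rule sqrt_sum_squares_le_sum_abs)

lemma cdist_lattice: "p \<in> lattice k \<Longrightarrow> q \<in> lattice k \<Longrightarrow> cdist p q \<le> 2 * real k"
  using cdist_le_abs[of p q] by (auto simp: lattice_def)

text \<open>The witness \<open>\<tau>\<close> records where each item currently is; while an item from cell \<open>b\<close>
  is held, \<open>\<tau> b\<close> is the unique empty cell.\<close>

lemma travel_displacement_invariant:
  fixes init :: "cell \<Rightarrow> nat" and k :: nat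
  defines "S \<equiv> lattice k"
  assumes "set ps \<subseteq> S"
  shows "(snd (exec k init ps) = None \<and> (\<exists>\<tau>. \<tau> permutes S \<and> (\<forall>c\<in>S. fst (exec k init ps) (\<tau> c) = Some (init c)) \<and>
       (\<Sum>c\<in>S. cdist c (\<tau> c)) \<le> path_len (p0 # ps))) \<or>
     (\<exists>\<tau> b. \<tau> permutes S \<and> b \<in> S \<and> snd (exec k init ps) = Some (init b) \<and> fst (exec k init ps) (\<tau> b) = None \<and>
       (\<forall>c\<in>S - {b}. fst (exec k init ps) (\<tau> c) = Some (init c)) \<and>
       (\<Sum>c\<in>S - {b}. cdist c (\<tau> c)) + cdist b (last (p0 # ps)) \<le> path_len (p0 # ps))"
  using assms(2)
proof (induction ps rule: rev_induct)
  case Nil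
  then show ?case
    by (intro disjI1 conjI exI[of _ "\<lambda>c. c"]) (auto simp: exec_def S_def permutes_id[unfolded id_def])
next
  case (snoc p ps)
  have fS: "finite S" by (simp add: S_def)
  have p: "p \<in> S" using snoc.prems by simp
  define L h where "L = fst (exec k init ps)" and "h = snd (exec k init ps)"
  have ex: "fst (exec k init (ps @ [p])) = L(p := h)" "snd (exec k init (ps @ [p])) = L p"
    by (simp_all add: exec_def L_def h_def pns_def)
  define q where "q = last (p0 # ps)"
  have len: "path_len (p0 # ps @ [p]) = path_len (p0 # ps) + cdist q p"
    using path_len_snoc[of "p0 # ps" p] by (simp add: q_def)
  have last: "last (p0 # ps @ [p]) = p" by simp
  have rem: "(\<Sum>c\<in>S. g c) = g b + (\<Sum>c\<in>S - {b}. g c)" if "b \<in> S" for b and g :: "cell \<Rightarrow> real"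
    using sum.remove[OF fS that] .
  consider (empty) \<tau> where "h = None" "\<tau> permutes S" "\<forall>c\<in>S. L (\<tau> c) = Some (init c)"
      "(\<Sum>c\<in>S. cdist c (\<tau> c)) \<le> path_len (p0 # ps)"
    | (held) \<tau> b where "\<tau> permutes S" "b \<in> S" "h = Some (init b)" "L (\<tau> b) = None"
       "\<forall>c\<in>S - {b}. L (\<tau> c) = Some (init c)"
       "(\<Sum>c\<in>S - {b}. cdist c (\<tau> c)) + cdist b q \<le> path_len (p0 # ps)"
    using snoc unfolding L_def h_def q_def by auto
  then show ?case
  proof cases
    case empty
    \<comment> \<open>The original cell of the item that currently lies at \<open>p\<close>.\<close>
    define b where "b = inv \<tau> p"
    have tb: "\<tau> b = p" using permutes_inverses[OF empty(2)] by (simp add: b_def)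
    have b: "b \<in> S" using permutes_in_image[OF empty(2), of b] tb p by simp
    have inj: "\<tau> c \<noteq> p" if "c \<noteq> b" for c
      using that tb permutes_inj[OF empty(2)] by (metis injD)
    have "(\<Sum>c\<in>S - {b}. cdist c (\<tau> c)) + cdist b p \<le> path_len (p0 # ps) + cdist q p"
      using empty(4) rem[OF b, of "\<lambda>c. cdist c (\<tau> c)"] cdist_nonneg[of q p] unfolding tb by linarith
    then show ?thesis
      unfolding ex len last
      using empty b tb inj by (intro disjI2 exI[of _ \<tau>] exI[of _ b]) (simp, metis)
  next
    case held
    show ?thesis
    proof (cases "p = \<tau> b")
      case True
      have inj: "\<tau> c \<noteq> p" if "c \<noteq> b" for c
        using that True permutes_inj[OF held(1)] by (metis injD)
      have "(\<Sum>c\<in>S. cdist c (\<tau> c)) \<le> path_len (p0 # ps) + cdist q p"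
        using held(6) rem[OF held(2), of "\<lambda>c. cdist c (\<tau> c)"] cdist_triangle[of b p q] True by simp
      moreover have "\<forall>c\<in>S. (L(p := h)) (\<tau> c) = Some (init c)"
        using held inj True by (metis DiffI fun_upd_apply singletonD)
      ultimately show ?thesis
        unfolding ex len last using held(1,4) True by (intro disjI1 conjI exI[of _ \<tau>]) simp_all
    next
      case False
      define d where "d = inv \<tau> p"
      have td: "\<tau> d = p" using permutes_inverses[OF held(1)] by (simp add: d_def)
      have d: "d \<in> S" using permutes_in_image[OF held(1), of d] td p by simp
      have db: "d \<noteq> b" using td False by auto
      \<comment> \<open>The held item of \<open>b\<close> is put down at \<open>p\<close>, and the
        item of \<open>d\<close> found there becomes the held one; the empty cell is handed over to
        \<open>d\<close> as its formal position.\<close>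
      define \<tau>' where "\<tau>' = \<tau>(b := \<tau> d, d := \<tau> b)"
      have per: "\<tau>' permutes S" unfolding \<tau>'_def using held(1,2) d by (rule goal_swap_permutes)
      have inj: "\<tau> c \<noteq> p" if "c \<noteq> d" for c
        using that td permutes_inj[OF held(1)] by (metis injD)
      have v: "\<tau>' d = \<tau> b" "\<tau>' b = p" "\<And>c. c \<noteq> b \<Longrightarrow> c \<noteq> d \<Longrightarrow> \<tau>' c = \<tau> c"
        using db td by (simp_all add: \<tau>'_def)
      have "\<forall>c\<in>S - {d}. (L(p := h)) (\<tau>' c) = Some (init c)"
      proof
        fix c assume c: "c \<in> S - {d}"
        show "(L(p := h)) (\<tau>' c) = Some (init c)"
        proof (cases "c = b")
          case True then show ?thesis using v held by simp
        next
          case False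
          then show ?thesis using v(3)[of c] c inj[of c] held(5) by simp
        qed
      qed
      moreover have "L p = Some (init d)" using held(5) d db td by auto
      moreover have "(L(p := h)) (\<tau>' d) = None" using v False held(4) by simp
      moreover have "(\<Sum>c\<in>S - {d}. cdist c (\<tau>' c)) + cdist d p \<le> path_len (p0 # ps) + cdist q p"
      proof -
        have "(\<Sum>c\<in>S - {d}. cdist c (\<tau>' c)) = cdist b p + (\<Sum>c\<in>S - {d} - {b}. cdist c (\<tau>' c))"
          using sum.remove[of "S - {d}" b "\<lambda>c. cdist c (\<tau>' c)"] fS held(2) db unfolding v(2) by blast
        also have "(\<Sum>c\<in>S - {d} - {b}. cdist c (\<tau>' c)) = (\<Sum>c\<in>S - {d} - {b}. cdist c (\<tau> c))"
          by (intro sum.cong refl) (simp add: v(3))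
        also have "S - {d} - {b} = S - {b} - {d}" by blast
        also have "(\<Sum>c\<in>S - {b} - {d}. cdist c (\<tau> c)) = (\<Sum>c\<in>S - {b}. cdist c (\<tau> c)) - cdist d p"
          using sum.remove[of "S - {b}" d "\<lambda>c. cdist c (\<tau> c)"] fS d db unfolding td by force
        finally show ?thesis using held(6) cdist_triangle[of b p q] by simp
      qed
      ultimately show ?thesis
        unfolding ex len last using per d by blast
    qed
  qed
qed

lemma travel_lower_bound:
  assumes \<sigma>: "phase1 k init goal \<sigma>" and vp: "valid_plan k init goal ps"
  shows "(\<Sum>c\<in>misplaced k init goal. cdist c (\<sigma> c)) \<le> travel ps"
proof -
  have "set ps \<subseteq> lattice k" "snd (exec k init ps) = None"
    and fin: "\<forall>c\<in>lattice k. fst (exec k init ps) c = Some (goal c)"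
    using vp by (auto simp: valid_plan_def)
  then obtain \<tau> where \<tau>: "\<tau> permutes lattice k" "\<forall>c\<in>lattice k. fst (exec k init ps) (\<tau> c) = Some (init c)"
      "(\<Sum>c\<in>lattice k. cdist c (\<tau> c)) \<le> path_len (p0 # ps)"
    using travel_displacement_invariant[of ps k init] by auto
  have "\<forall>c\<in>lattice k. goal (\<tau> c) = init c"
    using \<tau>(1,2) fin permutes_in_image[OF \<tau>(1)] by (metis option.inject)
  then have "(\<Sum>c\<in>misplaced k init goal. cdist c (\<sigma> c)) \<le> (\<Sum>c\<in>lattice k. cdist c (\<tau> c))"
    by (rule phase1_optimal_lattice[OF \<sigma> refl \<tau>(1)])
  also have "\<dots> \<le> travel ps"
    unfolding travel_def using \<tau>(3) path_len_snoc[of "p0 # ps" p0] cdist_nonneg[of "last (p0 # ps)" p0]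
    by (simp del: cdist_nonneg)
  finally show ?thesis .
qed

lemma finite_optimal_travels: "finite {travel ps | ps. valid_plan k init goal ps \<and> length ps = min_pns k init goal}"
proof -
  have "finite {ps. set ps \<subseteq> lattice k \<and> length ps = min_pns k init goal}"
    by (rule finite_lists_length_eq) simp
  then have "finite (travel ` {ps. set ps \<subseteq> lattice k \<and> length ps = min_pns k init goal})" by (rule finite_imageI)
  then show ?thesis by (rule rev_finite_subset) (auto simp: valid_plan_def)
qed

lemma opt_travel_le:
  "valid_plan k init goal ps \<Longrightarrow> length ps = min_pns k init goal \<Longrightarrow> opt_travel k init goal \<le> travel ps"
  unfolding opt_travel_def by (rule Min_le[OF finite_optimal_travels]) blast

lemma opt_travel_ge:
  assumes "phase1 k init goal \<sigma>" "valid_plan k init goal ps" "length ps = min_pns k init goal"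
  shows "(\<Sum>c\<in>misplaced k init goal. cdist c (\<sigma> c)) \<le> opt_travel k init goal"
proof -
  let ?T = "{travel ps | ps. valid_plan k init goal ps \<and> length ps = min_pns k init goal}"
  have "?T \<noteq> {}" using assms by blast
  then have "Min ?T \<in> ?T" by (rule Min_in[OF finite_optimal_travels])
  then show ?thesis using travel_lower_bound[OF assms(1)] unfolding opt_travel_def by force
qed

context type_cycles
begin

text \<open>A lap around a cycle has the length of its assigned moves and ends at its entry cell.
  What remains are hops between consecutive entry cells, including the first hop from and the last
  one to \<open>p0\<close>; each is at most 2k, whatever the traversal order.\<close>

lemma phase3_travel:
  assumes "phase3 D s ps" "k \<ge> 1"
  shows "travel ps \<le> (\<Sum>c\<in>D. cdist c (s c)) + 2 * real k * (real (card N) + 1)"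
proof -
  obtain ent L where L: "distinct L" "set L = N" "\<And>x. x \<in> N \<Longrightarrow> ent x \<in> x"
    and ps: "ps = concat (map (\<lambda>x. follow s x (ent x)) L)"
    using phase3E[OF assms(1)] by blast
  have ent: "x = orbit s (ent x) \<and> ent x \<in> lattice k" if "x \<in> N" for x
    using mem_N[OF that L(3)[OF that]] by (simp add: D_def misplaced_def)
  have root: "p0 \<in> lattice k" using assms(2) by (simp add: p0_def lattice_def)
  have "path_len (q # concat (map (\<lambda>x. follow s x (ent x)) L) @ [p0]) \<le>
      (\<Sum>x\<leftarrow>L. \<Sum>c\<in>x. cdist c (s c)) + 2 * real k * (real (length L) + 1)"
    if "q \<in> lattice k" "set L \<subseteq> N" for q L
    using that
  proof (induction L arbitrary: q)
    case Nil
    then show ?case using cdist_lattice[of q k p0] root by simp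
  next
    case (Cons x L)
    let ?rest = "concat (map (\<lambda>x. follow s x (ent x)) L) @ [p0]"
    have e: "x = orbit s (ent x)" "ent x \<in> lattice k" using ent Cons.prems by auto
    obtain zs where zs: "follow s x (ent x) = ent x # zs" using follow_Cons[OF s_D finite_D, of "ent x", folded e(1)] by blast
    obtain ys where ys: "follow s x (ent x) = ys @ [ent x]" by (simp add: follow_def)
    have "path_len (q # follow s x (ent x) @ ?rest) = cdist q (ent x) + path_len (ys @ ent x # ?rest)"
    proof -
      have "ys @ ent x # ?rest = (ys @ [ent x]) @ ?rest" by simp
      also have "\<dots> = ent x # zs @ ?rest" unfolding ys[symmetric] zs by simp
      finally have "ys @ ent x # ?rest = ent x # zs @ ?rest" .
      then show ?thesis unfolding zs append_Cons path_len_simps by (simp only:)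
    qed
    also have "\<dots> = cdist q (ent x) + path_len (follow s x (ent x)) + path_len (ent x # ?rest)"
      using path_len_append[of ys "ent x" ?rest] ys by simp
    also have "path_len (follow s x (ent x)) = (\<Sum>c\<in>x. cdist c (s c))"
      by (rule path_len_follow[OF s_D finite_D, of "ent x", folded e(1)])
    also have "cdist q (ent x) \<le> 2 * real k" using cdist_lattice Cons.prems e by blast
    also have "path_len (ent x # ?rest) \<le> (\<Sum>x\<leftarrow>L. \<Sum>c\<in>x. cdist c (s c)) + 2 * real k * (real (length L) + 1)"
      using Cons.IH[OF e(2)] Cons.prems(2) by simp
    finally show ?case by (simp add: algebra_simps)
  qed
  from this[OF root, of L] have "travel ps \<le> (\<Sum>x\<leftarrow>L. \<Sum>c\<in>x. cdist c (s c)) + 2 * real k * (real (length L) + 1)"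
    using L by (simp add: travel_def ps)
  moreover have "length L = card N" using L distinct_card by metis
  moreover have "(\<Sum>x\<leftarrow>L. \<Sum>c\<in>x. cdist c (s c)) = (\<Sum>c\<in>D. cdist c (s c))"
    using L sum_cycles[of "\<lambda>c. cdist c (s c)"] by (simp add: sum_list_distinct_conv_sum_set)
  ultimately show ?thesis by simp
qed

end

section \<open>Matching into a column\<close>

text \<open>For Z = Y^2/(3K) the bound on Y gives Z \<le> K/3, hence 2XZ + Z^2 \<le> (2 + 1/3) K Z
  \<le> Y^2. The factor 3 instead of 2 makes room for Z^2. This is the quadratic price of a row
  displacement.\<close>

lemma sqrt_sum_squares_ge:
  fixes X Y K :: real
  assumes "0 \<le> X" "X \<le> K" "\<bar>Y\<bar> \<le> K" "0 < K"
  shows "X + Y\<^sup>2 / (3 * K) \<le> sqrt (X\<^sup>2 + Y\<^sup>2)"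
proof (rule real_le_rsqrt)
  define Z where "Z = Y\<^sup>2 / (3 * K)"
  have "Y\<^sup>2 \<le> K\<^sup>2" using assms(3,4) by (intro abs_le_square_iff[THEN iffD1]) simp
  then have Z: "0 \<le> Z" "Z \<le> K / 3" "3 * (K * Z) = Y\<^sup>2"
    using assms(4) by (auto simp: Z_def power2_eq_square field_simps)
  have "X * Z \<le> K * Z" using assms(2) Z(1) by (rule mult_right_mono)
  moreover have "Z * Z \<le> K / 3 * Z" using Z by (intro mult_right_mono) auto
  ultimately have "(X + Z)\<^sup>2 \<le> X\<^sup>2 + (2 * (K * Z) + K / 3 * Z)"
    by (simp add: power2_eq_square algebra_simps)
  also have "\<dots> \<le> X\<^sup>2 + Y\<^sup>2" using Z(3) mult_nonneg_nonneg[of K Z] assms(4) Z(1) by linarith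
  finally show "(X + Y\<^sup>2 / (3 * K))\<^sup>2 \<le> X\<^sup>2 + Y\<^sup>2" by (simp add: Z_def)
qed

text \<open>A unit shift raises the squared length by at most 2|Y| + 1. Since the length is at least
  \<open>th\<close>, lengthening it by e raises its square by at least 2 * th * e, and e is chosen
  to make the two equal.\<close>

lemma sqrt_sum_squares_shift:
  fixes X Y d th :: real
  assumes "0 < th" "th \<le> X" "\<bar>d\<bar> \<le> 1"
  shows "sqrt (X\<^sup>2 + (Y + d)\<^sup>2) \<le> sqrt (X\<^sup>2 + Y\<^sup>2) + (2 * \<bar>Y\<bar> + 1) / (2 * th)"
proof (rule real_le_lsqrt)
  define A where "A = sqrt (X\<^sup>2 + Y\<^sup>2)"
  define e where "e = (2 * \<bar>Y\<bar> + 1) / (2 * th)"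
  have e: "0 \<le> e" "2 * th * e = 2 * \<bar>Y\<bar> + 1" using assms(1) by (auto simp: e_def)
  have "th \<le> A" unfolding A_def using assms by (intro order_trans[OF assms(2)] real_le_rsqrt) simp
  then have "2 * th * e \<le> 2 * A * e" using e(1) by (intro mult_right_mono) auto
  moreover have "(Y + d)\<^sup>2 \<le> Y\<^sup>2 + 2 * \<bar>Y\<bar> + 1"
  proof -
    have "Y * d \<le> \<bar>Y\<bar> * \<bar>d\<bar>" by (metis abs_ge_self abs_mult)
    also have "\<dots> \<le> \<bar>Y\<bar> * 1" using assms(3) by (intro mult_left_mono) auto
    finally have "Y * d \<le> \<bar>Y\<bar>" by simp
    moreover have "d\<^sup>2 \<le> 1" using assms(3) by (simp add: abs_square_le_1)
    ultimately show ?thesis by (simp add: power2_sum)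
  qed
  moreover have "A\<^sup>2 = X\<^sup>2 + Y\<^sup>2" by (simp add: A_def)
  moreover have "(A + e)\<^sup>2 = A\<^sup>2 + 2 * A * e + e\<^sup>2" by (simp add: power2_sum)
  ultimately have "X\<^sup>2 + (Y + d)\<^sup>2 \<le> (A + e)\<^sup>2" using e zero_le_power2[of e] by linarith
  then show "X\<^sup>2 + (Y + d)\<^sup>2 \<le> (sqrt (X\<^sup>2 + Y\<^sup>2) + (2 * \<bar>Y\<bar> + 1) / (2 * th))\<^sup>2"
    by (simp add: A_def e_def)
qed (use assms in \<open>auto intro!: add_nonneg_nonneg\<close>)

text \<open>A cyclic shift of the interval between \<open>r\<close> and \<rho>: one entry jumps
  across the interval, the others move by one.\<close>

lemma rotation_exists:
  fixes r \<rho> k :: nat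
  assumes "r < k" "\<rho> < k"
  shows "\<exists>\<pi>. \<pi> \<rho> = r \<and> inj_on \<pi> {0..<k} \<and> \<pi> ` {0..<k} \<subseteq> {0..<k} \<and>
    (\<forall>y<k. y \<noteq> \<rho> \<longrightarrow> \<bar>real (\<pi> y) - real y\<bar> \<le> 1)"
proof (cases "r \<le> \<rho>")
  case True
  let ?p = "\<lambda>y. if y = \<rho> then r else if r \<le> y \<and> y < \<rho> then y + 1 else y"
  show ?thesis
    by (rule exI[of _ ?p]) (use assms True in \<open>auto simp: inj_on_def\<close>)
next
  case False
  let ?p = "\<lambda>y. if y = \<rho> then r else if \<rho> < y \<and> y \<le> r then y - 1 else y"
  show ?thesis
    by (rule exI[of _ ?p]) (use assms False in \<open>auto simp: inj_on_def\<close>)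
qed

section \<open>Row-major ranks within a type\<close>

definition lex_less :: "cell \<Rightarrow> cell \<Rightarrow> bool" where
  "lex_less p q \<longleftrightarrow> fst p < fst q \<or> fst p = fst q \<and> snd p < snd q"

lemma lex_less_trans: "lex_less p q \<Longrightarrow> lex_less q r \<Longrightarrow> lex_less p r"
  by (auto simp: lex_less_def)

lemma lex_less_irrefl [simp]: "\<not> lex_less p p"
  by (simp add: lex_less_def)

lemma lex_less_total: "p \<noteq> q \<Longrightarrow> lex_less p q \<or> lex_less q p"
  by (auto simp: lex_less_def prod_eq_iff)

definition of_type :: "nat \<Rightarrow> (cell \<Rightarrow> nat) \<Rightarrow> nat \<Rightarrow> cell set" where
  "of_type k init t = {c \<in> lattice k. init c = t}"

lemma finite_of_type [simp]: "finite (of_type k init t)"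
  by (simp add: of_type_def)

lemma sum_of_types:
  fixes h :: "cell \<Rightarrow> real"
  assumes "init \<in> configs k"
  shows "(\<Sum>c\<in>lattice k. h c) = (\<Sum>t\<in>{1..k}. \<Sum>c\<in>of_type k init t. h c)"
  unfolding of_type_def using assms
  by (intro sum.group[symmetric]) (auto simp: configs_def)

text \<open>Position of a cell in row-major order among the cells of its type; the column index
  breaks ties within a row. Sending each item to the row given by its rank is the reference matching
  for columns.\<close>

definition rank :: "nat \<Rightarrow> (cell \<Rightarrow> nat) \<Rightarrow> cell \<Rightarrow> nat" where
  "rank k init c = card {d \<in> of_type k init (init c). lex_less d c}"

lemma rank_less:
  assumes "lex_less c d" "c \<in> of_type k init t" "d \<in> of_type k init t"
  shows "rank k init c < rank k init d"
proof -
  have t: "init c = t" "init d = t" using assms by (auto simp: of_type_def)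
  have "{e \<in> of_type k init t. lex_less e c} \<subset> {e \<in> of_type k init t. lex_less e d}"
    using assms lex_less_trans[OF _ assms(1)] lex_less_irrefl[of c] by blast
  then show ?thesis unfolding rank_def t by (intro psubset_card_mono) auto
qed

lemma rank_inj: "inj_on (rank k init) (of_type k init t)"
  by (rule inj_onI) (metis rank_less lex_less_total less_irrefl)

lemma card_of_type: "init \<in> configs k \<Longrightarrow> t \<in> {1..k} \<Longrightarrow> card (of_type k init t) = k"
  by (simp add: configs_def of_type_def)

lemma rank_bij:
  assumes "init \<in> configs k" "t \<in> {1..k}"
  shows "rank k init ` of_type k init t = {0..<k}"
proof -
  have "rank k init c < k" if "c \<in> of_type k init t" for c
  proof -
    have t: "init c = t" using that by (simp add: of_type_def)
    have "{d \<in> of_type k init t. lex_less d c} \<subset> of_type k init t"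
      using that lex_less_irrefl[of c] by blast
    then show ?thesis
      unfolding rank_def t using psubset_card_mono[OF finite_of_type] card_of_type[OF assms] by metis
  qed
  then have "rank k init ` of_type k init t \<subseteq> {0..<k}" by auto
  moreover have "card (rank k init ` of_type k init t) = k"
    using card_image[OF rank_inj] card_of_type[OF assms] by metis
  ultimately show ?thesis by (intro card_subset_eq) auto
qed

text \<open>Total row displacement of the reference matching. It is one of the two random quantities
  in the column estimate.\<close>

definition rank_deviation :: "nat \<Rightarrow> (cell \<Rightarrow> nat) \<Rightarrow> real" where
  "rank_deviation k init = (\<Sum>c\<in>lattice k. \<bar>real (fst c) - real (rank k init c)\<bar>)"

definition prefix_count :: "nat \<Rightarrow> (cell \<Rightarrow> nat) \<Rightarrow> nat \<Rightarrow> nat \<Rightarrow> nat" where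
  "prefix_count k init t j = card {c \<in> of_type k init t. fst c < j}"

lemma abs_diff_threshold_count:
  fixes r i k :: nat
  assumes "r < k" "i < k"
  shows "\<bar>real r - real i\<bar> = (\<Sum>j\<in>{1..k}. if (r < j) \<noteq> (i < j) then 1 else 0)"
proof -
  have "(\<Sum>j\<in>{1..k}. if (r < j) \<noteq> (i < j) then 1 else 0) = real (card {j \<in> {1..k}. (r < j) \<noteq> (i < j)})"
    by (simp add: sum.If_cases Int_def)
  also have "{j \<in> {1..k}. (r < j) \<noteq> (i < j)} = {min r i<..max r i}"
    using assms by (auto simp: min_def max_def)
  finally show ?thesis by (auto simp: min_def max_def)
qed

text \<open>The difference between row and rank counts the thresholds \<open>j\<close> that separate
  them. For fixed \<open>t\<close> and \<open>j\<close> the cells with row below \<open>j\<close>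
  and those with rank below \<open>j\<close> are both initial segments of the row-major order, hence
  nested; so the number of separated cells is the difference of the two sizes, and the second size
  is \<open>j\<close>.\<close>

lemma rank_deviation_eq:
  assumes "init \<in> configs k"
  shows "rank_deviation k init = (\<Sum>t\<in>{1..k}. \<Sum>j\<in>{1..k}. \<bar>real (prefix_count k init t j) - real j\<bar>)"
proof -
  have "(\<Sum>c\<in>of_type k init t. \<bar>real (fst c) - real (rank k init c)\<bar>) =
      (\<Sum>j\<in>{1..k}. \<bar>real (prefix_count k init t j) - real j\<bar>)" if t: "t \<in> {1..k}" for t
  proof -
    let ?S = "of_type k init t"
    have "(\<Sum>c\<in>?S. \<bar>real (fst c) - real (rank k init c)\<bar>) =
        (\<Sum>c\<in>?S. \<Sum>j\<in>{1..k}. if (fst c < j) \<noteq> (rank k init c < j) then 1 else 0)"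
    proof (rule sum.cong[OF refl])
      fix c assume c: "c \<in> ?S"
      then have "rank k init c < k" using rank_bij[OF assms t] by (metis atLeastLessThan_iff imageI)
      moreover have "fst c < k" using c by (auto simp: of_type_def lattice_def)
      ultimately show "\<bar>real (fst c) - real (rank k init c)\<bar> =
          (\<Sum>j\<in>{1..k}. if (fst c < j) \<noteq> (rank k init c < j) then 1 else 0)"
        by (intro abs_diff_threshold_count)
    qed
    also have "\<dots> = (\<Sum>j\<in>{1..k}. \<Sum>c\<in>?S. if (fst c < j) \<noteq> (rank k init c < j) then 1 else 0)"
      by (rule sum.swap)
    also have "\<dots> = (\<Sum>j\<in>{1..k}. \<bar>real (prefix_count k init t j) - real j\<bar>)"
    proof (rule sum.cong[OF refl])
      fix j assume j: "j \<in> {1..k}"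
      define A where "A = {c \<in> ?S. fst c < j}"
      define B where "B = {c \<in> ?S. rank k init c < j}"
      have fin: "finite A" "finite B" by (simp_all add: A_def B_def)
      have "rank k init ` B = {0..<j}"
      proof
        show "{0..<j} \<subseteq> rank k init ` B"
        proof
          fix x assume x: "x \<in> {0..<j}"
          then have "x \<in> rank k init ` ?S" unfolding rank_bij[OF assms t] using j by simp
          then obtain c where "c \<in> ?S" "x = rank k init c" by blast
          then show "x \<in> rank k init ` B" using x by (auto simp: B_def)
        qed
      qed (auto simp: B_def)
      moreover have "inj_on (rank k init) B" using rank_inj by (rule inj_on_subset) (auto simp: B_def)
      ultimately have cB: "card B = j" using card_image by fastforce
      have nested: "A \<subseteq> B \<or> B \<subseteq> A"
      proof (rule ccontr)
        assume "\<not> (A \<subseteq> B \<or> B \<subseteq> A)"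
        then obtain p q where pq: "p \<in> A" "p \<notin> B" "q \<in> B" "q \<notin> A" by blast
        then have "lex_less p q" by (auto simp: A_def B_def lex_less_def)
        then have "rank k init p < rank k init q" using pq by (intro rank_less) (auto simp: A_def B_def)
        then show False using pq by (auto simp: A_def B_def)
      qed
      have "(\<Sum>c\<in>?S. if (fst c < j) \<noteq> (rank k init c < j) then 1 else 0) =
          real (card {c \<in> ?S. (fst c < j) \<noteq> (rank k init c < j)})"
        by (simp add: sum.If_cases Int_def)
      also have "{c \<in> ?S. (fst c < j) \<noteq> (rank k init c < j)} = (A - B) \<union> (B - A)"
        by (auto simp: A_def B_def)
      also have "real (card \<dots>) = \<bar>real (card A) - real (card B)\<bar>"
        using nested
      proof
        assume "A \<subseteq> B"
        then have "(A - B) \<union> (B - A) = B - A" by blast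
        then show ?thesis
          using card_Diff_subset[OF fin(1) \<open>A \<subseteq> B\<close>] card_mono[OF fin(2) \<open>A \<subseteq> B\<close>]
          by simp
      next
        assume "B \<subseteq> A"
        then have "(A - B) \<union> (B - A) = A - B" by blast
        then show ?thesis
          using card_Diff_subset[OF fin(2) \<open>B \<subseteq> A\<close>] card_mono[OF fin(1) \<open>B \<subseteq> A\<close>]
          by simp
      qed
      finally show "(\<Sum>c\<in>?S. if (fst c < j) \<noteq> (rank k init c < j) then 1 else 0) =
          \<bar>real (prefix_count k init t j) - real j\<bar>"
        unfolding prefix_count_def A_def[symmetric] cB .
    qed
    finally show ?thesis .
  qed
  then show ?thesis unfolding rank_deviation_def sum_of_types[OF assms] by simp
qed

section \<open>The phase 1 matching for column goals\<close>

locale column_goal =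
  fixes k :: nat and init goal :: "cell \<Rightarrow> nat" and \<kappa> :: "nat \<Rightarrow> nat" and \<sigma> :: "cell \<Rightarrow> cell"
  assumes k: "k \<ge> 1" and config: "init \<in> configs k"
    and goal_iff: "\<And>p t. p \<in> lattice k \<Longrightarrow> t \<in> {1..k} \<Longrightarrow> goal p = t \<longleftrightarrow> snd p = \<kappa> t"
    and \<kappa>: "\<And>t. t \<in> {1..k} \<Longrightarrow> \<kappa> t < k"
    and matching: "phase1 k init goal \<sigma>"
begin

text \<open>The horizontal distance to the goal column does not depend on the matching, so it
  cancels whenever two type-preserving matchings are compared.\<close>

definition hor :: "cell \<Rightarrow> real" where
  "hor c = \<bar>real (snd c) - real (\<kappa> (init c))\<bar>"

definition ver :: "cell \<Rightarrow> real" where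
  "ver c = \<bar>real (fst c) - real (fst (\<sigma> c))\<bar>"

lemma init_type: "c \<in> lattice k \<Longrightarrow> init c \<in> {1..k}"
  using config by (auto simp: configs_def)

lemma \<sigma>_permutes: "\<sigma> permutes lattice k"
  using phase1D(1)[OF matching] by (rule permutes_subset) (auto simp: misplaced_def)

lemma \<sigma>_lattice: "c \<in> lattice k \<Longrightarrow> \<sigma> c \<in> lattice k"
  using permutes_in_image[OF \<sigma>_permutes] by simp

lemma \<sigma>_fixes: "c \<notin> misplaced k init goal \<Longrightarrow> \<sigma> c = c"
  using permutes_not_in[OF phase1D(1)[OF matching]] .

lemma goal_\<sigma>: "c \<in> lattice k \<Longrightarrow> goal (\<sigma> c) = init c"
  using phase1D(2)[OF matching, rule_format, of c] \<sigma>_fixes[of c]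
  by (cases "c \<in> misplaced k init goal") (auto simp: misplaced_def)

lemma snd_\<sigma>: "c \<in> lattice k \<Longrightarrow> snd (\<sigma> c) = \<kappa> (init c)"
  using goal_iff[OF \<sigma>_lattice init_type] goal_\<sigma> by blast

lemma cdist_column:
  "snd p = \<kappa> (init c) \<Longrightarrow> cdist c p = sqrt ((hor c)\<^sup>2 + (real (fst c) - real (fst p))\<^sup>2)"
  by (simp add: cdist_def hor_def add.commute)

lemma hor_bounds: "c \<in> lattice k \<Longrightarrow> 0 \<le> hor c \<and> hor c \<le> real k"
  using \<kappa>[OF init_type, of c] by (auto simp: hor_def lattice_def)

lemma cdist_column_ge:
  assumes "c \<in> lattice k" "p \<in> lattice k" "snd p = \<kappa> (init c)"
  shows "hor c + (real (fst c) - real (fst p))\<^sup>2 / (3 * real k) \<le> cdist c p"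
  unfolding cdist_column[OF assms(3)] using hor_bounds[OF assms(1)] assms k
  by (intro sqrt_sum_squares_ge) (auto simp: lattice_def)

lemma cdist_column_le: "snd p = \<kappa> (init c) \<Longrightarrow> cdist c p \<le> hor c + \<bar>real (fst c) - real (fst p)\<bar>"
  using cdist_le_abs[of c p] by (simp add: hor_def)

lemma \<sigma>_optimal:
  assumes "\<tau> permutes lattice k" "\<forall>c\<in>lattice k. goal (\<tau> c) = init c"
  shows "(\<Sum>c\<in>lattice k. cdist c (\<sigma> c)) \<le> (\<Sum>c\<in>lattice k. cdist c (\<tau> c))"
proof -
  have "(\<Sum>c\<in>lattice k. cdist c (\<sigma> c)) = (\<Sum>c\<in>misplaced k init goal. cdist c (\<sigma> c))"
    by (rule sum.mono_neutral_right) (auto simp: \<sigma>_fixes misplaced_def)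
  then show ?thesis using phase1_optimal_lattice[OF matching refl assms] by simp
qed

text \<open>Both sides of the optimality inequality against the rank matching contain the same
  horizontal sum. After cancelling it, the quadratic price of the row displacements of \<sigma> is
  at most the linear displacement of the rank matching.\<close>

lemma sum_ver_squared: "(\<Sum>c\<in>lattice k. (ver c)\<^sup>2) \<le> 3 * real k * rank_deviation k init"
proof -
  define \<tau> where "\<tau> c = (if c \<in> lattice k then (rank k init c, \<kappa> (init c)) else c)" for c
  have rk: "rank k init c < k" if "c \<in> lattice k" for c
    using rank_bij[OF config init_type[OF that]] that by (auto simp: of_type_def)
  have \<tau>L: "\<tau> c \<in> lattice k" if "c \<in> lattice k" for c
    using rk[OF that] \<kappa>[OF init_type[OF that]] that by (simp add: \<tau>_def lattice_def)
  have goal\<tau>: "goal (\<tau> c) = init c" if "c \<in> lattice k" for c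
    using goal_iff[OF \<tau>L[OF that] init_type[OF that]] that by (simp add: \<tau>_def)
  have "inj_on \<tau> (lattice k)"
  proof (rule inj_onI)
    fix c d assume cd: "c \<in> lattice k" "d \<in> lattice k" "\<tau> c = \<tau> d"
    then have "init c = init d" using goal\<tau> by metis
    then show "c = d" using cd inj_onD[OF rank_inj[of k init "init c"], of c d] by (auto simp: \<tau>_def of_type_def)
  qed
  then have "bij_betw \<tau> (lattice k) (lattice k)"
    using \<tau>L by (intro bij_betw_imageI endo_inj_surj) auto
  then have "\<tau> permutes lattice k" by (rule bij_imp_permutes) (simp add: \<tau>_def)
  then have "(\<Sum>c\<in>lattice k. cdist c (\<sigma> c)) \<le> (\<Sum>c\<in>lattice k. cdist c (\<tau> c))"
    using goal\<tau> by (intro \<sigma>_optimal) auto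
  also have "\<dots> \<le> (\<Sum>c\<in>lattice k. hor c + \<bar>real (fst c) - real (rank k init c)\<bar>)"
  proof (rule sum_mono)
    fix c assume c: "c \<in> lattice k"
    show "cdist c (\<tau> c) \<le> hor c + \<bar>real (fst c) - real (rank k init c)\<bar>"
      using cdist_column_le[of "\<tau> c" c] c by (simp add: \<tau>_def)
  qed
  finally have up: "(\<Sum>c\<in>lattice k. cdist c (\<sigma> c)) \<le> (\<Sum>c\<in>lattice k. hor c) + rank_deviation k init"
    by (simp add: sum.distrib rank_deviation_def)
  have "(\<Sum>c\<in>lattice k. hor c + (ver c)\<^sup>2 / (3 * real k)) \<le> (\<Sum>c\<in>lattice k. cdist c (\<sigma> c))"
    by (rule sum_mono) (use cdist_column_ge \<sigma>_lattice snd_\<sigma> in \<open>simp add: ver_def\<close>)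
  then have "(\<Sum>c\<in>lattice k. (ver c)\<^sup>2 / (3 * real k)) \<le> rank_deviation k init"
    using up by (simp add: sum.distrib)
  then have "(\<Sum>c\<in>lattice k. (ver c)\<^sup>2) / (3 * real k) \<le> rank_deviation k init"
    by (simp add: sum_divide_distrib)
  then show ?thesis using k by (simp add: field_simps)
qed

text \<open>Bound for the extra cost of moving the goal of \<open>c\<close> by one row: 1 in
  general, and about \<open>ver c / th\<close> once \<open>c\<close> is at horizontal distance at
  least \<open>th\<close>.\<close>

definition slope :: "real \<Rightarrow> cell \<Rightarrow> real" where
  "slope th c = (if hor c < th then 1 else (2 * ver c + 1) / (2 * th))"

lemma slope_nonneg: "0 < th \<Longrightarrow> 0 \<le> slope th c"
  by (auto simp: slope_def ver_def)

lemma cdist_unit_shift: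
  assumes "0 < th" "c \<in> lattice k" "\<bar>real y - real (fst (\<sigma> c))\<bar> \<le> 1"
  shows "cdist c (y, \<kappa> (init c)) \<le> cdist c (\<sigma> c) + slope th c"
proof (cases "hor c < th")
  case True
  have "cdist (\<sigma> c) (y, \<kappa> (init c)) \<le> 1"
    using cdist_le_abs[of "\<sigma> c" "(y, \<kappa> (init c))"] assms(3) snd_\<sigma>[OF assms(2)] by simp
  then show ?thesis using True cdist_triangle[of c "(y, \<kappa> (init c))" "\<sigma> c"] by (simp add: slope_def)
next
  case False
  let ?Y = "real (fst c) - real (fst (\<sigma> c))" and ?d = "real (fst (\<sigma> c)) - real y"
  have "sqrt ((hor c)\<^sup>2 + (?Y + ?d)\<^sup>2) \<le> sqrt ((hor c)\<^sup>2 + ?Y\<^sup>2) + (2 * \<bar>?Y\<bar> + 1) / (2 * th)"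
    using False assms by (intro sqrt_sum_squares_shift) auto
  moreover have "?Y + ?d = real (fst c) - real y" by simp
  ultimately show ?thesis
    using False by (simp add: cdist_column[OF snd_\<sigma>[OF assms(2)]] cdist_column slope_def ver_def)
qed

text \<open>Optimality against rotating the column so that \<open>u\<close> gets its own row.\<close>

lemma ver_squared_le:
  assumes th: "0 < th" and u: "u \<in> lattice k"
  shows "(ver u)\<^sup>2 \<le> 3 * real k * (\<Sum>c\<in>of_type k init (init u). slope th c)"
proof -
  define t where "t = init u"
  have t: "t \<in> {1..k}" using init_type[OF u] by (simp add: t_def)
  have row: "fst c < k" if "c \<in> lattice k" for c using that by (auto simp: lattice_def)
  obtain \<pi> where \<pi>: "\<pi> (fst (\<sigma> u)) = fst u" "inj_on \<pi> {0..<k}" "\<pi> ` {0..<k} \<subseteq> {0..<k}"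
    "\<forall>y<k. y \<noteq> fst (\<sigma> u) \<longrightarrow> \<bar>real (\<pi> y) - real y\<bar> \<le> 1"
    using rotation_exists[OF row[OF u] row[OF \<sigma>_lattice[OF u]]] by blast
  \<comment> \<open>Acts on the goal cells, not on the items: composed with \<sigma> it changes the
    goals of type \<open>t\<close> only and stays type-preserving because it keeps columns.\<close>
  define \<psi> where "\<psi> p = (if p \<in> lattice k \<and> snd p = \<kappa> t then (\<pi> (fst p), snd p) else p)" for p
  have \<psi>L: "\<psi> p \<in> lattice k" if "p \<in> lattice k" for p
    using that \<pi>(3) by (auto simp: \<psi>_def lattice_def)
  have snd\<psi>: "snd (\<psi> p) = snd p" for p by (simp add: \<psi>_def)
  have "inj_on \<psi> (lattice k)"
  proof (rule inj_onI)
    fix p q assume pq: "p \<in> lattice k" "q \<in> lattice k" "\<psi> p = \<psi> q"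
    then have s: "snd p = snd q" using snd\<psi> by metis
    show "p = q"
    proof (cases "snd p = \<kappa> t")
      case True
      then have "\<pi> (fst p) = \<pi> (fst q)" using pq s by (simp add: \<psi>_def)
      then have "fst p = fst q" using row pq(1,2) inj_onD[OF \<pi>(2)] by simp
      then show ?thesis using s by (simp add: prod_eq_iff)
    next
      case False
      then show ?thesis using pq s by (simp add: \<psi>_def)
    qed
  qed
  then have "bij_betw \<psi> (lattice k) (lattice k)"
    using \<psi>L by (intro bij_betw_imageI endo_inj_surj) auto
  then have "\<psi> permutes lattice k" by (rule bij_imp_permutes) (simp add: \<psi>_def)
  then have per: "\<psi> \<circ> \<sigma> permutes lattice k" using \<sigma>_permutes by (simp add: permutes_compose)
  have g: "goal ((\<psi> \<circ> \<sigma>) c) = init c" if "c \<in> lattice k" for c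
    using goal_iff[OF \<psi>L[OF \<sigma>_lattice[OF that]] init_type[OF that]] snd\<psi> snd_\<sigma>[OF that] by simp
  have col: "snd (\<sigma> c) = \<kappa> t \<longleftrightarrow> init c = t" if "c \<in> lattice k" for c
    using goal_iff[OF \<sigma>_lattice[OF that] t] goal_\<sigma>[OF that] by simp
  let ?S = "of_type k init t"
  have uS: "u \<in> ?S" using u by (simp add: of_type_def t_def)
  have SL: "c \<in> lattice k \<and> init c = t" if "c \<in> ?S" for c using that by (simp add: of_type_def)
  have on_S: "(\<psi> \<circ> \<sigma>) c = (\<pi> (fst (\<sigma> c)), \<kappa> (init c))" if "c \<in> ?S" for c
    using SL[OF that] col[of c] \<sigma>_lattice[of c] by (simp add: \<psi>_def)
  have off_S: "(\<psi> \<circ> \<sigma>) c = \<sigma> c" if "c \<in> lattice k - ?S" for c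
    using that col[of c] by (simp add: \<psi>_def of_type_def)
  have split: "(\<Sum>c\<in>lattice k. h c) = (\<Sum>c\<in>lattice k - ?S. h c) + (h u + (\<Sum>c\<in>?S - {u}. h c))"
    for h :: "cell \<Rightarrow> real"
    using sum.subset_diff[of ?S "lattice k" h] sum.remove[OF finite_of_type uS, of h] by (auto simp: of_type_def)
  have "(\<Sum>c\<in>lattice k. cdist c (\<sigma> c)) \<le> (\<Sum>c\<in>lattice k. cdist c ((\<psi> \<circ> \<sigma>) c))"
    by (rule \<sigma>_optimal[OF per]) (use g in blast)
  moreover have "(\<Sum>c\<in>lattice k - ?S. cdist c ((\<psi> \<circ> \<sigma>) c)) = (\<Sum>c\<in>lattice k - ?S. cdist c (\<sigma> c))"
    using off_S by (intro sum.cong) auto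
  ultimately have "cdist u (\<sigma> u) + (\<Sum>c\<in>?S - {u}. cdist c (\<sigma> c)) \<le>
      cdist u ((\<psi> \<circ> \<sigma>) u) + (\<Sum>c\<in>?S - {u}. cdist c ((\<psi> \<circ> \<sigma>) c))"
    unfolding split[of "\<lambda>c. cdist c (\<sigma> c)"] split[of "\<lambda>c. cdist c ((\<psi> \<circ> \<sigma>) c)"] by linarith
  also have "cdist u ((\<psi> \<circ> \<sigma>) u) \<le> hor u"
    unfolding on_S[OF uS] \<pi>(1) using cdist_column_le[of "(fst u, \<kappa> (init u))" u] by simp
  also have "(\<Sum>c\<in>?S - {u}. cdist c ((\<psi> \<circ> \<sigma>) c)) \<le> (\<Sum>c\<in>?S - {u}. cdist c (\<sigma> c) + slope th c)"
  proof (rule sum_mono)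
    fix c assume c: "c \<in> ?S - {u}"
    have "\<sigma> c \<noteq> \<sigma> u" using c permutes_inj[OF \<sigma>_permutes] by (auto dest: injD)
    then have "fst (\<sigma> c) \<noteq> fst (\<sigma> u)"
      using c SL snd_\<sigma>[of c] snd_\<sigma>[OF u] by (auto simp: prod_eq_iff t_def)
    then have "\<bar>real (\<pi> (fst (\<sigma> c))) - real (fst (\<sigma> c))\<bar> \<le> 1"
      using \<pi>(4) row \<sigma>_lattice SL c by blast
    then show "cdist c ((\<psi> \<circ> \<sigma>) c) \<le> cdist c (\<sigma> c) + slope th c"
      using cdist_unit_shift[OF th, of c "\<pi> (fst (\<sigma> c))"] on_S SL c by auto
  qed
  also have "\<dots> = (\<Sum>c\<in>?S - {u}. cdist c (\<sigma> c)) + (\<Sum>c\<in>?S - {u}. slope th c)"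
    by (rule sum.distrib)
  finally have "cdist u (\<sigma> u) \<le> hor u + (\<Sum>c\<in>?S - {u}. slope th c)" by simp
  also have "(\<Sum>c\<in>?S - {u}. slope th c) \<le> (\<Sum>c\<in>?S. slope th c)"
    using slope_nonneg[OF th] by (intro sum_mono2) auto
  finally have "(ver u)\<^sup>2 / (3 * real k) \<le> (\<Sum>c\<in>?S. slope th c)"
    using cdist_column_ge[OF u \<sigma>_lattice[OF u] snd_\<sigma>[OF u]] by (simp add: ver_def)
  then show ?thesis using k by (simp add: field_simps t_def)
qed

end

section \<open>Cost of merging\<close>

text \<open>Turns a bound on squares into a bound on first powers; the optimal choice of
  \<open>x\<close> would recover Cauchy-Schwarz.\<close>

lemma le_add_square_div:
  fixes v x :: real
  assumes "0 < x"
  shows "v \<le> x + v\<^sup>2 / x"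
proof -
  have "0 \<le> (v - x)\<^sup>2 + v * v + x * x" by simp
  then have "v * x \<le> x * x + v\<^sup>2" by (simp add: power2_eq_square algebra_simps)
  then show ?thesis using assms by (simp add: field_simps)
qed

text \<open>A square root made linear by the inequality of arithmetic and geometric means: the
  product of the two summands is 3Ky. The free parameter \<open>e\<close> is chosen only at the very
  end.\<close>

lemma le_of_square_le:
  fixes a y K e :: real
  assumes "a\<^sup>2 \<le> 3 * K * y" "0 < K" "0 < e" "0 \<le> y"
  shows "a \<le> e * K + 3 * y / e"
proof (rule power2_le_imp_le)
  have "2 * ((e * K) * (3 * y / e)) \<le> (e * K + 3 * y / e)\<^sup>2"
    by (simp add: power2_sum)
  moreover have "(e * K) * (3 * y / e) = 3 * K * y" using assms(3) by simp
  moreover have "0 \<le> K * y" using assms by simp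
  ultimately show "a\<^sup>2 \<le> (e * K + 3 * y / e)\<^sup>2" using assms(1) by simp
qed (use assms in auto)

lemma sum_UNION_le:
  fixes w :: "'a \<Rightarrow> real"
  assumes "finite I" "\<And>i. i \<in> I \<Longrightarrow> finite (A i)" "\<And>i x. i \<in> I \<Longrightarrow> x \<in> A i \<Longrightarrow> 0 \<le> w x"
  shows "(\<Sum>x\<in>(\<Union>i\<in>I. A i). w x) \<le> (\<Sum>i\<in>I. \<Sum>x\<in>A i. w x)"
  using assms
proof (induction I rule: finite_induct)
  case (insert i I)
  have "(\<Sum>x\<in>A i \<union> (\<Union>i\<in>I. A i). w x) + (\<Sum>x\<in>A i \<inter> (\<Union>i\<in>I. A i). w x) =
      (\<Sum>x\<in>A i. w x) + (\<Sum>x\<in>(\<Union>i\<in>I. A i). w x)"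
    using insert by (intro sum.union_inter) auto
  moreover have "0 \<le> (\<Sum>x\<in>A i \<inter> (\<Union>i\<in>I. A i). w x)" using insert.prems by (intro sum_nonneg) auto
  moreover have "(\<Sum>x\<in>(\<Union>i\<in>I. A i). w x) \<le> (\<Sum>i\<in>I. \<Sum>x\<in>A i. w x)" using insert by auto
  ultimately show ?case using insert.hyps by simp
qed simp

lemma card_lattice [simp]: "card (lattice k) = k * k"
  by (simp add: lattice_def)

lemma merge_pairs_distinct: "(u, v) \<in> merge_pairs D init s \<Longrightarrow> u \<noteq> v"
  by (auto simp: merge_pairs_def)

text \<open>Bounding a swap by the positions of \<open>u\<close> and \<open>v\<close>, not by their current goals, keeps the
  bound valid when a cell takes part in several swaps.\<close>

lemma merge_goals_row_displacement:
  assumes "finite S" "\<And>u v. (u, v) \<in> set ts \<Longrightarrow> u \<in> S \<and> v \<in> S \<and> u \<noteq> v"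
  shows "(\<Sum>c\<in>S. \<bar>real (fst c) - real (fst (merge_goals \<sigma> ts c))\<bar>) \<le>
    (\<Sum>c\<in>S. \<bar>real (fst c) - real (fst (\<sigma> c))\<bar>) + 2 * (\<Sum>(u, v)\<leftarrow>ts. \<bar>real (fst u) - real (fst v)\<bar>)"
  using assms(2)
proof (induction ts rule: rev_induct)
  case (snoc a ts)
  obtain u v where a: "a = (u, v)" by (cases a)
  define s where "s = merge_goals \<sigma> ts"
  have uv: "u \<in> S" "v \<in> S" "u \<noteq> v" using snoc.prems[of u v] by (auto simp: a)
  have IH: "(\<Sum>c\<in>S. \<bar>real (fst c) - real (fst (s c))\<bar>) \<le>
    (\<Sum>c\<in>S. \<bar>real (fst c) - real (fst (\<sigma> c))\<bar>) + 2 * (\<Sum>(u, v)\<leftarrow>ts. \<bar>real (fst u) - real (fst v)\<bar>)"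
    unfolding s_def using snoc.prems by (intro snoc.IH) auto
  have "(\<Sum>c\<in>S. \<bar>real (fst c) - real (fst ((s(u := s v, v := s u)) c))\<bar>) \<le>
      (\<Sum>c\<in>S. \<bar>real (fst c) - real (fst (s c))\<bar>) + 2 * \<bar>real (fst u) - real (fst v)\<bar>"
  proof -
    define h where "h c p = \<bar>real (fst c) - real (fst p)\<bar>" for c p :: cell
    have tri: "h u p \<le> h u v + h v p" "h v p \<le> h u v + h u p" for p
      unfolding h_def by linarith+
    have "(\<Sum>c\<in>S. h c ((s(u := s v, v := s u)) c)) \<le> (\<Sum>c\<in>S. h c (s c)) + 2 * h u v"
      using sum_update2[OF assms(1) uv, of h s "s v" "s u"] tri(1)[of "s v"] tri(2)[of "s u"] by linarith
    then show ?thesis by (simp only: h_def)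
  qed
  then show ?case using IH unfolding a merge_goals_snoc s_def[symmetric] by simp
qed simp

section \<open>Weight of the minimum spanning forest and row gaps of the swaps\<close>

context column_goal
begin

abbreviation "mis \<equiv> misplaced k init goal"
abbreviation "edges \<equiv> merge_edges mis init \<sigma>"
abbreviation "weight \<equiv> edge_weight mis init \<sigma>"

lemma mis_lattice: "c \<in> mis \<Longrightarrow> c \<in> lattice k"
  by (simp add: misplaced_def)

lemma merge_pairsD:
  assumes "(u, v) \<in> merge_pairs mis init \<sigma>"
  shows "u \<in> lattice k" "v \<in> lattice k" "init u = init v" "u \<noteq> v"
  using assms merge_pairs_distinct[OF assms] by (auto simp: merge_pairs_def misplaced_def)

text \<open>One swap applied to \<sigma> yields another type-preserving permutation, and \<sigma> is
  optimal. Nonnegative weights are what permits passing from a connecting edge set to a forest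
  inside it.\<close>

lemma mcost_nonneg:
  assumes "(u, v) \<in> merge_pairs mis init \<sigma>"
  shows "0 \<le> mcost \<sigma> u v"
proof -
  note uv = merge_pairsD[OF assms]
  have "\<sigma>(u := \<sigma> v, v := \<sigma> u) permutes lattice k"
    by (rule goal_swap_permutes[OF \<sigma>_permutes uv(1,2)])
  moreover have "\<forall>c\<in>lattice k. goal ((\<sigma>(u := \<sigma> v, v := \<sigma> u)) c) = init c"
    using uv goal_\<sigma> by simp
  ultimately have "(\<Sum>c\<in>lattice k. cdist c (\<sigma> c)) \<le> (\<Sum>c\<in>lattice k. cdist c ((\<sigma>(u := \<sigma> v, v := \<sigma> u)) c))"
    by (rule \<sigma>_optimal)
  then show ?thesis
    unfolding mcost_def using sum_update2[OF finite_lattice uv(1,2,4), of cdist \<sigma> "\<sigma> v" "\<sigma> u"] by linarith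
qed

text \<open>After the swap either cell can be served through its old goal followed by a move along
  the common goal column.\<close>

lemma mcost_le:
  assumes "u \<in> lattice k" "v \<in> lattice k" "init u = init v"
  shows "mcost \<sigma> u v \<le> 2 * \<bar>real (fst (\<sigma> u)) - real (fst (\<sigma> v))\<bar>"
proof -
  have "cdist (\<sigma> u) (\<sigma> v) \<le> \<bar>real (fst (\<sigma> u)) - real (fst (\<sigma> v))\<bar>"
    using cdist_le_abs[of "\<sigma> u" "\<sigma> v"] snd_\<sigma> assms by simp
  moreover have "mcost \<sigma> u v \<le> 2 * cdist (\<sigma> u) (\<sigma> v)"
    using cdist_triangle[of u "\<sigma> v" "\<sigma> u"] cdist_triangle[of v "\<sigma> u" "\<sigma> v"] cdist_commute[of "\<sigma> u" "\<sigma> v"]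
    by (simp add: mcost_def)
  ultimately show ?thesis by simp
qed

lemma weight_nonneg:
  assumes "e \<in> edges"
  shows "0 \<le> weight e"
proof -
  obtain u v where "(u, v) \<in> merge_pairs mis init \<sigma>" "mcost \<sigma> u v = weight e"
    using edge_weight_attained[OF finite_misplaced assms] by blast
  then show ?thesis using mcost_nonneg by fastforce
qed

text \<open>Cells are added in order of increasing goal row, and each new one is linked to the cell
  \<open>y0\<close> with the largest goal row so far. The costs are at most twice the differences of
  consecutive goal rows and telescope, so the total is bounded by the last row.\<close>

lemma same_type_chain:
  assumes "finite Y" "Y \<subseteq> {c \<in> mis. init c = t}"
  shows "Y = {} \<or> (\<exists>y0\<in>Y. (\<forall>y\<in>Y. fst (\<sigma> y) \<le> fst (\<sigma> y0)) \<and>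
    (\<exists>E1\<subseteq>edges. (\<Sum>e\<in>E1. weight e) \<le> 2 * real (fst (\<sigma> y0)) \<and>
      (\<forall>y\<in>Y. conn E1 (orbit \<sigma> y0) (orbit \<sigma> y))))"
  using assms
proof (induction Y rule: finite_ranking_induct[where f = "\<lambda>y. fst (\<sigma> y)"])
  case (insert x Y)
  have x: "x \<in> mis" "init x = t" "x \<in> lattice k" using insert.prems mis_lattice[of x] by auto
  show ?case
  proof (cases "Y = {}")
    case True
    then show ?thesis by (intro disjI2 bexI[of _ x] conjI exI[of _ "{}"]) auto
  next
    case False
    then obtain y0 E1 where y0: "y0 \<in> Y" "\<forall>y\<in>Y. fst (\<sigma> y) \<le> fst (\<sigma> y0)"
      and E1: "E1 \<subseteq> edges" "(\<Sum>e\<in>E1. weight e) \<le> 2 * real (fst (\<sigma> y0))"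
        "\<forall>y\<in>Y. conn E1 (orbit \<sigma> y0) (orbit \<sigma> y)"
      using insert.IH insert.prems by auto
    have y0': "y0 \<in> mis" "init y0 = t" "y0 \<in> lattice k"
      using insert.prems y0(1) mis_lattice[of y0] by auto
    have le: "fst (\<sigma> y0) \<le> fst (\<sigma> x)" using insert.hyps y0(1) by blast
    have top: "\<forall>y\<in>insert x Y. fst (\<sigma> y) \<le> fst (\<sigma> x)" using insert.hyps by auto
    have "\<exists>E2\<subseteq>edges. (\<Sum>e\<in>E2. weight e) \<le> 2 * real (fst (\<sigma> x)) \<and>
        (\<forall>y\<in>insert x Y. conn E2 (orbit \<sigma> x) (orbit \<sigma> y))"
    proof (cases "orbit \<sigma> x = orbit \<sigma> y0")
      case True
      then have "\<forall>y\<in>insert x Y. conn E1 (orbit \<sigma> x) (orbit \<sigma> y)" using E1(3) by simp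
      then show ?thesis using E1(1,2) le by (intro exI[of _ E1]) auto
    next
      case False
      let ?e = "{orbit \<sigma> x, orbit \<sigma> y0}"
      have mp: "(x, y0) \<in> merge_pairs mis init \<sigma>" using False x y0' by (simp add: merge_pairs_def)
      then have "?e \<in> edges" unfolding merge_edges_def by blast
      have fin: "finite E1" using E1(1) finite_merge_edges[OF finite_misplaced] by (rule finite_subset)
      have "weight ?e \<le> 2 * (real (fst (\<sigma> x)) - real (fst (\<sigma> y0)))"
        using edge_weight_le[OF finite_misplaced mp] mcost_le[of x y0] x y0' le by simp
      then have "(\<Sum>e\<in>insert ?e E1. weight e) \<le> 2 * real (fst (\<sigma> x))"
        using E1(2) weight_nonneg[OF \<open>?e \<in> edges\<close>] fin by (cases "?e \<in> E1") (auto simp: insert_absorb)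
      moreover have "conn (insert ?e E1) (orbit \<sigma> x) (orbit \<sigma> y)" if "y \<in> insert x Y" for y
      proof (cases "y = x")
        case False
        then have "conn E1 (orbit \<sigma> y0) (orbit \<sigma> y)" using that E1(3) by simp
        then show ?thesis unfolding conn_insert by simp
      qed simp
      ultimately show ?thesis using E1(1) \<open>?e \<in> edges\<close> by (intro exI[of _ "insert ?e E1"]) blast
    qed
    then show ?thesis using top by blast
  qed
qed simp

lemma same_type_edges:
  "\<exists>E1\<subseteq>edges. (\<Sum>e\<in>E1. weight e) \<le> 2 * real k \<and>
    (\<forall>u v. u \<in> mis \<longrightarrow> v \<in> mis \<longrightarrow> init u = t \<longrightarrow> init v = t \<longrightarrow> conn E1 (orbit \<sigma> u) (orbit \<sigma> v))"
proof (cases "{c \<in> mis. init c = t} = {}")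
  case True
  then show ?thesis by (intro exI[of _ "{}"]) auto
next
  case False
  have "finite {c \<in> mis. init c = t}" by simp
  from same_type_chain[OF this order_refl] False
  obtain y0 E1 where y0: "y0 \<in> mis" "E1 \<subseteq> edges" "(\<Sum>e\<in>E1. weight e) \<le> 2 * real (fst (\<sigma> y0))"
    "\<And>y. y \<in> mis \<Longrightarrow> init y = t \<Longrightarrow> conn E1 (orbit \<sigma> y0) (orbit \<sigma> y)"
    by (elim disjE bexE exE conjE) auto
  have "fst (\<sigma> y0) < k" using \<sigma>_lattice[OF mis_lattice[OF y0(1)]] by (auto simp: lattice_def)
  then have "(\<Sum>e\<in>E1. weight e) \<le> 2 * real k" using y0(3) by simp
  moreover have "conn E1 (orbit \<sigma> u) (orbit \<sigma> v)" if "u \<in> mis" "v \<in> mis" "init u = t" "init v = t" for u v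
    using y0(4)[OF that(1,3)] y0(4)[OF that(2,4)] conn_sym conn_trans by metis
  ultimately show ?thesis using y0(2) by blast
qed

text \<open>The union of the chains of all \<open>k\<close> types, each of weight at most 2k,
  connects everything that merge edges connect; the minimum forest is no heavier than a forest
  inside this union.\<close>

lemma min_spanning_forest_weight:
  assumes "min_spanning_forest edges weight F"
  shows "(\<Sum>e\<in>F. weight e) \<le> 2 * (real k)\<^sup>2"
proof -
  obtain E1 where E1: "\<And>t. E1 t \<subseteq> edges" "\<And>t. (\<Sum>e\<in>E1 t. weight e) \<le> 2 * real k"
    "\<And>t u v. u \<in> mis \<Longrightarrow> v \<in> mis \<Longrightarrow> init u = t \<Longrightarrow> init v = t \<Longrightarrow> conn (E1 t) (orbit \<sigma> u) (orbit \<sigma> v)"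
    using same_type_edges by metis
  define E2 where "E2 = (\<Union>t\<in>{1..k}. E1 t)"
  have sub: "E2 \<subseteq> edges" using E1(1) by (auto simp: E2_def)
  have fin: "finite edges" by (rule finite_merge_edges[OF finite_misplaced])
  have edge: "conn E2 a b" if "{a, b} \<in> edges" for a b
  proof -
    obtain u v where uv: "(u, v) \<in> merge_pairs mis init \<sigma>" "{a, b} = {orbit \<sigma> u, orbit \<sigma> v}"
      using \<open>{a, b} \<in> edges\<close> unfolding merge_edges_def by blast
    then have m: "u \<in> mis" "v \<in> mis" "init v = init u" by (auto simp: merge_pairs_def)
    have "conn (E1 (init u)) (orbit \<sigma> u) (orbit \<sigma> v)" by (rule E1(3)[OF m(1,2) refl m(3)])
    moreover have "E1 (init u) \<subseteq> E2" using init_type[OF mis_lattice[OF m(1)]] by (auto simp: E2_def)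
    ultimately have "conn E2 (orbit \<sigma> u) (orbit \<sigma> v)" by (rule conn_mono[rotated])
    moreover have "a = orbit \<sigma> u \<and> b = orbit \<sigma> v \<or> a = orbit \<sigma> v \<and> b = orbit \<sigma> u"
      using uv(2) unfolding doubleton_eq_iff .
    ultimately show ?thesis using conn_sym[of E2 "orbit \<sigma> u" "orbit \<sigma> v"] by (elim disjE conjE) simp_all
  qed
  have "conn E2 = conn edges"
  proof (intro ext iffI)
    show "conn edges x y" if "conn E2 x y" for x y using conn_mono[OF sub that] .
    show "conn E2 x y" if "conn edges x y" for x y
      using conn_le[of edges "conn E2", OF edge conn_refl _ that] conn_trans by metis
  qed
  then obtain F' where F': "F' \<subseteq> E2" "spanning_forest edges F'"
    using spanning_forest_exists[OF fin sub] by blast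
  have "(\<Sum>e\<in>F. weight e) \<le> (\<Sum>e\<in>F'. weight e)" using assms F'(2) by (simp add: min_spanning_forest_def)
  also have "\<dots> \<le> (\<Sum>e\<in>E2. weight e)"
    using F'(1) sub fin weight_nonneg by (intro sum_mono2) (auto intro: finite_subset)
  also have "\<dots> \<le> (\<Sum>t\<in>{1..k}. \<Sum>e\<in>E1 t. weight e)"
    unfolding E2_def using E1(1) fin weight_nonneg
    by (intro sum_UNION_le) (auto intro: finite_subset)
  also have "\<dots> \<le> (\<Sum>t\<in>{1..k}. 2 * real k)" using E1(2) by (rule sum_mono)
  finally show ?thesis by (simp add: power2_eq_square)
qed

definition near :: "real \<Rightarrow> cell set" where
  "near th = {c \<in> lattice k. hor c < th}"

text \<open>Each of the k^2 cells pays \<open>z * real k\<close>; the remainder is quadratic and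
  covered by \<open>sum_ver_squared\<close>.\<close>

lemma sum_ver:
  assumes "0 < z"
  shows "(\<Sum>c\<in>lattice k. ver c) \<le> z * real k ^ 3 + 3 * rank_deviation k init / z"
proof -
  have "(\<Sum>c\<in>lattice k. ver c) \<le> (\<Sum>c\<in>lattice k. z * real k + (ver c)\<^sup>2 / (z * real k))"
    using assms k by (intro sum_mono le_add_square_div) auto
  also have "\<dots> = z * real k ^ 3 + (\<Sum>c\<in>lattice k. (ver c)\<^sup>2) / (z * real k)"
    by (simp add: sum.distrib sum_divide_distrib power3_eq_cube)
  also have "(\<Sum>c\<in>lattice k. (ver c)\<^sup>2) / (z * real k) \<le> (3 * real k * rank_deviation k init) / (z * real k)"
    using assms sum_ver_squared by (intro divide_right_mono) auto
  also have "\<dots> = 3 * rank_deviation k init / z" using k by simp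
  finally show ?thesis by simp
qed

lemma sum_slope:
  assumes "0 < th"
  shows "(\<Sum>c\<in>lattice k. slope th c) \<le>
    real (card (near th)) + (\<Sum>c\<in>lattice k. ver c) / th + (real k)\<^sup>2 / (2 * th)"
proof -
  have "(\<Sum>c\<in>lattice k. slope th c) \<le>
      (\<Sum>c\<in>lattice k. (if hor c < th then 1 else 0) + (ver c / th + 1 / (2 * th)))"
  proof (rule sum_mono)
    fix c
    have "0 \<le> ver c / th" "0 \<le> 1 / (2 * th)" using assms by (auto simp: ver_def)
    moreover have "(2 * ver c + 1) / (2 * th) = ver c / th + 1 / (2 * th)"
      using assms by (simp add: field_simps)
    ultimately show "slope th c \<le> (if hor c < th then 1 else 0) + (ver c / th + 1 / (2 * th))"
      by (simp add: slope_def)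
  qed
  also have "\<dots> = real (card (near th)) + ((\<Sum>c\<in>lattice k. ver c) / th + (real k)\<^sup>2 / (2 * th))"
    by (simp add: sum.distrib sum_divide_distrib near_def sum.If_cases Int_def power2_eq_square)
  finally show ?thesis by simp
qed

text \<open>After the swap \<open>u\<close> pays its horizontal distance plus R^2/(3k), where R is
  its row distance to the goal of \<open>v\<close>, and \<open>v\<close> pays at least its
  horizontal distance. Before the swap both pay at most horizontal distance plus \<open>A\<close>.
  Hence R^2 \<le> 3k (mcost + 2A): a cheap swap forces the rows to be close. The row displacement of
  \<open>v\<close> leads from its goal back to \<open>v\<close>.\<close>

lemma merge_pair_row_difference:
  assumes uv: "(u, v) \<in> merge_pairs mis init \<sigma>" and e: "0 < e"
    and A: "ver u \<le> A" "ver v \<le> A"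
  shows "\<bar>real (fst u) - real (fst v)\<bar> \<le> (1 + 6 / e) * A + e * real k + 3 / e * mcost \<sigma> u v"
proof -
  note m = merge_pairsD[OF uv]
  define R where "R = \<bar>real (fst u) - real (fst (\<sigma> v))\<bar>"
  have col: "snd (\<sigma> v) = \<kappa> (init u)" "snd (\<sigma> u) = \<kappa> (init v)" using snd_\<sigma> m by simp_all
  have "hor u + R\<^sup>2 / (3 * real k) \<le> cdist u (\<sigma> v)"
    unfolding R_def using cdist_column_ge[OF m(1) \<sigma>_lattice[OF m(2)] col(1)] by simp
  moreover have "hor v \<le> cdist v (\<sigma> u)"
  proof -
    have "0 \<le> (real (fst v) - real (fst (\<sigma> u)))\<^sup>2 / (3 * real k)" by simp
    then show ?thesis using cdist_column_ge[OF m(2) \<sigma>_lattice[OF m(1)] col(2)] by linarith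
  qed
  moreover have "cdist u (\<sigma> u) \<le> hor u + ver u" "cdist v (\<sigma> v) \<le> hor v + ver v"
    using cdist_column_le[OF snd_\<sigma>] m by (simp_all add: ver_def)
  ultimately have "R\<^sup>2 / (3 * real k) \<le> mcost \<sigma> u v + 2 * A"
    unfolding mcost_def using A by linarith
  then have "R\<^sup>2 \<le> 3 * real k * (mcost \<sigma> u v + 2 * A)" using k by (simp add: field_simps)
  moreover have "0 \<le> mcost \<sigma> u v + 2 * A"
    using mcost_nonneg[OF uv] A(1) by (simp add: ver_def)
  ultimately have "R \<le> e * real k + 3 * (mcost \<sigma> u v + 2 * A) / e"
    using k e by (intro le_of_square_le) auto
  moreover have "\<bar>real (fst u) - real (fst v)\<bar> \<le> R + ver v" unfolding R_def ver_def by linarith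
  moreover have "3 * (mcost \<sigma> u v + 2 * A) / e = 3 / e * mcost \<sigma> u v + 6 / e * A"
    using e by (simp add: field_simps)
  ultimately have "\<bar>real (fst u) - real (fst v)\<bar> \<le> e * real k + 3 / e * mcost \<sigma> u v + 6 / e * A + A"
    using A(2) by linarith
  then show ?thesis by (simp add: distrib_right)
qed

end

text \<open>Here \<open>K\<close> stands for k, \<open>V\<close> for the rank deviation and
  \<open>X\<close> for the number of cells near their goal column. Then \<open>v\<close> bounds the
  total row displacement of \<sigma>, \<open>B\<close> the sum of all slopes, and \<open>A\<close>
  the sum over the types of a bound valid for every displacement within the type. The last bracket
  bounds the row gaps of all swaps. The parameters \<open>z\<close>, \<open>d\<close>,
  \<open>e\<close> come from linearized square roots and \<open>th\<close> is the distance
  threshold.\<close>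

definition column_overhead :: "real \<Rightarrow> real \<Rightarrow> real \<Rightarrow> real \<Rightarrow> real \<Rightarrow> real \<Rightarrow> real \<Rightarrow> real" where
  "column_overhead K z th d e V X =
    (let v = z * K ^ 3 + 3 * V / z;
         B = X + v / th + K\<^sup>2 / (2 * th);
         A = d * K\<^sup>2 + 3 * B / d
     in v + 2 * ((1 + 6 / e) * (K * A) + e * K ^ 3 + 6 * K\<^sup>2 / e))"

context column_goal
begin

lemma merged_cost:
  assumes p2: "phase2 mis init \<sigma> \<sigma>'" and pos: "0 < z" "0 < th" "0 < d" "0 < e"
  shows "(\<Sum>c\<in>mis. cdist c (\<sigma>' c)) \<le> (\<Sum>c\<in>mis. cdist c (\<sigma> c)) +
    column_overhead (real k) z th d e (rank_deviation k init) (real (card (near th)))"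
proof -
  define edge where "edge = orbit_edge \<sigma>"
  obtain F ts where F: "min_spanning_forest edges weight F"
    and ts: "distinct (map edge ts)" "set (map edge ts) = F"
    and tsD: "\<And>u v. (u, v) \<in> set ts \<Longrightarrow> (u, v) \<in> merge_pairs mis init \<sigma> \<and> mcost \<sigma> u v = weight (edge (u, v))"
    and \<sigma>': "\<sigma>' = merge_goals \<sigma> ts"
    using phase2E[OF p2] unfolding edge_def by (metis (no_types, lifting) case_prod_conv)
  define P where "P = set ts"
  have P: "finite P" "inj_on edge P" "edge ` P = F" "distinct ts"
    using ts by (auto simp: P_def distinct_map)
  have PD: "p \<in> P \<Longrightarrow> (fst p, snd p) \<in> merge_pairs mis init \<sigma> \<and> mcost \<sigma> (fst p) (snd p) = weight (edge p)" for p
    using tsD[of "fst p" "snd p"] by (simp add: P_def)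
  define K where "K = real k"
  have K: "K > 0" using k by (simp add: K_def)
  define Bt where "Bt t = (\<Sum>c\<in>of_type k init t. slope th c)" for t
  \<comment> \<open>Linearized form of \<open>ver_squared_le\<close>: a bound for the row
    displacement of every cell of type \<open>t\<close> at once.\<close>
  define At where "At t = d * K + 3 * Bt t / d" for t
  have Bt0: "0 \<le> Bt t" for t unfolding Bt_def using slope_nonneg[OF pos(2)] by (rule sum_nonneg)
  have At0: "0 \<le> At t" for t unfolding At_def using Bt0 pos(3) K by simp
  have ver: "ver u \<le> At (init u)" if "u \<in> lattice k" for u
    unfolding At_def using ver_squared_le[OF pos(2) that] pos(3) K Bt0
    by (intro le_of_square_le) (auto simp: Bt_def K_def)
  have acyc: "acyclic_edges F" using F by (auto simp: min_spanning_forest_def intro: spanning_forest_acyclic)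
  \<comment> \<open>The swaps of one type are edges of a forest whose vertices are cycles meeting
    this type, and the type has only \<open>k\<close> cells. So the bound \<open>At t\<close> is
    charged at most \<open>k\<close> times.\<close>
  have per_type: "card {p \<in> P. init (fst p) = t} \<le> k" if t: "t \<in> {1..k}" for t
  proof -
    let ?Q = "{p \<in> P. init (fst p) = t}" and ?W = "orbit \<sigma> ` of_type k init t"
    have "card ?Q = card (edge ` ?Q)" by (rule card_image[symmetric], rule inj_on_subset[OF P(2)]) auto
    also have "\<dots> \<le> card ?W"
    proof (rule acyclic_edges_card)
      show "finite (edge ` ?Q)" using P(1) by simp
      show "acyclic_edges (edge ` ?Q)" by (rule acyclic_edges_subset[OF acyc]) (use P(3) in auto)
      fix f assume "f \<in> edge ` ?Q"
      then obtain p where p: "p \<in> P" "init (fst p) = t" "f = edge p" by blast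
      then have "fst p \<in> of_type k init t" "snd p \<in> of_type k init t"
        using merge_pairsD[of "fst p" "snd p"] PD by (auto simp: of_type_def)
      then show "\<exists>a\<in>?W. \<exists>b\<in>?W. f = {a, b}" using p(3) by (auto simp: edge_def split: prod.splits)
    qed simp
    also have "\<dots> \<le> k" using card_image_le[OF finite_of_type, of "orbit \<sigma>" k init t] card_of_type[OF config t] by simp
    finally show ?thesis .
  qed
  have by_type: "(\<Sum>p\<in>P. h (init (fst p))) = (\<Sum>t\<in>{1..k}. real (card {p \<in> P. init (fst p) = t}) * h t)"
    for h :: "nat \<Rightarrow> real"
  proof -
    have "(\<lambda>p. init (fst p)) ` P \<subseteq> {1..k}"
      using PD merge_pairsD(1) init_type by blast
    then have "(\<Sum>p\<in>P. h (init (fst p))) = (\<Sum>t\<in>{1..k}. \<Sum>p\<in>{p \<in> P. init (fst p) = t}. h (init (fst p)))"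
      using P(1) by (intro sum.group[symmetric]) auto
    also have "\<dots> = (\<Sum>t\<in>{1..k}. real (card {p \<in> P. init (fst p) = t}) * h t)"
      by (intro sum.cong refl) (simp add: sum.cong)
    finally show ?thesis .
  qed
  define v where "v = z * K ^ 3 + 3 * rank_deviation k init / z"
  define B where "B = real (card (near th)) + v / th + K\<^sup>2 / (2 * th)"
  define A where "A = d * K\<^sup>2 + 3 * B / d"
  have V: "(\<Sum>c\<in>lattice k. ver c) \<le> v" unfolding v_def K_def by (rule sum_ver[OF pos(1)])
  have "(\<Sum>t\<in>{1..k}. Bt t) = (\<Sum>c\<in>lattice k. slope th c)"
    unfolding Bt_def by (rule sum_of_types[OF config, symmetric])
  also have "\<dots> \<le> real (card (near th)) + (\<Sum>c\<in>lattice k. ver c) / th + K\<^sup>2 / (2 * th)"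
    unfolding K_def by (rule sum_slope[OF pos(2)])
  also have "\<dots> \<le> B" unfolding B_def using V pos(2) by (simp add: divide_right_mono)
  finally have SB: "(\<Sum>t\<in>{1..k}. Bt t) \<le> B" .
  have "(\<Sum>t\<in>{1..k}. At t) = d * K\<^sup>2 + 3 * (\<Sum>t\<in>{1..k}. Bt t) / d"
    by (simp add: At_def sum.distrib sum_divide_distrib sum_distrib_left K_def power2_eq_square)
  also have "\<dots> \<le> A" unfolding A_def using SB pos(3) by (simp add: divide_right_mono)
  finally have SA: "(\<Sum>t\<in>{1..k}. At t) \<le> A" .
  have "(\<Sum>p\<in>P. At (init (fst p))) \<le> (\<Sum>t\<in>{1..k}. K * At t)"
    unfolding by_type using per_type At0 by (intro sum_mono mult_right_mono) (auto simp: K_def)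
  also have "\<dots> \<le> K * A" unfolding sum_distrib_left[symmetric] using SA K by (intro mult_left_mono) auto
  finally have PA: "(\<Sum>p\<in>P. At (init (fst p))) \<le> K * A" .
  have "real (card P) = (\<Sum>p\<in>P. 1)" by simp
  also have "\<dots> = (\<Sum>t\<in>{1..k}. real (card {p \<in> P. init (fst p) = t}) * 1)" by (rule by_type)
  also have "\<dots> \<le> (\<Sum>t\<in>{1..k}. K * 1)"
    using per_type by (intro sum_mono mult_right_mono) (auto simp: K_def)
  finally have cP: "real (card P) \<le> K\<^sup>2" by (simp add: K_def power2_eq_square)
  have "(\<Sum>p\<in>P. mcost \<sigma> (fst p) (snd p)) = (\<Sum>p\<in>P. weight (edge p))"
    using PD by (intro sum.cong) auto
  also have "\<dots> = (\<Sum>f\<in>F. weight f)" using sum.reindex[OF P(2), of weight] P(3) by simp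
  also have "\<dots> \<le> 2 * K\<^sup>2" unfolding K_def by (rule min_spanning_forest_weight[OF F])
  finally have PW: "(\<Sum>p\<in>P. mcost \<sigma> (fst p) (snd p)) \<le> 2 * K\<^sup>2" .
  define gap where "gap p = \<bar>real (fst (fst p)) - real (fst (snd p))\<bar>" for p :: "cell \<times> cell"
  have "(\<Sum>p\<in>P. gap p) \<le> (\<Sum>p\<in>P. (1 + 6 / e) * At (init (fst p)) + e * K + 3 / e * mcost \<sigma> (fst p) (snd p))"
  proof (rule sum_mono)
    fix p assume "p \<in> P"
    then have mp: "(fst p, snd p) \<in> merge_pairs mis init \<sigma>" using PD by blast
    note m = merge_pairsD[OF mp]
    show "gap p \<le> (1 + 6 / e) * At (init (fst p)) + e * K + 3 / e * mcost \<sigma> (fst p) (snd p)"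
      unfolding gap_def K_def using ver[OF m(1)] ver[OF m(2)] m(3)
      by (intro merge_pair_row_difference[OF mp pos(4)]) auto
  qed
  also have "\<dots> = (1 + 6 / e) * (\<Sum>p\<in>P. At (init (fst p))) + real (card P) * (e * K) +
      3 / e * (\<Sum>p\<in>P. mcost \<sigma> (fst p) (snd p))"
    by (simp only: sum.distrib sum_distrib_left sum_constant)
  also have "\<dots> \<le> (1 + 6 / e) * (K * A) + K\<^sup>2 * (e * K) + 3 / e * (2 * K\<^sup>2)"
    using PA cP PW pos(4) K by (intro add_mono mult_left_mono mult_right_mono) auto
  finally have gaps: "(\<Sum>p\<in>P. gap p) \<le> (1 + 6 / e) * (K * A) + e * K ^ 3 + 6 * K\<^sup>2 / e"
    by (simp add: power3_eq_cube power2_eq_square mult_ac)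
  define G where "G = (1 + 6 / e) * (K * A) + e * K ^ 3 + 6 * K\<^sup>2 / e"
  have "(\<Sum>(u, v)\<leftarrow>ts. \<bar>real (fst u) - real (fst v)\<bar>) = (\<Sum>p\<in>P. gap p)"
    unfolding P_def using P(4) by (simp add: sum_list_distinct_conv_sum_set gap_def case_prod_beta)
  moreover have "(\<Sum>c\<in>lattice k. \<bar>real (fst c) - real (fst (\<sigma>' c))\<bar>) \<le>
      (\<Sum>c\<in>lattice k. ver c) + 2 * (\<Sum>(u, v)\<leftarrow>ts. \<bar>real (fst u) - real (fst v)\<bar>)"
    unfolding \<sigma>' ver_def
    by (rule merge_goals_row_displacement[OF finite_lattice]) (use tsD merge_pairsD in metis)
  ultimately have rows: "(\<Sum>c\<in>lattice k. \<bar>real (fst c) - real (fst (\<sigma>' c))\<bar>) \<le>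
      v + 2 * G"
    using V gaps[folded G_def] by simp
  have ty: "\<forall>(u, v)\<in>set ts. u \<in> mis \<and> v \<in> mis \<and> init u = init v"
    using tsD by (auto simp: merge_pairs_def)
  have perm: "\<sigma>' permutes mis"
    unfolding \<sigma>' using ty by (intro merge_goals_permutes phase1D(1)[OF matching]) auto
  have goal': "\<forall>c\<in>mis. goal (\<sigma>' c) = init c"
    unfolding \<sigma>' by (rule merge_goals_types) (fact phase1D(2)[OF matching] ty)+
  \<comment> \<open>The final goal is still in the goal column, so its distance exceeds the
    horizontal one by at most the final row displacement, and the horizontal one is at most the
    phase 1 distance.\<close>
  have "(\<Sum>c\<in>mis. cdist c (\<sigma>' c)) \<le> (\<Sum>c\<in>mis. cdist c (\<sigma> c) + \<bar>real (fst c) - real (fst (\<sigma>' c))\<bar>)"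
  proof (rule sum_mono)
    fix c assume c: "c \<in> mis"
    then have l: "c \<in> lattice k" "\<sigma>' c \<in> lattice k"
      using mis_lattice permutes_in_image[OF perm] by auto
    have "goal (\<sigma>' c) = init c" using goal' c by blast
    then have "snd (\<sigma>' c) = \<kappa> (init c)" using goal_iff[OF l(2) init_type[OF l(1)]] by simp
    then have "cdist c (\<sigma>' c) \<le> hor c + \<bar>real (fst c) - real (fst (\<sigma>' c))\<bar>" by (rule cdist_column_le)
    moreover have "hor c \<le> cdist c (\<sigma> c)"
    proof -
      have "0 \<le> (real (fst c) - real (fst (\<sigma> c)))\<^sup>2 / (3 * real k)" by simp
      then show ?thesis using cdist_column_ge[OF l(1) \<sigma>_lattice[OF l(1)] snd_\<sigma>[OF l(1)]] by linarith
    qed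
    ultimately show "cdist c (\<sigma>' c) \<le> cdist c (\<sigma> c) + \<bar>real (fst c) - real (fst (\<sigma>' c))\<bar>" by linarith
  qed
  also have "\<dots> \<le> (\<Sum>c\<in>mis. cdist c (\<sigma> c)) + (\<Sum>c\<in>lattice k. \<bar>real (fst c) - real (fst (\<sigma>' c))\<bar>)"
    unfolding sum.distrib by (intro add_left_mono sum_mono2) (auto simp: misplaced_def)
  also have "\<dots> \<le> (\<Sum>c\<in>mis. cdist c (\<sigma> c)) + (v + 2 * G)"
    using rows by simp
  also have "v + 2 * G =
      column_overhead (real k) z th d e (rank_deviation k init) (real (card (near th)))"
    by (simp only: column_overhead_def Let_def G_def v_def B_def A_def K_def)
  finally show ?thesis .
qed

end

section \<open>Travel of a plan compared with the optimum, for each pattern\<close>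

lemma PlanPTR_travel_bounds:
  assumes "PlanPTR k init goal ps" "k \<ge> 1" "init \<in> configs k"
  obtains \<sigma> \<sigma>' where "phase1 k init goal \<sigma>" "phase2 (misplaced k init goal) init \<sigma> \<sigma>'"
    "\<sigma>' permutes misplaced k init goal" "\<And>c. c \<in> misplaced k init goal \<Longrightarrow> goal (\<sigma>' c) = init c"
    "travel ps \<le> (\<Sum>c\<in>misplaced k init goal. cdist c (\<sigma>' c)) + 2 * real k * (real k + 1)"
    "(\<Sum>c\<in>misplaced k init goal. cdist c (\<sigma> c)) \<le> opt_travel k init goal"
proof -
  obtain \<sigma> \<sigma>' where *: "phase1 k init goal \<sigma>" "phase2 (misplaced k init goal) init \<sigma> \<sigma>'"
    "phase3 (misplaced k init goal) \<sigma>' ps"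
    using assms by (auto simp: PlanPTR_def Let_def)
  interpret type_cycles k init goal \<sigma>' "misplaced k init goal" "{orbit \<sigma>' c | c. c \<in> misplaced k init goal}"
    using PlanPTR_cycles[OF *(1,2)] by simp_all
  let ?N = "{orbit \<sigma>' c | c. c \<in> misplaced k init goal}"
  have "init ` misplaced k init goal \<subseteq> {1..k}" using assms(3) by (auto simp: configs_def misplaced_def)
  then have "card (init ` misplaced k init goal) \<le> k" using card_mono[of "{1..k}"] by fastforce
  then have "real (card ?N) \<le> real k" using card_N_le by linarith
  then have "2 * real k * (real (card ?N) + 1) \<le> 2 * real k * (real k + 1)" by (intro mult_left_mono) auto
  then have "travel ps \<le> (\<Sum>c\<in>misplaced k init goal. cdist c (\<sigma>' c)) + 2 * real k * (real k + 1)"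
    using phase3_travel[OF *(3) assms(2)] by linarith
  then show ?thesis
    using that[OF *(1,2) s_D _ _ opt_travel_ge[OF *(1) PlanPTR_valid[OF assms(1)]]] goal_s by blast
qed

text \<open>The set \<open>near\<close> without reference to a matching, so that its size can be
  averaged over the configurations.\<close>

definition column_near :: "nat \<Rightarrow> (nat \<Rightarrow> nat) \<Rightarrow> real \<Rightarrow> (cell \<Rightarrow> nat) \<Rightarrow> cell set" where
  "column_near k \<kappa> th init = {c \<in> lattice k. \<bar>real (snd c) - real (\<kappa> (init c))\<bar> < th}"

lemma PlanPTR_column_travel:
  assumes "PlanPTR k init goal ps" "k \<ge> 1" "init \<in> configs k"
    and "\<And>p t. p \<in> lattice k \<Longrightarrow> t \<in> {1..k} \<Longrightarrow> goal p = t \<longleftrightarrow> snd p = \<kappa> t"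
    and "\<And>t. t \<in> {1..k} \<Longrightarrow> \<kappa> t < k"
    and "0 < z" "0 < th" "0 < d" "0 < e"
  shows "travel ps \<le> opt_travel k init goal +
    column_overhead (real k) z th d e (rank_deviation k init) (real (card (column_near k \<kappa> th init))) +
    2 * real k * (real k + 1)"
proof -
  obtain \<sigma> \<sigma>' where *: "phase1 k init goal \<sigma>" "phase2 (misplaced k init goal) init \<sigma> \<sigma>'"
    "travel ps \<le> (\<Sum>c\<in>misplaced k init goal. cdist c (\<sigma>' c)) + 2 * real k * (real k + 1)"
    "(\<Sum>c\<in>misplaced k init goal. cdist c (\<sigma> c)) \<le> opt_travel k init goal"
    using PlanPTR_travel_bounds[OF assms(1-3)] by blast
  interpret column_goal k init goal \<kappa> \<sigma>
    by unfold_locales (fact assms * | rule assms; assumption)+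
  have "near th = column_near k \<kappa> th init" by (simp add: near_def column_near_def hor_def)
  then show ?thesis using merged_cost[OF *(2) assms(6-9)] *(3,4) by simp
qed

lemma patternA_blocks:
  assumes "patternA m goal"
  obtains \<beta> where "bij_betw \<beta> ({0..<m} \<times> {0..<m}) {1..m^2}"
    "\<And>p. p \<in> lattice (m^2) \<Longrightarrow> (fst p div m, snd p div m) \<in> {0..<m} \<times> {0..<m}"
    "\<And>p. p \<in> lattice (m^2) \<Longrightarrow> goal p = \<beta> (fst p div m, snd p div m)"
proof -
  obtain \<beta> where \<beta>: "bij_betw \<beta> ({0..<m} \<times> {0..<m}) {1..m^2}"
    "\<And>r c. r < m^2 \<Longrightarrow> c < m^2 \<Longrightarrow> goal (r, c) = \<beta> (r div m, c div m)"
    using assms by (auto simp: patternA_def)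
  have "(fst p div m, snd p div m) \<in> {0..<m} \<times> {0..<m}" "goal p = \<beta> (fst p div m, snd p div m)"
    if "p \<in> lattice (m^2)" for p
    using that \<beta>(2)[of "fst p" "snd p"] by (auto simp: lattice_def power2_eq_square less_mult_imp_div_less)
  then show ?thesis using that \<beta>(1) by blast
qed

text \<open>However many swaps a cell takes part in, its first and its last goal lie in the same
  block. The loss of 2m on each of at most k^2 cells is of order m^5, against m^6 for the
  optimum.\<close>

lemma PlanPTR_block_travel:
  assumes "PlanPTR (m^2) init goal ps" "m \<ge> 1" "init \<in> configs (m^2)" "patternA m goal"
  shows "travel ps \<le> opt_travel (m^2) init goal + 2 * real m * (real (m^2))\<^sup>2 + 2 * real (m^2) * (real (m^2) + 1)"
proof -
  let ?k = "m^2" and ?D = "misplaced (m^2) init goal"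
  have k1: "?k \<ge> 1" using assms(2) by simp
  obtain \<sigma> \<sigma>' where *: "phase1 ?k init goal \<sigma>"
    "\<sigma>' permutes ?D" "\<And>c. c \<in> ?D \<Longrightarrow> goal (\<sigma>' c) = init c"
    "travel ps \<le> (\<Sum>c\<in>?D. cdist c (\<sigma>' c)) + 2 * real ?k * (real ?k + 1)"
    "(\<Sum>c\<in>?D. cdist c (\<sigma> c)) \<le> opt_travel ?k init goal"
    using PlanPTR_travel_bounds[OF assms(1) k1 assms(3)] by blast
  obtain \<beta> where \<beta>: "bij_betw \<beta> ({0..<m} \<times> {0..<m}) {1..m^2}"
    and blk: "\<And>p. p \<in> lattice ?k \<Longrightarrow> (fst p div m, snd p div m) \<in> {0..<m} \<times> {0..<m}"
      "\<And>p. p \<in> lattice ?k \<Longrightarrow> goal p = \<beta> (fst p div m, snd p div m)"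
    using patternA_blocks[OF assms(4)] by blast
  have div_close: "\<bar>real x - real y\<bar> \<le> real m" if "x div m = y div m" for x y
  proof -
    have "x = m * (y div m) + x mod m" using that by (metis mult_div_mod_eq)
    moreover have "y = m * (y div m) + y mod m" by simp
    moreover have "x mod m < m" "y mod m < m" using assms(2) by auto
    ultimately have "x \<le> y + m" "y \<le> x + m" by linarith+
    then show ?thesis by linarith
  qed
  have close: "cdist p q \<le> 2 * real m" if "p \<in> lattice ?k" "q \<in> lattice ?k" "goal p = goal q" for p q
  proof -
    have "(fst p div m, snd p div m) = (fst q div m, snd q div m)"
      using blk[OF that(1)] blk[OF that(2)] that(3) \<beta> by (auto simp: bij_betw_def dest: inj_onD)
    then show ?thesis using cdist_le_abs[of p q] div_close[of "fst p" "fst q"] div_close[of "snd p" "snd q"] by simp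
  qed
  have DL: "c \<in> lattice ?k" if "c \<in> ?D" for c using that by (simp add: misplaced_def)
  have "(\<Sum>c\<in>?D. cdist c (\<sigma>' c)) \<le> (\<Sum>c\<in>?D. cdist c (\<sigma> c) + 2 * real m)"
  proof (rule sum_mono)
    fix c assume c: "c \<in> ?D"
    have "\<sigma> c \<in> ?D" "\<sigma>' c \<in> ?D" using c permutes_in_image[OF phase1D(1)[OF *(1)]] permutes_in_image[OF *(2)] by auto
    moreover have "goal (\<sigma> c) = goal (\<sigma>' c)" using *(3)[OF c] phase1D(2)[OF *(1)] c by simp
    ultimately have "cdist (\<sigma> c) (\<sigma>' c) \<le> 2 * real m" using close DL by blast
    then show "cdist c (\<sigma>' c) \<le> cdist c (\<sigma> c) + 2 * real m" using cdist_triangle[of c "\<sigma>' c" "\<sigma> c"] by simp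
  qed
  also have "\<dots> = (\<Sum>c\<in>?D. cdist c (\<sigma> c)) + real (card ?D) * (2 * real m)" by (simp add: sum.distrib)
  also have "real (card ?D) \<le> (real ?k)\<^sup>2"
  proof -
    have "card ?D \<le> card (lattice ?k)" by (intro card_mono) (auto simp: misplaced_def)
    then have "card ?D \<le> ?k * ?k" by simp
    then show ?thesis by (metis of_nat_le_iff of_nat_mult power2_eq_square)
  qed
  finally show ?thesis using *(4,5) by (simp add: mult_right_mono algebra_simps)
qed

text \<open>Each misplaced item has to cover its horizontal distance to a reference column of its
  type, up to the tolerance \<open>w\<close>. Well-placed cells contribute nothing positive, so the
  sum can run over the whole lattice. The tolerance lets blocks and columns share one
  argument.\<close>

lemma opt_travel_column_lower_bound:
  assumes "PlanPTR k init goal ps" "k \<ge> 1" "init \<in> configs k"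
    and \<kappa>: "\<And>p. p \<in> lattice k \<Longrightarrow> \<bar>real (snd p) - real (\<kappa> (goal p))\<bar> \<le> w"
  shows "(\<Sum>c\<in>lattice k. \<bar>real (snd c) - real (\<kappa> (init c))\<bar>) - (real k)\<^sup>2 * w \<le> opt_travel k init goal"
proof -
  obtain \<sigma> where \<sigma>: "phase1 k init goal \<sigma>"
    "(\<Sum>c\<in>misplaced k init goal. cdist c (\<sigma> c)) \<le> opt_travel k init goal"
    using PlanPTR_travel_bounds[OF assms(1-3)] by blast
  let ?h = "\<lambda>c. \<bar>real (snd c) - real (\<kappa> (init c))\<bar> - w"
  have "(\<Sum>c\<in>lattice k. ?h c) = (\<Sum>c\<in>lattice k - misplaced k init goal. ?h c) + (\<Sum>c\<in>misplaced k init goal. ?h c)"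
    by (rule sum.subset_diff) (auto simp: misplaced_def)
  also have "(\<Sum>c\<in>lattice k - misplaced k init goal. ?h c) \<le> 0"
    using \<kappa> by (intro sum_nonpos) (auto simp: misplaced_def)
  also have "(\<Sum>c\<in>misplaced k init goal. ?h c) \<le> (\<Sum>c\<in>misplaced k init goal. cdist c (\<sigma> c))"
  proof (rule sum_mono)
    fix c assume c: "c \<in> misplaced k init goal"
    then have "\<sigma> c \<in> misplaced k init goal" using permutes_in_image[OF phase1D(1)[OF \<sigma>(1)]] by simp
    then have "\<sigma> c \<in> lattice k" by (simp add: misplaced_def)
    moreover have "goal (\<sigma> c) = init c" using phase1D(2)[OF \<sigma>(1)] c by blast
    ultimately have "\<bar>real (snd (\<sigma> c)) - real (\<kappa> (init c))\<bar> \<le> w" using \<kappa> by metis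
    moreover have "\<bar>real (snd c) - real (snd (\<sigma> c))\<bar> \<le> cdist c (\<sigma> c)"
      unfolding cdist_def by (rule real_sqrt_ge_abs2)
    ultimately show "?h c \<le> cdist c (\<sigma> c)" by linarith
  qed
  finally show ?thesis using \<sigma>(2) by (simp add: sum_subtractf power2_eq_square)
qed

section \<open>Expectations over random configurations\<close>

lemma type_counts_configs:
  assumes "init \<in> configs k" "goal ` lattice k \<subseteq> {1..k}"
    "\<And>t. t \<in> {1..k} \<Longrightarrow> card {c \<in> lattice k. goal c = t} = k"
  shows "card {c \<in> lattice k. init c = t} = card {c \<in> lattice k. goal c = t}"
proof (cases "t \<in> {1..k}")
  case True
  then show ?thesis using assms(1) assms(3)[OF True] by (simp add: configs_def)
next
  case False
  then have "{c \<in> lattice k. init c = t} = {}" "{c \<in> lattice k. goal c = t} = {}"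
    using assms(1,2) by (auto simp: configs_def)
  then show ?thesis by (simp only:)
qed

lemma patternB_columns:
  assumes "patternB k goal"
  obtains \<kappa> where "\<And>p t. p \<in> lattice k \<Longrightarrow> t \<in> {1..k} \<Longrightarrow> goal p = t \<longleftrightarrow> snd p = \<kappa> t"
    "\<And>t. t \<in> {1..k} \<Longrightarrow> \<kappa> t < k" "goal ` lattice k \<subseteq> {1..k}"
    "\<And>t. t \<in> {1..k} \<Longrightarrow> card {c \<in> lattice k. goal c = t} = k"
proof -
  obtain \<gamma> where \<gamma>: "bij_betw \<gamma> {0..<k} {1..k}" "\<And>r c. r < k \<Longrightarrow> c < k \<Longrightarrow> goal (r, c) = \<gamma> c"
    using assms by (auto simp: patternB_def)
  define \<kappa> where "\<kappa> = inv_into {0..<k} \<gamma>"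
  have g: "goal p = \<gamma> (snd p)" "snd p \<in> {0..<k}" if "p \<in> lattice k" for p
    using that \<gamma>(2)[of "fst p" "snd p"] by (auto simp: lattice_def)
  have \<kappa>: "\<kappa> t \<in> {0..<k}" "\<gamma> (\<kappa> t) = t" if "t \<in> {1..k}" for t
  proof -
    have "t \<in> \<gamma> ` {0..<k}" using that \<gamma>(1) by (simp add: bij_betw_def)
    then show "\<kappa> t \<in> {0..<k}" "\<gamma> (\<kappa> t) = t" unfolding \<kappa>_def by (rule inv_into_into, rule f_inv_into_f)
  qed
  have iff: "goal p = t \<longleftrightarrow> snd p = \<kappa> t" if "p \<in> lattice k" "t \<in> {1..k}" for p t
    using g[OF that(1)] \<kappa>[OF that(2)] \<gamma>(1) by (auto simp: bij_betw_def dest: inj_onD)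
  have "card {c \<in> lattice k. goal c = t} = k" if t: "t \<in> {1..k}" for t
  proof -
    have "{c \<in> lattice k. goal c = t} = {c \<in> lattice k. snd c = \<kappa> t}"
      using iff[OF _ t] by (intro Collect_cong conj_cong refl)
    also have "\<dots> = {0..<k} \<times> {\<kappa> t}" using \<kappa>(1)[OF t] by (auto simp: lattice_def)
    finally show ?thesis by simp
  qed
  moreover have "goal ` lattice k \<subseteq> {1..k}" using g \<gamma>(1) by (auto simp: bij_betw_def)
  ultimately show ?thesis using that[of \<kappa>] iff \<kappa>(1) by auto
qed

lemma patternA_columns:
  assumes "patternA m goal" "m \<ge> 1"
  obtains \<kappa> where "\<And>p. p \<in> lattice (m^2) \<Longrightarrow> \<bar>real (snd p) - real (\<kappa> (goal p))\<bar> \<le> real m"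
    "goal ` lattice (m^2) \<subseteq> {1..m^2}"
    "\<And>t. t \<in> {1..m^2} \<Longrightarrow> card {c \<in> lattice (m^2). goal c = t} = m^2"
proof -
  obtain \<beta> where \<beta>: "bij_betw \<beta> ({0..<m} \<times> {0..<m}) {1..m^2}"
    and blk: "\<And>p. p \<in> lattice (m^2) \<Longrightarrow> (fst p div m, snd p div m) \<in> {0..<m} \<times> {0..<m}"
      "\<And>p. p \<in> lattice (m^2) \<Longrightarrow> goal p = \<beta> (fst p div m, snd p div m)"
    using patternA_blocks[OF assms(1)] by blast
  define \<beta>' where "\<beta>' = inv_into ({0..<m} \<times> {0..<m}) \<beta>"
  \<comment> \<open>The leftmost column of the block of type \<open>t\<close>.\<close>
  define \<kappa> where "\<kappa> t = m * snd (\<beta>' t)" for t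
  have inv: "\<beta>' (\<beta> q) = q" if "q \<in> {0..<m} \<times> {0..<m}" for q
    using \<beta> that by (simp add: \<beta>'_def bij_betw_def)
  have "\<bar>real (snd p) - real (\<kappa> (goal p))\<bar> \<le> real m" if p: "p \<in> lattice (m^2)" for p
  proof -
    have \<kappa>: "\<kappa> (goal p) = m * (snd p div m)" using blk[OF p] inv by (simp add: \<kappa>_def)
    have "snd p = m * (snd p div m) + snd p mod m" by simp
    moreover have "snd p mod m < m" using assms(2) by simp
    ultimately have "\<kappa> (goal p) \<le> snd p" "snd p \<le> \<kappa> (goal p) + m" unfolding \<kappa> by linarith+
    then show ?thesis by linarith
  qed
  moreover have "card {c \<in> lattice (m^2). goal c = t} = m^2" if t: "t \<in> {1..m^2}" for t
  proof -
    have "t \<in> \<beta> ` ({0..<m} \<times> {0..<m})" using \<beta> t by (simp add: bij_betw_def)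
    then obtain i j where ij: "i < m" "j < m" "\<beta> (i, j) = t" by auto
    have dv: "x div m = a \<longleftrightarrow> x \<in> {a * m..<a * m + m}" for x a
    proof
      show "x \<in> {a * m..<a * m + m}" if "x div m = a"
        using that assms(2) div_times_less_eq_dividend[of x m] dividend_less_div_times[of m x] by auto
      show "x div m = a" if "x \<in> {a * m..<a * m + m}"
        using that by (intro div_nat_eqI) (auto simp: mult.commute)
    qed
    have "a * m + m \<le> m^2" if "a < m" for a
    proof -
      have "Suc a * m \<le> m * m" using that by (intro mult_right_mono) auto
      then show ?thesis by (simp add: power2_eq_square)
    qed
    note bound = this[OF ij(1)] this[OF ij(2)]
    have "goal c = t \<longleftrightarrow> fst c div m = i \<and> snd c div m = j" if c: "c \<in> lattice (m^2)" for c
    proof -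
      have "\<beta> (fst c div m, snd c div m) = \<beta> (i, j) \<longleftrightarrow> (fst c div m, snd c div m) = (i, j)"
        using \<beta> blk(1)[OF c] ij by (intro inj_on_eq_iff[of _ "{0..<m} \<times> {0..<m}"]) (auto simp: bij_betw_def)
      then show ?thesis using blk(2)[OF c] ij(3) by simp
    qed
    then have "{c \<in> lattice (m^2). goal c = t} = {c \<in> lattice (m^2). fst c div m = i \<and> snd c div m = j}"
      by (intro Collect_cong conj_cong refl)
    also have "\<dots> = {i * m..<i * m + m} \<times> {j * m..<j * m + m}"
      unfolding dv using bound by (auto simp: lattice_def)
    finally show ?thesis by (simp add: power2_eq_square)
  qed
  moreover have "goal ` lattice (m^2) \<subseteq> {1..m^2}"
    using blk \<beta> by (auto simp: bij_betw_def)
  ultimately show ?thesis using that by blast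
qed

section \<open>The uniform distribution: symmetry, first and second moments\<close>

lemma finite_configs [simp]: "finite (configs k)"
proof (rule finite_subset)
  show "configs k \<subseteq> {f. \<forall>c. (c \<in> lattice k \<longrightarrow> f c \<in> {1..k}) \<and> (c \<notin> lattice k \<longrightarrow> f c = 0)}"
    by (auto simp: configs_def)
qed (rule finite_set_of_finite_funs; simp)

lemma configs_nonempty: "configs k \<noteq> {}"
proof -
  define f where "f c = (if c \<in> lattice k then Suc (snd c) else 0)" for c :: cell
  have "card {c \<in> lattice k. f c = t} = k" if "t \<in> {1..k}" for t
  proof -
    have "{c \<in> lattice k. f c = t} = {0..<k} \<times> {t - 1}"
      using that by (auto simp: f_def lattice_def)
    then show ?thesis by simp
  qed
  moreover have "f ` lattice k \<subseteq> {1..k}" by (auto simp: f_def lattice_def)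
  ultimately have "f \<in> configs k" by (simp add: configs_def f_def)
  then show ?thesis by blast
qed

lemma card_configs_pos: "0 < real (card (configs k))"
  using configs_nonempty by (simp add: card_gt_0_iff)

lemma expect_mono: "(\<And>f. f \<in> configs k \<Longrightarrow> X f \<le> Y f) \<Longrightarrow> expect k X \<le> expect k Y"
  unfolding expect_def using card_configs_pos[of k] by (intro divide_right_mono sum_mono) auto

lemma expect_cong: "(\<And>f. f \<in> configs k \<Longrightarrow> X f = Y f) \<Longrightarrow> expect k X = expect k Y"
  by (simp add: expect_def cong: sum.cong)

lemma expect_add: "expect k (\<lambda>f. X f + Y f) = expect k X + expect k Y"
  by (simp add: expect_def sum.distrib add_divide_distrib)

lemma expect_cmult: "expect k (\<lambda>f. a * X f) = a * expect k X"
  by (simp add: expect_def sum_distrib_left[symmetric])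

lemma expect_const [simp]: "expect k (\<lambda>f. a) = a"
  by (simp add: expect_def configs_nonempty)

lemma expect_sum: "expect k (\<lambda>f. \<Sum>i\<in>I. X i f) = (\<Sum>i\<in>I. expect k (X i))"
  unfolding expect_def sum_divide_distrib[symmetric] by (subst sum.swap) simp

lemma configs_comp:
  assumes "\<pi> permutes lattice k" "f \<in> configs k"
  shows "f \<circ> \<pi> \<in> configs k"
proof -
  have "card {c \<in> lattice k. f (\<pi> c) = t} = card {c \<in> lattice k. f c = t}" for t
  proof (rule bij_betw_same_card)
    have "\<pi> ` {c \<in> lattice k. f (\<pi> c) = t} = {c \<in> lattice k. f c = t}"
    proof
      show "{c \<in> lattice k. f c = t} \<subseteq> \<pi> ` {c \<in> lattice k. f (\<pi> c) = t}"
      proof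
        fix d assume d: "d \<in> {c \<in> lattice k. f c = t}"
        then obtain c where "c \<in> lattice k" "d = \<pi> c" using permutes_image[OF assms(1)] by blast
        then show "d \<in> \<pi> ` {c \<in> lattice k. f (\<pi> c) = t}" using d by blast
      qed
    qed (use permutes_in_image[OF assms(1)] in auto)
    then show "bij_betw \<pi> {c \<in> lattice k. f (\<pi> c) = t} {c \<in> lattice k. f c = t}"
      using permutes_inj_on[OF assms(1)] by (simp add: bij_betw_def)
  qed
  moreover have "(f \<circ> \<pi>) c = 0" if "c \<notin> lattice k" for c
    using that assms(2) permutes_not_in[OF assms(1) that] unfolding configs_def comp_apply
    by (metis (mono_tags, lifting) mem_Collect_eq)
  moreover have "(f \<circ> \<pi>) ` lattice k \<subseteq> {1..k}"
    unfolding image_comp[symmetric] permutes_image[OF assms(1)] using assms(2) by (simp add: configs_def)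
  ultimately show ?thesis using assms(2) by (simp add: configs_def)
qed

text \<open>Permuting the cells is a bijection of the configurations. This symmetry replaces any
  explicit counting of configurations.\<close>

lemma expect_permute:
  assumes "\<pi> permutes lattice k"
  shows "expect k (\<lambda>f. X (f \<circ> \<pi>)) = expect k X"
proof -
  have "(\<Sum>f\<in>configs k. X (f \<circ> \<pi>)) = (\<Sum>f\<in>configs k. X f)"
    by (rule sum.reindex_bij_witness[of _ "\<lambda>f. f \<circ> inv \<pi>" "\<lambda>f. f \<circ> \<pi>"])
      (use assms configs_comp permutes_inv[OF assms] in
        \<open>simp_all add: comp_assoc permutes_inv_o[OF assms]\<close>)
  then show ?thesis by (simp add: expect_def)
qed

text \<open>All k^2 cells have the same probability by symmetry, and these add up to the k cells of
  type \<open>t\<close>.\<close>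

lemma expect_type_at:
  assumes "c \<in> lattice k" "t \<in> {1..k}"
  shows "expect k (\<lambda>f. of_bool (f c = t)) = 1 / real k"
proof -
  have same: "expect k (\<lambda>f. of_bool (f d = t)) = expect k (\<lambda>f. of_bool (f c = t) :: real)"
    if "d \<in> lattice k" for d
    using expect_permute[OF permutes_swap_id[OF assms(1) that], of "\<lambda>f. of_bool (f d = t)"]
    by (simp add: transpose_def)
  have "real k = expect k (\<lambda>f. \<Sum>d\<in>lattice k. of_bool (f d = t))"
  proof -
    have "(\<Sum>d\<in>lattice k. of_bool (f d = t) :: real) = real k" if "f \<in> configs k" for f
      using that assms(2) by (simp add: of_bool_def sum.If_cases Int_def configs_def)
    from expect_cong[OF this] show ?thesis by simp
  qed
  also have "\<dots> = (\<Sum>d\<in>lattice k. expect k (\<lambda>f. of_bool (f c = t)))"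
    unfolding expect_sum using same by (intro sum.cong) auto
  also have "\<dots> = real k * real k * expect k (\<lambda>f. of_bool (f c = t))" by simp
  finally show ?thesis using assms(2) by (simp add: field_simps)
qed

text \<open>All ordered pairs of distinct cells have the same probability q. Counting pairs of
  type-\<open>t\<close> cells gives k^2 = k^2 (1/k + (k^2 - 1) q), which is solved for q.\<close>

lemma expect_type_at_pair:
  assumes c: "c \<in> lattice k" "c' \<in> lattice k" "c \<noteq> c'" and t: "t \<in> {1..k}" and k: "k \<ge> 2"
  shows "expect k (\<lambda>f. of_bool (f c = t \<and> f c' = t)) = 1 / (real k * (real k + 1))"
proof -
  define q where "q a b = expect k (\<lambda>f. of_bool (f a = t \<and> f b = t) :: real)" for a b
  have comm: "q a b = q b a" for a b by (simp add: q_def conj_commute)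
  have move: "q a b = q d b" if "a \<in> lattice k" "d \<in> lattice k" "b \<noteq> a" "b \<noteq> d" for a b d
    unfolding q_def
    using expect_permute[OF permutes_swap_id[OF that(1,2)], of "\<lambda>f. of_bool (f d = t \<and> f b = t)"] that(3,4)
    by (simp add: transpose_def)
  \<comment> \<open>One cell is moved at a time by a transposition. The case distinction ensures
    that a cell is never moved onto the other cell of the pair.\<close>
  have same: "q a b = q c c'" if ab: "a \<in> lattice k" "b \<in> lattice k" "a \<noteq> b" for a b
  proof (cases "b = c")
    case True
    show ?thesis
    proof (cases "a = c'")
      case True then show ?thesis using \<open>b = c\<close> comm by simp
    next
      case False
      have "q a b = q c' b" using ab c True by (intro move) auto
      then show ?thesis using True comm by simp
    qed
  next
    case False
    have "q a b = q c b" using ab c False by (intro move) auto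
    also have "\<dots> = q b c" by (rule comm)
    also have "\<dots> = q c' c" using ab c False by (intro move) auto
    finally show ?thesis using comm by simp
  qed
  define R where "R = real k"
  have R: "R \<ge> 2" using k by (simp add: R_def)
  have "R * R = expect k (\<lambda>f. \<Sum>a\<in>lattice k. \<Sum>b\<in>lattice k. of_bool (f a = t \<and> f b = t))"
  proof -
    have "(\<Sum>a\<in>lattice k. \<Sum>b\<in>lattice k. of_bool (f a = t \<and> f b = t) :: real) = R * R" if "f \<in> configs k" for f
    proof -
      have "(\<Sum>d\<in>lattice k. of_bool (f d = t) :: real) = R"
        using that t by (simp add: of_bool_def sum.If_cases Int_def configs_def R_def)
      then show ?thesis by (simp add: of_bool_conj sum_distrib_left[symmetric] sum_distrib_right[symmetric])
    qed
    from expect_cong[OF this] show ?thesis by simp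
  qed
  also have "\<dots> = (\<Sum>a\<in>lattice k. \<Sum>b\<in>lattice k. q a b)"
    by (simp only: expect_sum q_def)
  also have "\<dots> = (\<Sum>a\<in>lattice k. 1 / R + (R * R - 1) * q c c')"
  proof (rule sum.cong[OF refl])
    fix a assume a: "a \<in> lattice k"
    have "(\<Sum>b\<in>lattice k. q a b) = q a a + (\<Sum>b\<in>lattice k - {a}. q a b)"
      by (rule sum.remove[OF finite_lattice a])
    also have "q a a = 1 / R" using expect_type_at[OF a t] by (simp add: q_def R_def)
    also have "(\<Sum>b\<in>lattice k - {a}. q a b) = (\<Sum>b\<in>lattice k - {a}. q c c')"
      by (rule sum.cong[OF refl], rule same) (use a in auto)
    also have "\<dots> = real (card (lattice k - {a})) * q c c'" by simp
    also have "real (card (lattice k - {a})) = R * R - 1"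
    proof -
      have "k * k \<ge> 1" using k by simp
      then have "real (k * k - 1) = R * R - 1" by (simp add: R_def)
      then show ?thesis using a by simp
    qed
    finally show "(\<Sum>b\<in>lattice k. q a b) = 1 / R + (R * R - 1) * q c c'" .
  qed
  also have "\<dots> = R * R * (1 / R + (R * R - 1) * q c c')" by (simp add: R_def)
  finally have "1 = 1 / R + (R * R - 1) * q c c'" using R by simp
  then have "(R - 1) * (1 / R) = (R - 1) * ((R + 1) * q c c')" using R by (simp add: field_simps)
  then have "1 / R = (R + 1) * q c c'" using R by (simp only: mult_cancel_left) simp
  then have "q c c' = 1 / R / (R + 1)" using R by simp
  then show ?thesis unfolding q_def[symmetric] R_def[symmetric] by simp
qed

text \<open>The count is a sum of j * k indicators with mean j / (j * k) each when j > 0. Distinct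
  indicators are slightly negatively correlated, and the variance comes out exactly as j (k - j) /
  (k + 1).\<close>

lemma prefix_count_variance:
  assumes t: "t \<in> {1..k}" and k: "k \<ge> 2" and j: "j \<le> k"
  shows "expect k (\<lambda>f. (real (prefix_count k f t j) - real j)\<^sup>2) \<le> real k"
proof -
  define R where "R = {c \<in> lattice k. fst c < j}"
  define K J where "K = real k" and "J = real j"
  have K: "K \<ge> 2" "0 \<le> J" "J \<le> K" using k j by (auto simp: K_def J_def)
  have "R = {0..<j} \<times> {0..<k}" using j by (auto simp: R_def lattice_def)
  then have cR: "card R = j * k" by simp
  have finR: "finite R" by (simp add: R_def)
  define b where "b c f = (of_bool (f c = t) :: real)" for c :: cell and f :: "cell \<Rightarrow> nat"
  have N: "real (prefix_count k f t j) = (\<Sum>c\<in>R. b c f)" for f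
  proof -
    have "{c \<in> of_type k f t. fst c < j} = {c \<in> R. f c = t}" by (auto simp: of_type_def R_def)
    then show ?thesis using finR by (simp add: prefix_count_def b_def of_bool_def sum.If_cases Int_def)
  qed
  have E1: "expect k (b c) = 1 / K" if "c \<in> R" for c
  proof -
    have "b c = (\<lambda>f. of_bool (f c = t))" by (simp add: b_def fun_eq_iff)
    then show ?thesis using expect_type_at[OF _ t, of c] that by (simp add: R_def K_def)
  qed
  have EN: "expect k (\<lambda>f. \<Sum>c\<in>R. b c f) = J"
    using E1 cR K by (simp add: expect_sum K_def J_def)
  have EN2: "expect k (\<lambda>f. (\<Sum>c\<in>R. b c f)\<^sup>2) = (\<Sum>c\<in>R. 1 / K + (J * K - 1) * (1 / (K * (K + 1))))"
  proof -
    have "(\<Sum>c\<in>R. b c f)\<^sup>2 = (\<Sum>c\<in>R. \<Sum>d\<in>R. b c f * b d f)" for f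
      by (simp add: power2_eq_square sum_product)
    then have "expect k (\<lambda>f. (\<Sum>c\<in>R. b c f)\<^sup>2) = (\<Sum>c\<in>R. \<Sum>d\<in>R. expect k (\<lambda>f. b c f * b d f))"
      by (simp add: expect_sum)
    also have "\<dots> = (\<Sum>c\<in>R. 1 / K + (J * K - 1) * (1 / (K * (K + 1))))"
    proof (rule sum.cong[OF refl])
      fix c assume c: "c \<in> R"
      have "(\<Sum>d\<in>R. expect k (\<lambda>f. b c f * b d f)) =
          expect k (\<lambda>f. b c f * b c f) + (\<Sum>d\<in>R - {c}. expect k (\<lambda>f. b c f * b d f))"
        by (rule sum.remove[OF finR c])
      also have "expect k (\<lambda>f. b c f * b c f) = 1 / K"
      proof -
        have "(\<lambda>f. b c f * b c f) = b c" by (simp add: b_def fun_eq_iff)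
        then show ?thesis using E1[OF c] by simp
      qed
      also have "(\<Sum>d\<in>R - {c}. expect k (\<lambda>f. b c f * b d f)) = (\<Sum>d\<in>R - {c}. 1 / (K * (K + 1)))"
      proof (rule sum.cong[OF refl])
        fix d assume d: "d \<in> R - {c}"
        have "(\<lambda>f. b c f * b d f) = (\<lambda>f. of_bool (f c = t \<and> f d = t))" by (simp add: b_def fun_eq_iff)
        moreover have "c \<noteq> d" using d by blast
        ultimately show "expect k (\<lambda>f. b c f * b d f) = 1 / (K * (K + 1))"
          using expect_type_at_pair[of c k d t] c d t k by (simp add: R_def K_def)
      qed
      also have "\<dots> = (J * K - 1) * (1 / (K * (K + 1)))"
      proof -
        have "card R \<ge> 1" using c finR by (metis One_nat_def Suc_leI card_gt_0_iff empty_iff)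
        then have "real (card (R - {c})) = J * K - 1"
          using c finR cR by (simp add: J_def K_def)
        then show ?thesis by simp
      qed
      finally show "(\<Sum>d\<in>R. expect k (\<lambda>f. b c f * b d f)) = 1 / K + (J * K - 1) * (1 / (K * (K + 1)))" .
    qed
    finally show ?thesis .
  qed
  have "expect k (\<lambda>f. (real (prefix_count k f t j) - real j)\<^sup>2) =
      expect k (\<lambda>f. (\<Sum>c\<in>R. b c f)\<^sup>2 + ((- 2 * J) * (\<Sum>c\<in>R. b c f) + J\<^sup>2))"
    unfolding N J_def[symmetric] by (simp add: power2_diff algebra_simps)
  also have "\<dots> = (\<Sum>c\<in>R. 1 / K + (J * K - 1) * (1 / (K * (K + 1)))) + ((- 2 * J) * J + J\<^sup>2)"
    by (simp only: expect_add expect_cmult expect_const EN EN2)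
  also have "\<dots> = J * K * (1 / K + (J * K - 1) * (1 / (K * (K + 1)))) - J * J"
    by (simp add: cR J_def K_def power2_eq_square)
  also have "\<dots> = J * (K - J) / (K + 1)" using K by (simp add: divide_simps) (simp add: algebra_simps)
  also have "\<dots> \<le> K"
  proof -
    have "J * (K - J) \<le> K * (K + 1)" using K by (intro mult_mono) auto
    then show ?thesis using K by (simp add: divide_le_eq)
  qed
  finally show ?thesis by (simp add: K_def)
qed

section \<open>Asymptotic optimality\<close>

text \<open>The standard deviation of a prefix count is at most m, the square root of k, and there
  are k^2 pairs of a type and a threshold. The first absolute moment is reached through |x| \<le>
  x^2/(2m) + m/2, which is best at |x| = m.\<close>

lemma expect_rank_deviation:
  assumes m: "m \<ge> 2" and k: "k = m^2"
  shows "expect k (rank_deviation k) \<le> (real k)\<^sup>2 * real m"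
proof -
  have "2 \<le> m * m" using mult_le_mono[OF m m] by simp
  then have k2: "k \<ge> 2" by (simp add: k power2_eq_square)
  have M: "real m > 0" "real k = real m * real m" using m by (auto simp: k power2_eq_square)
  have dev: "expect k (\<lambda>f. \<bar>real (prefix_count k f t j) - real j\<bar>) \<le> real m"
    if "t \<in> {1..k}" "j \<in> {1..k}" for t j
  proof -
    have "\<bar>x\<bar> \<le> 1 / (2 * real m) * x\<^sup>2 + real m / 2" for x :: real
    proof -
      have "(\<bar>x\<bar> - real m)\<^sup>2 = x\<^sup>2 - 2 * \<bar>x\<bar> * real m + real m * real m"
        by (simp add: power2_diff power2_eq_square[of "real m"])
      then have "2 * \<bar>x\<bar> * real m \<le> x\<^sup>2 + real m * real m"
        using zero_le_power2[of "\<bar>x\<bar> - real m"] by linarith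
      then show ?thesis using M(1) by (simp add: field_simps)
    qed
    then have "expect k (\<lambda>f. \<bar>real (prefix_count k f t j) - real j\<bar>) \<le>
        expect k (\<lambda>f. 1 / (2 * real m) * (real (prefix_count k f t j) - real j)\<^sup>2 + real m / 2)"
      by (intro expect_mono)
    also have "\<dots> = 1 / (2 * real m) * expect k (\<lambda>f. (real (prefix_count k f t j) - real j)\<^sup>2) + real m / 2"
      by (simp only: expect_add expect_cmult expect_const)
    also have "\<dots> \<le> 1 / (2 * real m) * real k + real m / 2"
      using prefix_count_variance[OF that(1) k2, of j] that(2) M(1) by (intro add_right_mono mult_left_mono) auto
    also have "\<dots> = real m" using M by simp
    finally show ?thesis .
  qed
  have "expect k (rank_deviation k) \<le>
      expect k (\<lambda>f. \<Sum>t\<in>{1..k}. \<Sum>j\<in>{1..k}. \<bar>real (prefix_count k f t j) - real j\<bar>)"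
    by (intro expect_mono) (simp add: rank_deviation_eq)
  also have "\<dots> = (\<Sum>t\<in>{1..k}. \<Sum>j\<in>{1..k}. expect k (\<lambda>f. \<bar>real (prefix_count k f t j) - real j\<bar>))"
    by (simp only: expect_sum)
  also have "\<dots> \<le> (\<Sum>t\<in>{1..k}. \<Sum>j\<in>{1..k}. real m)" by (intro sum_mono dev)
  finally show ?thesis by (simp add: power2_eq_square)
qed

lemma card_near_le:
  fixes a th :: real
  assumes "0 < th"
  shows "real (card {j \<in> {0..<k}. \<bar>real j - a\<bar> < th}) \<le> 2 * th + 1"
proof -
  let ?S = "{j \<in> {0..<k}. \<bar>real j - a\<bar> < th}"
  have "int ` ?S \<subseteq> {\<lceil>a - th\<rceil>..\<lfloor>a + th\<rfloor>}"
    by (auto simp: ceiling_le_iff le_floor_iff)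
  then have "card (int ` ?S) \<le> card {\<lceil>a - th\<rceil>..\<lfloor>a + th\<rfloor>}" by (intro card_mono) auto
  moreover have "card (int ` ?S) = card ?S" by (rule card_image) (simp add: inj_on_def)
  ultimately have "real (card ?S) \<le> real (nat (\<lfloor>a + th\<rfloor> - \<lceil>a - th\<rceil> + 1))" by simp
  also have "\<dots> \<le> 2 * th + 1" using assms by (cases "\<lfloor>a + th\<rfloor> - \<lceil>a - th\<rceil> + 1 \<ge> 0"; linarith)
  finally show ?thesis .
qed

text \<open>For a fixed type at most k (2 * th + 1) cells lie close to its column, and each of them
  has this type with probability 1/k; there are k types.\<close>

lemma expect_column_near:
  assumes th: "0 < th" and k: "k \<ge> 1"
  shows "expect k (\<lambda>f. real (card (column_near k \<kappa> th f))) \<le> real k * (2 * th + 1)"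
proof -
  define I where "I c t = (of_bool (\<bar>real (snd c) - real (\<kappa> t)\<bar> < th) :: real)" for c :: cell and t
  have pt: "real (card (column_near k \<kappa> th f)) = (\<Sum>c\<in>lattice k. \<Sum>t\<in>{1..k}. I c t * of_bool (f c = t))"
    if f: "f \<in> configs k" for f
  proof -
    have "(\<Sum>t\<in>{1..k}. I c t * of_bool (f c = t)) = I c (f c)" if "c \<in> lattice k" for c
    proof -
      have "f c \<in> {1..k}" using f that by (auto simp: configs_def)
      then show ?thesis by (simp add: of_bool_def if_distrib[of "\<lambda>x. _ * x"] cong: if_cong)
    qed
    then have "(\<Sum>c\<in>lattice k. \<Sum>t\<in>{1..k}. I c t * of_bool (f c = t)) = (\<Sum>c\<in>lattice k. I c (f c))"
      by (rule sum.cong[OF refl])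
    also have "\<dots> = real (card (column_near k \<kappa> th f))"
      by (simp add: I_def column_near_def of_bool_def sum.If_cases Int_def)
    finally show ?thesis by simp
  qed
  have col: "(\<Sum>c\<in>lattice k. I c t) \<le> real k * (2 * th + 1)" for t
  proof -
    let ?S = "{j \<in> {0..<k}. \<bar>real j - real (\<kappa> t)\<bar> < th}"
    have "(\<Sum>c\<in>lattice k. I c t) = real (card {c \<in> lattice k. \<bar>real (snd c) - real (\<kappa> t)\<bar> < th})"
      by (simp add: I_def of_bool_def sum.If_cases Int_def)
    also have "{c \<in> lattice k. \<bar>real (snd c) - real (\<kappa> t)\<bar> < th} = {0..<k} \<times> ?S"
      by (auto simp: lattice_def)
    also have "real (card ({0..<k} \<times> ?S)) = real k * real (card ?S)" by (simp add: card_cartesian_product)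
    also have "\<dots> \<le> real k * (2 * th + 1)" using card_near_le[OF th] by (intro mult_left_mono) auto
    finally show ?thesis .
  qed
  have "expect k (\<lambda>f. real (card (column_near k \<kappa> th f))) \<le>
      expect k (\<lambda>f. \<Sum>c\<in>lattice k. \<Sum>t\<in>{1..k}. I c t * of_bool (f c = t))"
    by (intro expect_mono) (simp only: pt)
  also have "\<dots> = (\<Sum>c\<in>lattice k. \<Sum>t\<in>{1..k}. I c t * expect k (\<lambda>f. of_bool (f c = t)))"
    by (simp only: expect_sum expect_cmult)
  also have "\<dots> = (\<Sum>c\<in>lattice k. \<Sum>t\<in>{1..k}. I c t * (1 / real k))"
    by (intro sum.cong refl) (simp only: expect_type_at)
  also have "\<dots> = (\<Sum>t\<in>{1..k}. \<Sum>c\<in>lattice k. I c t * (1 / real k))" by (rule sum.swap)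
  also have "\<dots> = (\<Sum>t\<in>{1..k}. (\<Sum>c\<in>lattice k. I c t) * (1 / real k))" by (simp only: sum_distrib_right)
  also have "\<dots> \<le> (\<Sum>t\<in>{1..k}. (real k * (2 * th + 1)) * (1 / real k))"
    using col by (intro sum_mono mult_right_mono) auto
  also have "\<dots> = real k * (2 * th + 1)" using k by simp
  finally show ?thesis .
qed

text \<open>Because |x| \<le> k for every summand, k |x| \<ge> x^2, and the sum of squares has a
  closed form without a parity distinction. The induction needs the shift k - 1 replaced by a free
  \<open>c\<close>.\<close>

lemma sum_reflected_columns: "real k * ((real k)\<^sup>2 - 1) / 3 \<le> (\<Sum>j<k. real k * \<bar>real k - 1 - 2 * real j\<bar>)"
proof -
  have closed: "(\<Sum>j<n. (c - 2 * real j)\<^sup>2) =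
      real n * c\<^sup>2 - 2 * c * real n * (real n - 1) + 2 * real n * (real n - 1) * (2 * real n - 1) / 3" for n and c :: real
    by (induction n) (simp_all add: power2_eq_square field_simps)
  have "(real k - 1 - 2 * real j)\<^sup>2 \<le> real k * \<bar>real k - 1 - 2 * real j\<bar>" if "j < k" for j
  proof -
    have "\<bar>real k - 1 - 2 * real j\<bar> * \<bar>real k - 1 - 2 * real j\<bar> \<le> real k * \<bar>real k - 1 - 2 * real j\<bar>"
      using that by (intro mult_right_mono) linarith+
    then show ?thesis by (simp add: power2_eq_square)
  qed
  then have "(\<Sum>j<k. (real k - 1 - 2 * real j)\<^sup>2) \<le> (\<Sum>j<k. real k * \<bar>real k - 1 - 2 * real j\<bar>)"
    by (intro sum_mono) auto
  moreover have "(\<Sum>j<k. (real k - 1 - 2 * real j)\<^sup>2) = real k * ((real k)\<^sup>2 - 1) / 3"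
    unfolding closed by (simp add: power2_eq_square field_simps)
  ultimately show ?thesis by simp
qed

text \<open>Reflecting the columns preserves the distribution, and the column distances of a cell and of
  its mirror image to any fixed column add up to at least the distance of the two cells.\<close>

lemma expect_column_distance:
  "real k * ((real k)\<^sup>2 - 1) / 6 \<le> expect k (\<lambda>f. \<Sum>c\<in>lattice k. \<bar>real (snd c) - real (\<kappa> (f c))\<bar>)"
proof -
  define \<rho> where "\<rho> c = (if c \<in> lattice k then (fst c, k - 1 - snd c) else c)" for c :: cell
  have \<rho>L: "\<rho> c \<in> lattice k" if "c \<in> lattice k" for c using that by (auto simp: \<rho>_def lattice_def)
  have inv: "\<rho> (\<rho> c) = c" for c by (auto simp: \<rho>_def lattice_def)
  have "bij_betw \<rho> (lattice k) (lattice k)"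
    by (rule bij_betw_byWitness[of _ \<rho>]) (use inv \<rho>L in auto)
  then have per: "\<rho> permutes lattice k" by (rule bij_imp_permutes) (simp add: \<rho>_def)
  define X where "X f = (\<Sum>c\<in>lattice k. \<bar>real (snd c) - real (\<kappa> (f c))\<bar>)" for f
  have refl: "X (f \<circ> \<rho>) = (\<Sum>c\<in>lattice k. \<bar>real (snd (\<rho> c)) - real (\<kappa> (f c))\<bar>)" for f
    unfolding X_def
    by (rule sum.reindex_bij_witness[of _ \<rho> \<rho>]) (use inv \<rho>L in auto)
  have "real k * ((real k)\<^sup>2 - 1) / 3 \<le> X f + X (f \<circ> \<rho>)" for f
  proof -
    have "real k * ((real k)\<^sup>2 - 1) / 3 \<le> (\<Sum>j<k. real k * \<bar>real k - 1 - 2 * real j\<bar>)"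
      by (rule sum_reflected_columns)
    also have "\<dots> = (\<Sum>i<k. \<Sum>j<k. \<bar>real k - 1 - 2 * real j\<bar>)" by (simp add: sum_distrib_left)
    also have "\<dots> = (\<Sum>c\<in>lattice k. \<bar>real k - 1 - 2 * real (snd c)\<bar>)"
      by (simp only: lattice_def atLeast0LessThan sum.cartesian_product case_prod_unfold)
    also have "\<dots> \<le> (\<Sum>c\<in>lattice k. \<bar>real (snd c) - real (\<kappa> (f c))\<bar> + \<bar>real (snd (\<rho> c)) - real (\<kappa> (f c))\<bar>)"
    proof (rule sum_mono)
      fix c assume c: "c \<in> lattice k"
      then have "real (snd (\<rho> c)) = real k - 1 - real (snd c)" by (auto simp: \<rho>_def lattice_def)
      then show "\<bar>real k - 1 - 2 * real (snd c)\<bar> \<le>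
          \<bar>real (snd c) - real (\<kappa> (f c))\<bar> + \<bar>real (snd (\<rho> c)) - real (\<kappa> (f c))\<bar>" by linarith
    qed
    also have "\<dots> = X f + X (f \<circ> \<rho>)" unfolding refl by (simp add: X_def sum.distrib)
    finally show ?thesis .
  qed
  then have "expect k (\<lambda>f. real k * ((real k)\<^sup>2 - 1) / 3) \<le> expect k (\<lambda>f. X f + X (f \<circ> \<rho>))"
    by (intro expect_mono)
  also have "\<dots> = 2 * expect k X" by (simp add: expect_add expect_permute[OF per])
  finally show ?thesis by (simp add: X_def[abs_def])
qed

text \<open>The payoff of linearizing all square roots: the overhead is affine with nonnegative
  coefficients in both random quantities, so bounds on their expectations can be
  substituted.\<close>

lemma column_overhead_affine:
  assumes "0 < z" "0 < th" "0 < d" "0 < e"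
  shows "column_overhead K z th d e V X = column_overhead K z th d e 0 0 +
    (3 / z + 18 * (1 + 6 / e) * K / (d * th * z)) * V + 6 * (1 + 6 / e) * K / d * X"
  using assms by (simp add: column_overhead_def Let_def field_simps)

lemma expect_column_overhead:
  assumes pos: "0 < z" "0 < th" "0 < d" "0 < e" "0 \<le> K"
    and "expect k V \<le> v" "expect k X \<le> x"
  shows "expect k (\<lambda>f. column_overhead K z th d e (V f) (X f)) \<le> column_overhead K z th d e v x"
proof -
  define a b where "a = 3 / z + 18 * (1 + 6 / e) * K / (d * th * z)" and "b = 6 * (1 + 6 / e) * K / d"
  have ab: "0 \<le> a" "0 \<le> b" using pos by (auto simp: a_def b_def)
  have aff: "column_overhead K z th d e V X = column_overhead K z th d e 0 0 + a * V + b * X" for V X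
    unfolding a_def b_def by (rule column_overhead_affine[OF pos(1-4)])
  have "expect k (\<lambda>f. column_overhead K z th d e (V f) (X f)) =
      column_overhead K z th d e 0 0 + a * expect k V + b * expect k X"
    unfolding aff[of "V _"] by (simp only: expect_add expect_cmult expect_const)
  also have "\<dots> \<le> column_overhead K z th d e 0 0 + a * v + b * x"
    using assms(6,7) ab by (intro add_mono mult_left_mono) auto
  also have "\<dots> = column_overhead K z th d e v x" by (rule aff[symmetric])
  finally show ?thesis .
qed

definition block_bound :: "real \<Rightarrow> real" where
  "block_bound M = 2 * M * (M\<^sup>2)\<^sup>2"

text \<open>The exponents balance the error terms of \<open>column_overhead\<close>, with \<open>k = M\<^sup>2\<close>.\<close>

definition column_bound :: "real \<Rightarrow> real" where
  "column_bound M = column_overhead (M\<^sup>2) (M powr (-1/2)) (M powr (7/4)) (M powr (-1/8)) (M powr (-1/16))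
     ((M\<^sup>2)\<^sup>2 * M) (M\<^sup>2 * (2 * M powr (7/4) + 1))"

lemma column_bound_nonneg: "1 \<le> M \<Longrightarrow> 0 \<le> column_bound M"
  unfolding column_bound_def column_overhead_def Let_def by (intro add_nonneg_nonneg mult_nonneg_nonneg divide_nonneg_nonneg) auto

text \<open>The pattern may change with \<open>m\<close>, so the limit argument needs one bound for
  both; the overheads of the two patterns are simply added, each being nonnegative.\<close>

lemma expected_travel_bound:
  assumes m: "m \<ge> 2" and pat: "patternA m goal \<or> patternB (m^2) goal"
    and sel: "\<And>f. f \<in> configs (m^2) \<Longrightarrow> PlanPTR (m^2) f goal (sel f)"
  shows "expect (m^2) (\<lambda>f. travel (sel f)) \<le> expect (m^2) (\<lambda>f. opt_travel (m^2) f goal) +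
    (block_bound (real m) + column_bound (real m) + 2 * (real m)\<^sup>2 * ((real m)\<^sup>2 + 1))"
    (is "?E \<le> ?O + ?B")
proof -
  define k where "k = m^2"
  have k1: "k \<ge> 1" using m by (simp add: k_def)
  have K: "real k = (real m)\<^sup>2" by (simp add: k_def)
  have M: "real m \<ge> 1" using m by simp
  from pat show ?thesis
  proof
    assume A: "patternA m goal"
    have "?E \<le> expect k (\<lambda>f. opt_travel k f goal + (block_bound (real m) + 2 * (real m)\<^sup>2 * ((real m)\<^sup>2 + 1)))"
      unfolding k_def
    proof (rule expect_mono)
      fix f assume f: "f \<in> configs (m^2)"
      show "travel (sel f) \<le> opt_travel (m^2) f goal + (block_bound (real m) + 2 * (real m)\<^sup>2 * ((real m)\<^sup>2 + 1))"
        using PlanPTR_block_travel[OF sel[OF f] _ f A] m by (simp add: block_bound_def)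
    qed
    also have "\<dots> = ?O + (block_bound (real m) + 2 * (real m)\<^sup>2 * ((real m)\<^sup>2 + 1))"
      unfolding k_def by (simp only: expect_add expect_const)
    finally show ?thesis using column_bound_nonneg[OF M] by simp
  next
    assume "patternB (m^2) goal"
    then obtain \<kappa> where \<kappa>: "\<And>p t. p \<in> lattice k \<Longrightarrow> t \<in> {1..k} \<Longrightarrow> goal p = t \<longleftrightarrow> snd p = \<kappa> t"
      "\<And>t. t \<in> {1..k} \<Longrightarrow> \<kappa> t < k"
      unfolding k_def by (rule patternB_columns) blast
    define z th d e where "z = real m powr (-1/2)" and "th = real m powr (7/4)"
      and "d = real m powr (-1/8)" and "e = real m powr (-1/16)"
    have pos: "0 < z" "0 < th" "0 < d" "0 < e" using m by (auto simp: z_def th_def d_def e_def)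
    define over where "over f = column_overhead (real k) z th d e (rank_deviation k f)
        (real (card (column_near k \<kappa> th f)))" for f
    have "?E \<le> expect k (\<lambda>f. opt_travel k f goal + (over f + 2 * real k * (real k + 1)))"
      unfolding k_def
    proof (rule expect_mono)
      fix f assume "f \<in> configs (m^2)"
      then have f: "f \<in> configs k" by (simp add: k_def)
      show "travel (sel f) \<le> opt_travel (m^2) f goal + (over f + 2 * real (m^2) * (real (m^2) + 1))"
        using PlanPTR_column_travel[OF sel[OF f[unfolded k_def], folded k_def] k1 f \<kappa> pos]
        by (simp add: over_def k_def)
    qed
    also have "\<dots> = ?O + (expect k over + 2 * real k * (real k + 1))"
      unfolding k_def by (simp only: expect_add expect_const)
    also have "expect k over \<le> column_overhead (real k) z th d e ((real k)\<^sup>2 * real m) (real k * (2 * th + 1))"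
      unfolding over_def
      using expect_rank_deviation[OF m k_def] expect_column_near[OF pos(2) k1]
      by (intro expect_column_overhead pos) auto
    also have "\<dots> = column_bound (real m)"
      by (simp add: column_bound_def K z_def th_def d_def e_def)
    finally have "?E \<le> ?O + (column_bound (real m) + 2 * (real m)\<^sup>2 * ((real m)\<^sup>2 + 1))"
      by (simp add: K)
    moreover have "0 \<le> block_bound (real m)" by (simp add: block_bound_def)
    ultimately show ?thesis by linarith
  qed
qed

lemma expected_opt_lower_bound:
  assumes m: "m \<ge> 1" and pat: "patternA m goal \<or> patternB (m^2) goal"
    and sel: "\<And>f. f \<in> configs (m^2) \<Longrightarrow> PlanPTR (m^2) f goal (sel f)"
  shows "(real m)\<^sup>2 * (((real m)\<^sup>2)\<^sup>2 - 1) / 6 - ((real m)\<^sup>2)\<^sup>2 * real m \<le> expect (m^2) (\<lambda>f. opt_travel (m^2) f goal)"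
proof -
  define k where "k = m^2"
  have k1: "k \<ge> 1" using m by (simp add: k_def)
  have "\<exists>\<kappa>. \<forall>p\<in>lattice k. \<bar>real (snd p) - real (\<kappa> (goal p))\<bar> \<le> real m"
    using pat
  proof
    assume "patternA m goal"
    then show ?thesis unfolding k_def using m by (rule patternA_columns) blast
  next
    assume "patternB (m^2) goal"
    then show ?thesis
    proof (rule patternB_columns)
      fix \<kappa> assume \<kappa>: "\<And>p t. p \<in> lattice (m^2) \<Longrightarrow> t \<in> {1..m^2} \<Longrightarrow> goal p = t \<longleftrightarrow> snd p = \<kappa> t"
        and g: "goal ` lattice (m^2) \<subseteq> {1..m^2}"
      have "snd p = \<kappa> (goal p)" if "p \<in> lattice k" for p
        using \<kappa>[of p "goal p"] g that by (auto simp: k_def)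
      then show ?thesis by (intro exI[of _ \<kappa>]) simp
    qed
  qed
  then obtain \<kappa> where \<kappa>: "\<And>p. p \<in> lattice k \<Longrightarrow> \<bar>real (snd p) - real (\<kappa> (goal p))\<bar> \<le> real m" by blast
  define X where "X f = (\<Sum>c\<in>lattice k. \<bar>real (snd c) - real (\<kappa> (f c))\<bar>)" for f
  have "real k * ((real k)\<^sup>2 - 1) / 6 - (real k)\<^sup>2 * real m \<le> expect k X + (- ((real k)\<^sup>2 * real m))"
    using expect_column_distance[of k \<kappa>] by (simp add: X_def[abs_def])
  also have "\<dots> = expect k (\<lambda>f. X f + (- ((real k)\<^sup>2 * real m)))"
    by (simp only: expect_add expect_const)
  also have "\<dots> \<le> expect k (\<lambda>f. opt_travel k f goal)"
  proof (rule expect_mono)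
    fix f assume f: "f \<in> configs k"
    show "X f + (- ((real k)\<^sup>2 * real m)) \<le> opt_travel k f goal"
      using opt_travel_column_lower_bound[OF sel[OF f[unfolded k_def], folded k_def] k1 f \<kappa>] by (simp add: X_def)
  qed
  finally show ?thesis by (simp add: k_def)
qed

text \<open>In terms of M = m the orders are M^(11/2) for \<open>v\<close>, M^(15/4) for
  \<open>B\<close> and M^(31/8) for \<open>A\<close>. The column overhead is therefore of order
  M^(95/16) and the block overhead of order M^5, while the denominator grows like M^6/6.\<close>

lemma overhead_negligible:
  "(\<lambda>m. (block_bound (real m) + column_bound (real m) + 2 * (real m)\<^sup>2 * ((real m)\<^sup>2 + 1)) /
     ((real m)\<^sup>2 * (((real m)\<^sup>2)\<^sup>2 - 1) / 6 - ((real m)\<^sup>2)\<^sup>2 * real m)) \<longlonglongrightarrow> 0"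
  unfolding block_bound_def column_bound_def column_overhead_def Let_def by real_asymp

lemma opt_lower_bound_pos:
  "eventually (\<lambda>m. 0 < (real m)\<^sup>2 * (((real m)\<^sup>2)\<^sup>2 - 1) / 6 - ((real m)\<^sup>2)\<^sup>2 * real m) at_top"
  by real_asymp

lemma pattern_type_counts:
  assumes "m \<ge> 1" "patternA m goal \<or> patternB (m^2) goal" "init \<in> configs (m^2)"
  shows "card {c \<in> lattice (m^2). init c = t} = card {c \<in> lattice (m^2). goal c = t}"
  using assms(2)
proof
  assume A: "patternA m goal"
  show ?thesis by (rule patternA_columns[OF A assms(1)]) (rule type_counts_configs[OF assms(3)])
next
  assume B: "patternB (m^2) goal"
  show ?thesis by (rule patternB_columns[OF B]) (rule type_counts_configs[OF assms(3)])
qed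

theorem theorem4:
  fixes G :: "nat \<Rightarrow> cell \<Rightarrow> nat"
  assumes pat: "\<forall>m\<ge>1. patternA m (G m) \<or> patternB (m^2) (G m)"
  shows "(\<forall>m\<ge>1. \<forall>init\<in>configs (m^2). \<exists>ps. PlanPTR (m^2) init (G m) ps)
       \<and> (\<forall>m\<ge>1. \<forall>init\<in>configs (m^2). \<forall>ps. PlanPTR (m^2) init (G m) ps \<longrightarrow>
             valid_plan (m^2) init (G m) ps \<and> length ps = min_pns (m^2) init (G m))
       \<and> (\<forall>sel :: nat \<Rightarrow> (cell \<Rightarrow> nat) \<Rightarrow> cell list.
             (\<forall>m\<ge>1. \<forall>init\<in>configs (m^2). PlanPTR (m^2) init (G m) (sel m init)) \<longrightarrow>
             (\<lambda>m. expect (m^2) (\<lambda>init. travel (sel m init))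
                  / expect (m^2) (\<lambda>init. opt_travel (m^2) init (G m))) \<longlonglongrightarrow> 1)"
proof (intro conjI allI ballI impI)
  fix m :: nat and init assume "m \<ge> 1" "init \<in> configs (m^2)"
  then show "\<exists>ps. PlanPTR (m^2) init (G m) ps"
    using pat by (intro PlanPTR_exists pattern_type_counts) auto
next
  fix m :: nat and init ps assume "PlanPTR (m^2) init (G m) ps"
  then show "valid_plan (m^2) init (G m) ps" "length ps = min_pns (m^2) init (G m)"
    by (rule PlanPTR_valid)+
next
  fix sel :: "nat \<Rightarrow> (cell \<Rightarrow> nat) \<Rightarrow> cell list"
  assume sel: "\<forall>m\<ge>1. \<forall>init\<in>configs (m^2). PlanPTR (m^2) init (G m) (sel m init)"
  define T where "T m = expect (m^2) (\<lambda>init. travel (sel m init))" for m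
  define Opt where "Opt m = expect (m^2) (\<lambda>init. opt_travel (m^2) init (G m))" for m
  define B where "B m = block_bound (real m) + column_bound (real m) + 2 * (real m)\<^sup>2 * ((real m)\<^sup>2 + 1)" for m :: nat
  define L where "L m = (real m)\<^sup>2 * (((real m)\<^sup>2)\<^sup>2 - 1) / 6 - ((real m)\<^sup>2)\<^sup>2 * real m" for m :: nat
  \<comment> \<open>Positivity of \<open>L m\<close> makes the expected optimum positive, so the
    quotient is meaningful and \<open>Opt m\<close> may be replaced by the smaller
    \<open>L m\<close> in the error term.\<close>
  have bounds: "1 \<le> T m / Opt m \<and> T m / Opt m \<le> 1 + B m / L m" if m: "m \<ge> 2" and L: "0 < L m" for m
  proof -
    have p: "patternA m (G m) \<or> patternB (m^2) (G m)" using pat m by simp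
    have s: "PlanPTR (m^2) f (G m) (sel m f)" if "f \<in> configs (m^2)" for f using sel m that by simp
    have "Opt m \<le> T m"
      unfolding Opt_def T_def
      by (intro expect_mono opt_travel_le PlanPTR_valid) (use s in auto)
    moreover have "T m \<le> Opt m + B m" unfolding Opt_def T_def B_def by (rule expected_travel_bound[OF m p s])
    moreover have LO: "L m \<le> Opt m"
      unfolding Opt_def L_def by (rule expected_opt_lower_bound[OF _ p s]) (use m in simp)
    ultimately have "1 \<le> T m / Opt m" "T m / Opt m \<le> (Opt m + B m) / Opt m" "0 \<le> B m"
      using L by (auto intro: divide_right_mono)
    moreover have "(Opt m + B m) / Opt m = 1 + B m / Opt m" using L LO by (simp add: field_simps)
    moreover have "B m / Opt m \<le> B m / L m" using L LO \<open>0 \<le> B m\<close> by (intro divide_left_mono) auto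
    ultimately show ?thesis by simp
  qed
  have ev: "eventually (\<lambda>m. m \<ge> 2 \<and> 0 < L m) at_top"
    using opt_lower_bound_pos eventually_ge_at_top[of 2] unfolding L_def by eventually_elim simp
  have "(\<lambda>m. T m / Opt m) \<longlonglongrightarrow> 1"
  proof (rule tendsto_sandwich)
    show "eventually (\<lambda>m. 1 \<le> T m / Opt m) at_top" using ev by eventually_elim (use bounds in blast)
    show "eventually (\<lambda>m. T m / Opt m \<le> 1 + B m / L m) at_top" using ev by eventually_elim (use bounds in blast)
    show "(\<lambda>m. 1 + B m / L m) \<longlonglongrightarrow> 1"
      using tendsto_add[OF tendsto_const[of 1] overhead_negligible] by (simp add: B_def L_def)
  qed simp
  then show "(\<lambda>m. expect (m^2) (\<lambda>init. travel (sel m init))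
      / expect (m^2) (\<lambda>init. opt_travel (m^2) init (G m))) \<longlonglongrightarrow> 1"
    by (simp only: T_def Opt_def)
qed

end
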